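(* Let $L>0$, suppose that $m=n^p$ for some $p\in(0,1/2)$, and let $s_2>s_1>\frac{1}{4p}-\frac12$. Then there exist (small enough) constants $\varepsilon_1,\varepsilon_2>0$, depending only on $s_1,s_2$ and $p$, such that there does not exist a distributed estimator $\hat f$ with numbers of transmitted bits $(\hat B^{(1)},\dots,\hat B^{(m)})$ satisfying simultaneously $\hat B^{(i)}\le n^{\frac{1}{1+2s_1}+\varepsilon_1}\log n$ for $i=1,\dots,m$ and, for both $\ell=1,2$, $$\sup_{i\in\{1,\dots,m\}}\ \sup_{f_0\in B^{s_\ell}_{2,\infty}(L)}E^{(i)}_{f_0}\hat B^{(i)}\lesssim n^{\frac{1}{1+2s_\ell}+\varepsilon_1}$$ and $$\sup_{f_0\in B^{s_\ell}_{2,\infty}(L)}E_{f_0}\|\hat f-f_0\|_2^2\lesssim n^{-\frac{2s_\ell}{1+2s_\ell}+\varepsilon_2}.$$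
   Context: Model (distributed Gaussian white noise): there are $m=m_n$ machines; machine $i\in\{1,\dots,m\}$ observes the process $X^{(i)}$ with $dX^{(i)}_t=f_0(t)\,dt+\sqrt{m/n}\,dW^{(i)}_t$, $t\in[0,1]$, where $W^{(1)},\dots,W^{(m)}$ are independent standard Wiener processes and $f_0\in L_2[0,1]$ is unknown. $E_{f_0}$ denotes expectation under the joint law of all data (and any randomization), $E^{(i)}_{f_0}$ expectation under the law of $X^{(i)}$ (and the local randomization of machine $i$). When $m=n^p$, $n^p$ is understood as rounded to an integer if necessary. Distributed estimator: independently of each other, each machine $i$ produces from its own data $X^{(i)}$ (possibly with additional local randomization independent of everything else) a random finite binary string $Y^{(i)}$ of length $\hat B^{(i)}$ (number of transmitted bits), and $\hat f$ is a measurable function of $(Y^{(1)},\dots,Y^{(m)})$ only. Statements concern sequences of such procedures indexed by $n$. Besov balls: let $\{\psi_{jk}: j\ge 0,\ 1\le k\le 2^j\}$ be a compactly supported orthonormal $N$-regular Cohen–Daubechies–Vial wavelet basis of $L_2[0,1]$, with $N$ larger than all regularities considered, and $f_{jk}=\langle f,\psi_{jk}\rangle$. Then $\|f\|^2_{B^s_{2,\infty}}=\sup_{j\ge 0}2^{2js}\sum_{k=1}^{2^j}f_{jk}^2$ and $B^s_{2,\infty}(L)=\{f\in L_2[0,1]:\|f\|_{B^s_{2,\infty}}<L\}$. $\log$ is the base-2 logarithm. $a_n\lesssim b_n$ means $a_n\le C b_n$ for all sufficiently large $n$, with $C>0$ not depending on $n$, $i$ or $f_0$ (it may depend on fixed parameters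 such as $s_1,s_2,L,p$). *)

theory Defs
  imports "HOL-Probability.Probability"
begin

section \<open>The space \<open>L\<^sub>2[0,1]\<close>\<close>

abbreviation unit_leb :: "real measure" where
  "unit_leb \<equiv> lebesgue_on {0..1}"

text \<open>Elements of \<open>L\<^sub>2[0,1]\<close> are represented by functions; equality is equality almost everywhere
  on \<open>[0,1]\<close>.\<close>

definition L2_unit :: "(real \<Rightarrow> real) set" where
  "L2_unit = {f. f \<in> borel_measurable unit_leb \<and> integrable unit_leb (\<lambda>x. (f x)\<^sup>2)}"

definition L2_inner :: "(real \<Rightarrow> real) \<Rightarrow> (real \<Rightarrow> real) \<Rightarrow> real" where
  "L2_inner f g = (LINT x|unit_leb. f x * g x)"

definition L2_norm_sq :: "(real \<Rightarrow> real) \<Rightarrow> ennreal" where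
  "L2_norm_sq f = (\<integral>\<^sup>+ x. ennreal ((f x)\<^sup>2) \<partial>unit_leb)"

section \<open>Cohen--Daubechies--Vial wavelets\<close>

text \<open>A Daubechies filter with \<open>N\<close> vanishing moments and minimal length \<open>2 N\<close>. All phase choices
  (extremal phase, least asymmetric) are admitted.\<close>

definition daubechies_filter :: "nat \<Rightarrow> (nat \<Rightarrow> real) \<Rightarrow> bool" where
  "daubechies_filter N h \<longleftrightarrow>
     (\<forall>k\<ge>2*N. h k = 0) \<and>
     (\<Sum>k<2*N. h k) = sqrt 2 \<and>
     (\<forall>l. (\<Sum>k<2*N. h k * h (k + 2*l)) = (if l = 0 then 1 else 0)) \<and>
     (\<forall>r<N. (\<Sum>k<2*N. (-1)^k * real k ^ r * h k) = 0)"

text \<open>The father wavelet, translated so that its support is \<open>[-N+1, N]\<close>.\<close>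

definition father_wavelet :: "nat \<Rightarrow> (nat \<Rightarrow> real) \<Rightarrow> (real \<Rightarrow> real) \<Rightarrow> bool" where
  "father_wavelet N h \<phi> \<longleftrightarrow>
     \<phi> \<in> borel_measurable borel \<and>
     integrable lborel (\<lambda>x. (\<phi> x)\<^sup>2) \<and>
     (\<forall>x. x \<notin> {1 - real N..real N} \<longrightarrow> \<phi> x = 0) \<and>
     (LINT x|lborel. \<phi> x) = 1 \<and>
     (AE x in lborel. \<phi> x = sqrt 2 * (\<Sum>k<2*N. h k * \<phi> (2 * x - real k + real N - 1)))"

text \<open>This is \<open>\<psi>(x) = \<surd>2 \<Sum>\<^sub>j (-1)\<^sup>j a(1-j) \<phi>(2x-j)\<close> up to sign, where \<open>a(j) = h(j+N-1)\<close> is the filter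
  belonging to the translated \<open>\<phi>\<close> and \<open>j = N-l\<close>.\<close>

definition mother_wavelet :: "nat \<Rightarrow> (nat \<Rightarrow> real) \<Rightarrow> (real \<Rightarrow> real) \<Rightarrow> real \<Rightarrow> real" where
  "mother_wavelet N h \<phi> x = sqrt 2 * (\<Sum>l<2*N. (-1)^(l+1) * h l * \<phi> (2 * x + real l - real N))"

text \<open>The \<open>2\<^sup>j\<close> unnormalised scaling functions of level \<open>j\<close> on \<open>[0,1]\<close>: \<open>N\<close> functions adapted to the
  left end point, \<open>\<Sum>\<^sub>n (n choose q) \<phi>(2\<^sup>j x + n - N + 1)\<close>, the mirror images adapted to the right end
  point, and interior translates. Restricted to \<open>[0,1]\<close> they span all polynomials of degree less
  than \<open>N\<close>.\<close>

definition cdv_scaling :: "nat \<Rightarrow> (real \<Rightarrow> real) \<Rightarrow> nat \<Rightarrow> nat \<Rightarrow> real \<Rightarrow> real" where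
  "cdv_scaling N \<phi> j q x =
     (if q < N then
        (\<Sum>n = q..2*N-2. real (n choose q) * \<phi> (2^j * x + real n - real N + 1))
      else if 2^j \<le> q + N then
        (\<Sum>n = 2^j-1-q..2*N-2. real (n choose (2^j-1-q)) * \<phi> (2^j * x - 2^j - real n + real N))
      else \<phi> (2^j * x - real q))"

definition cdv_space :: "nat \<Rightarrow> (real \<Rightarrow> real) \<Rightarrow> nat \<Rightarrow> (real \<Rightarrow> real) set" where
  "cdv_space N \<phi> j =
     {f \<in> L2_unit. \<exists>c. AE x in unit_leb. f x = (\<Sum>q<2^j. c q * cdv_scaling N \<phi> j q x)}"

text \<open>A multiresolution space of level \<open>j\<^sub>0\<close> has dimension \<open>2\<^sup>j\<^sup>0\<close>, whereas there are only
  \<open>2\<^sup>j\<^sup>0 - 1\<close> pairs \<open>(j,k)\<close> with \<open>j < j\<^sub>0\<close> and \<open>1 \<le> k \<le> 2\<^sup>j\<close>. As for the Haar basis, the one remaining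
  (father) function is put at level \<open>0\<close>, with index \<open>k = 0\<close>.\<close>

definition wavelet_idx :: "nat \<Rightarrow> nat set" where
  "wavelet_idx j = (if j = 0 then {0..1} else {1..2^j})"

text \<open>\<open>\<psi> j k\<close> is a CDV basis built from Daubechies wavelets with \<open>N\<close> vanishing moments, with coarsest
  level \<open>j\<^sub>0\<close>. The levels below \<open>j\<^sub>0\<close> hold an orthonormal basis of the coarsest scaling space. From
  level \<open>j\<^sub>0\<close> on, \<open>\<psi> j (q+1)\<close> is the dilated and translated mother wavelet for
  \<open>N \<le> q < 2\<^sup>j - N\<close>, and the \<open>N\<close> wavelets next to either end point are dilations of compactly
  supported edge functions \<open>\<psi>l q\<close>, \<open>\<psi>r q\<close> not depending on \<open>j\<close>. By a dimension count,
  the \<open>\<psi> j k\<close> with \<open>k \<in> {1..2\<^sup>j}\<close> span the orthogonal complement of the scaling space of level \<open>j\<close> in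
  that of level \<open>j+1\<close>.\<close>

definition cdv_wavelet_basis :: "nat \<Rightarrow> (nat \<Rightarrow> nat \<Rightarrow> real \<Rightarrow> real) \<Rightarrow> bool" where
  "cdv_wavelet_basis N \<psi> \<longleftrightarrow> 1 \<le> N \<and>
     (\<forall>j. \<forall>k\<in>wavelet_idx j. \<psi> j k \<in> L2_unit) \<and>
     (\<forall>j j'. \<forall>k\<in>wavelet_idx j. \<forall>k'\<in>wavelet_idx j'.
        L2_inner (\<psi> j k) (\<psi> j' k') = (if j = j' \<and> k = k' then 1 else 0)) \<and>
     (\<forall>f\<in>L2_unit. (\<forall>j. \<forall>k\<in>wavelet_idx j. L2_inner f (\<psi> j k) = 0) \<longrightarrow>
        (AE x in unit_leb. f x = 0)) \<and>
     (\<exists>h \<phi> j\<^sub>0 \<psi>l \<psi>r.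
        daubechies_filter N h \<and> father_wavelet N h \<phi> \<and> 2*N \<le> 2^j\<^sub>0 \<and>
        (\<forall>j<j\<^sub>0. \<forall>k\<in>wavelet_idx j. \<psi> j k \<in> cdv_space N \<phi> j\<^sub>0) \<and>
        (\<forall>q<N. \<forall>y. y \<notin> {0..2 * real N - 1} \<longrightarrow> \<psi>l q y = (0::real) \<and> \<psi>r q y = (0::real)) \<and>
        (\<forall>j\<ge>j\<^sub>0.
           (\<forall>k\<in>{1..2^j}. \<psi> j k \<in> cdv_space N \<phi> (Suc j)) \<and>
           (\<forall>q. N \<le> q \<and> q + N < 2^j \<longrightarrow>
              (AE x in unit_leb. \<psi> j (q+1) x = sqrt (2^j) * mother_wavelet N h \<phi> (2^j * x - real q))) \<and>
           (\<forall>q<N. (AE x in unit_leb. \<psi> j (q+1) x = sqrt (2^j) * \<psi>l q (2^j * x)) \<and>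
                  (AE x in unit_leb. \<psi> j (2^j - q) x = sqrt (2^j) * \<psi>r q (2^j * (1 - x))))))"

section \<open>Besov balls\<close>

definition besov_norm_sq :: "(nat \<Rightarrow> nat \<Rightarrow> real \<Rightarrow> real) \<Rightarrow> real \<Rightarrow> (real \<Rightarrow> real) \<Rightarrow> ennreal" where
  "besov_norm_sq \<psi> s f =
     (SUP j. ennreal (2 powr (2 * real j * s) * (\<Sum>k\<in>wavelet_idx j. (L2_inner f (\<psi> j k))\<^sup>2)))"

text \<open>\<open>\<parallel>f\<parallel> < L\<close>, written with squares; used for \<open>L > 0\<close>.\<close>

definition besov_ball :: "(nat \<Rightarrow> nat \<Rightarrow> real \<Rightarrow> real) \<Rightarrow> real \<Rightarrow> real \<Rightarrow> (real \<Rightarrow> real) set" where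
  "besov_ball \<psi> s L = {f \<in> L2_unit. besov_norm_sq \<psi> s f < ennreal (L\<^sup>2)}"

section \<open>Gaussian white noise\<close>

definition wiener_process :: "'a measure \<Rightarrow> (real \<Rightarrow> 'a \<Rightarrow> real) \<Rightarrow> bool" where
  "wiener_process M W \<longleftrightarrow> prob_space M \<and>
     (\<forall>t\<in>{0..1}. W t \<in> borel_measurable M) \<and>
     (AE \<omega> in M. W 0 \<omega> = 0) \<and>
     (\<forall>\<omega>\<in>space M. continuous_on {0..1} (\<lambda>t. W t \<omega>)) \<and>
     (\<forall>s t. 0 \<le> s \<and> s < t \<and> t \<le> 1 \<longrightarrow>
        distributed M lborel (\<lambda>\<omega>. W t \<omega> - W s \<omega>) (\<lambda>x. ennreal (normal_density 0 (sqrt (t - s)) x))) \<and>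
     (\<forall>r (\<tau> :: nat \<Rightarrow> real). 0 \<le> \<tau> 0 \<and> (\<forall>i<r. \<tau> i < \<tau> (Suc i)) \<and> \<tau> r \<le> 1 \<longrightarrow>
        prob_space.indep_vars M (\<lambda>_. borel) (\<lambda>i \<omega>. W (\<tau> (Suc i)) \<omega> - W (\<tau> i) \<omega>) {..<r})"

text \<open>Continuous paths on \<open>[0,1]\<close> (extended by \<open>undefined\<close>) with the \<open>\<sigma>\<close>-algebra generated by the
  evaluations, which is the Borel \<open>\<sigma>\<close>-algebra of the uniform distance.\<close>

definition path_space :: "(real \<Rightarrow> real) measure" where
  "path_space = restrict_space (Pi\<^sub>M {0..1} (\<lambda>_. borel)) {x. continuous_on {0..1} x}"

definition wiener_measure :: "(real \<Rightarrow> real) measure \<Rightarrow> bool" where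
  "wiener_measure \<W> \<longleftrightarrow> sets \<W> = sets path_space \<and> wiener_process \<W> (\<lambda>t w. w t)"

text \<open>The law of \<open>X\<close> with \<open>dX\<^sub>t = f(t) dt + \<sigma> dW\<^sub>t\<close>, \<open>X\<^sub>0 = 0\<close>, where \<open>W\<close> has law \<open>\<W>\<close>.\<close>

definition white_noise_law :: "(real \<Rightarrow> real) measure \<Rightarrow> real \<Rightarrow> (real \<Rightarrow> real) \<Rightarrow> (real \<Rightarrow> real) measure" where
  "white_noise_law \<W> \<sigma> f =
     distr \<W> path_space (\<lambda>w. \<lambda>t\<in>{0..1}. (LINT u|lebesgue_on {0..t}. f u) + \<sigma> * w t)"

section \<open>Distributed estimators\<close>

text \<open>Machine \<open>i\<close> acts through a Markov kernel \<open>K i\<close>, the conditional law, given \<open>X\<^sup>i\<close>, of its message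
  \<open>Y\<^sup>i\<close>; this is the general form of a locally randomised message. The final estimator \<open>F\<close> maps the
  tuple of messages to \<open>L\<^sub>2[0,1]\<close>. There are only countably many such tuples and all sets of tuples are
  measurable, so that measurability of \<open>F\<close> is no restriction.\<close>

definition distributed_estimator ::
  "nat \<Rightarrow> (nat \<Rightarrow> (real \<Rightarrow> real) \<Rightarrow> bool list measure) \<Rightarrow> ((nat \<Rightarrow> bool list) \<Rightarrow> real \<Rightarrow> real) \<Rightarrow> bool" where
  "distributed_estimator m K F \<longleftrightarrow>
     (\<forall>i\<in>{1..m}. K i \<in> path_space \<rightarrow>\<^sub>M prob_algebra (count_space UNIV)) \<and>
     (\<forall>y\<in>{1..m} \<rightarrow>\<^sub>E UNIV. F y \<in> L2_unit)"

text \<open>The law of \<open>Y\<^sup>i\<close>, with \<open>m\<close> machines and signal-to-noise parameter \<open>n\<close>; the number of bits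
  transmitted by machine \<open>i\<close> is the length of \<open>Y\<^sup>i\<close>.\<close>

definition message_law ::
  "(real \<Rightarrow> real) measure \<Rightarrow> nat \<Rightarrow> nat \<Rightarrow> (nat \<Rightarrow> (real \<Rightarrow> real) \<Rightarrow> bool list measure) \<Rightarrow> (real \<Rightarrow> real)
    \<Rightarrow> nat \<Rightarrow> bool list measure" where
  "message_law \<W> n m K f i = Giry_Monad.bind (white_noise_law \<W> (sqrt (real m / real n)) f) (K i)"

definition expected_bits ::
  "(real \<Rightarrow> real) measure \<Rightarrow> nat \<Rightarrow> nat \<Rightarrow> (nat \<Rightarrow> (real \<Rightarrow> real) \<Rightarrow> bool list measure) \<Rightarrow> (real \<Rightarrow> real)
    \<Rightarrow> nat \<Rightarrow> ennreal" where
  "expected_bits \<W> n m K f i = (\<integral>\<^sup>+ y. of_nat (length y) \<partial>message_law \<W> n m K f i)"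

text \<open>The messages of different machines are independent.\<close>

definition risk ::
  "(real \<Rightarrow> real) measure \<Rightarrow> nat \<Rightarrow> nat \<Rightarrow> (nat \<Rightarrow> (real \<Rightarrow> real) \<Rightarrow> bool list measure)
    \<Rightarrow> ((nat \<Rightarrow> bool list) \<Rightarrow> real \<Rightarrow> real) \<Rightarrow> (real \<Rightarrow> real) \<Rightarrow> ennreal" where
  "risk \<W> n m K F f =
     (\<integral>\<^sup>+ y. L2_norm_sq (\<lambda>t. F y t - f t) \<partial>(Pi\<^sub>M {1..m} (message_law \<W> n m K f)))"

end

(*
Reduction to finitely many dimensions. Fix a resolution level j with d = 2^j slightly below
n^(1/(1+2 s1)) and consider f = delta * sum_k z_k psi_jk with signs z in {-1,1}^d, delta being as
large as membership in the s1-ball permits. Only orthonormality of the psi_jk matters. By the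
Cameron-Martin formula, machine i sees d coordinates with signal-to-noise ratio a, where
a^2 = delta^2 n/m.

The machines cannot tell rough from smooth. A uniform mixture over the signs has chi-square distance
cosh(a^2)^d - 1, about d a^4, from f = 0, and p > r/2 with r = 1/(1+2 s1) makes this polynomially
small. Hence the short messages that s2 forces at f = 0 stay short, on average, under the mixture.

Short messages carry little information. If v(y) is the posterior mean of the d Gaussian coordinates
given the message y, then E |v(Y)|^2 is at most twice the entropy of Y, hence of the order of the mean
message length. To first order this bounds the sum over k of the chi-square distances between the
message laws of z and of z with the k-th sign flipped; the second order terms, of order d a^4 per
machine, add up to m d a^4, which is negligible against d because a^2 is about 1/m. Chi-square
distances of independent messages combine, and averaging the two-point bounds over z and k (Assouad)
gives a risk of order d delta^2, which exceeds the assumed rate.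
*)
theory Submission
  imports Defs "HOL-Real_Asymp.Real_Asymp"
begin

section \<open>Square integrable functions\<close>

text \<open>A single sign vector may be far from f = 0: its chi-square distance is exp(d a^2) - 1,
  and d a^2 grows like a power of n when p < r. Only the mixture is close, so message lengths can be
  controlled only on average over the signs. This is enough because the information bound is linear
  in the mean length. Small total variation changes a mean length by little only if the length is
  bounded; this is where the hard cap on the number of bits enters. Cap times total variation is
  about n^r sqrt(d) a^2, and r < 2p, which restates s1 > 1/(4p) - 1/2, keeps it below n^r. Entropy
  occurs only as cross entropy against an explicit probability weight on binary words. The Wiener
  integrals that turn the observed path into coordinates are L^2 limits of discrete pairings over
  dyadic partitions, for which the shift formula is a finite-dimensional computation.\<close>

lemma integrable_mult_square_integrable:
  fixes f g :: "'a \<Rightarrow> real"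
  assumes [measurable]: "f \<in> borel_measurable M" "g \<in> borel_measurable M"
    and "integrable M (\<lambda>x. (f x)\<^sup>2)" "integrable M (\<lambda>x. (g x)\<^sup>2)"
  shows "integrable M (\<lambda>x. f x * g x)"
proof (rule Bochner_Integration.integrable_bound)
  show "integrable M (\<lambda>x. (f x)\<^sup>2 + (g x)\<^sup>2)"
    using assms by auto
  have "\<bar>f x * g x\<bar> \<le> (f x)\<^sup>2 + (g x)\<^sup>2" for x
  proof -
    have "2 * (\<bar>f x\<bar> * \<bar>g x\<bar>) \<le> (f x)\<^sup>2 + (g x)\<^sup>2"
      using sum_squares_bound[of "\<bar>f x\<bar>" "\<bar>g x\<bar>"] by (simp add: mult.assoc)
    moreover have "0 \<le> \<bar>f x\<bar> * \<bar>g x\<bar>" by simp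
    ultimately show ?thesis unfolding abs_mult by linarith
  qed
  then show "AE x in M. norm (f x * g x) \<le> norm ((f x)\<^sup>2 + (g x)\<^sup>2)" by simp
qed simp

lemma integrable_square_add:
  fixes f g :: "'a \<Rightarrow> real"
  assumes [measurable]: "f \<in> borel_measurable M" "g \<in> borel_measurable M"
    and "integrable M (\<lambda>x. (f x)\<^sup>2)" "integrable M (\<lambda>x. (g x)\<^sup>2)"
  shows "integrable M (\<lambda>x. (f x + g x)\<^sup>2)"
  using assms integrable_mult_square_integrable[OF assms]
  by (auto simp: power2_sum mult.assoc)

lemma integrable_square_diff:
  fixes f g :: "'a \<Rightarrow> real"
  assumes "f \<in> borel_measurable M" "g \<in> borel_measurable M"
    and "integrable M (\<lambda>x. (f x)\<^sup>2)" "integrable M (\<lambda>x. (g x)\<^sup>2)"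
  shows "integrable M (\<lambda>x. (f x - g x)\<^sup>2)"
  using integrable_square_add[of f M "\<lambda>x. - g x"] assms by simp

lemma Cauchy_Schwarz_integral:
  fixes f g :: "'a \<Rightarrow> real"
  assumes [measurable]: "f \<in> borel_measurable M" "g \<in> borel_measurable M"
    and f: "integrable M (\<lambda>x. (f x)\<^sup>2)" and g: "integrable M (\<lambda>x. (g x)\<^sup>2)"
  shows "(\<integral>x. \<bar>f x * g x\<bar> \<partial>M)\<^sup>2 \<le> (\<integral>x. (f x)\<^sup>2 \<partial>M) * (\<integral>x. (g x)\<^sup>2 \<partial>M)"
proof -
  have "integrable M (\<lambda>x. \<bar>f x * g x\<bar>)"
    using integrable_mult_square_integrable[OF assms] by simp
  then have "(\<integral>\<^sup>+x. ennreal \<bar>f x\<bar> * ennreal \<bar>g x\<bar> \<partial>M) = ennreal (\<integral>x. \<bar>f x * g x\<bar> \<partial>M)"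
    by (subst nn_integral_eq_integral[symmetric]) (auto simp: abs_mult ennreal_mult intro!: nn_integral_cong)
  moreover have "(\<integral>\<^sup>+x. (ennreal \<bar>f x\<bar>)\<^sup>2 \<partial>M) = ennreal (\<integral>x. (f x)\<^sup>2 \<partial>M)"
    by (subst nn_integral_eq_integral[symmetric]) (auto simp: f ennreal_power intro!: nn_integral_cong)
  moreover have "(\<integral>\<^sup>+x. (ennreal \<bar>g x\<bar>)\<^sup>2 \<partial>M) = ennreal (\<integral>x. (g x)\<^sup>2 \<partial>M)"
    by (subst nn_integral_eq_integral[symmetric]) (auto simp: g ennreal_power intro!: nn_integral_cong)
  ultimately have "(ennreal (\<integral>x. \<bar>f x * g x\<bar> \<partial>M))\<^sup>2
      \<le> ennreal (\<integral>x. (f x)\<^sup>2 \<partial>M) * ennreal (\<integral>x. (g x)\<^sup>2 \<partial>M)"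
    using Cauchy_Schwarz_nn_integral[of "\<lambda>x. ennreal \<bar>f x\<bar>" M "\<lambda>x. ennreal \<bar>g x\<bar>"] by simp
  then show ?thesis
    by (simp add: ennreal_power ennreal_mult[symmetric])
qed

lemma Cauchy_Schwarz_integral_sqrt:
  fixes f g :: "'a \<Rightarrow> real"
  assumes "f \<in> borel_measurable M" "g \<in> borel_measurable M"
    and "integrable M (\<lambda>x. (f x)\<^sup>2)" "integrable M (\<lambda>x. (g x)\<^sup>2)"
  shows "(\<integral>x. \<bar>f x * g x\<bar> \<partial>M) \<le> sqrt (\<integral>x. (f x)\<^sup>2 \<partial>M) * sqrt (\<integral>x. (g x)\<^sup>2 \<partial>M)"
  using real_le_rsqrt[OF Cauchy_Schwarz_integral[OF assms]] by (simp add: real_sqrt_mult)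

section \<open>Convergence and completeness in L^2 over a finite measure\<close>

lemma (in finite_measure) integrable_if_square_integrable:
  fixes f :: "'a \<Rightarrow> real"
  assumes "f \<in> borel_measurable M" "integrable M (\<lambda>x. (f x)\<^sup>2)"
  shows "integrable M f"
  using integrable_mult_square_integrable[of f M "\<lambda>_. 1"] assms by simp

lemma (in finite_measure) integral_abs_le_sqrt:
  fixes f :: "'a \<Rightarrow> real"
  assumes "f \<in> borel_measurable M" "integrable M (\<lambda>x. (f x)\<^sup>2)"
  shows "(\<integral>x. \<bar>f x\<bar> \<partial>M) \<le> sqrt (\<integral>x. (f x)\<^sup>2 \<partial>M) * sqrt (measure M (space M))"
  using Cauchy_Schwarz_integral_sqrt[of f M "\<lambda>_. 1"] assms by simp

text \<open>On a finite measure space L^2 convergence implies L^1 convergence, which gives almost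
  everywhere convergence along a subsequence.\<close>

lemma (in finite_measure) L2_subseq_AE:
  fixes f :: "nat \<Rightarrow> 'a \<Rightarrow> real"
  assumes [measurable]: "\<And>n. f n \<in> borel_measurable M" "g \<in> borel_measurable M"
    and f: "\<And>n. integrable M (\<lambda>x. (f n x)\<^sup>2)" and g: "integrable M (\<lambda>x. (g x)\<^sup>2)"
    and lim: "(\<lambda>n. \<integral>x. (f n x - g x)\<^sup>2 \<partial>M) \<longlonglongrightarrow> 0"
  obtains r where "strict_mono r" "AE x in M. (\<lambda>n. f (r n) x) \<longlonglongrightarrow> g x"
proof -
  have int: "integrable M (\<lambda>x. (f n x - g x)\<^sup>2)" for n
    by (intro integrable_square_diff f g) auto
  have "(\<lambda>n. \<integral>x. norm (f n x - g x) \<partial>M) \<longlonglongrightarrow> 0"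
  proof (rule tendsto_sandwich[OF _ _ tendsto_const])
    show "(\<lambda>n. sqrt (\<integral>x. (f n x - g x)\<^sup>2 \<partial>M) * sqrt (measure M (space M))) \<longlonglongrightarrow> 0"
      using tendsto_mult[OF tendsto_real_sqrt[OF lim] tendsto_const] by simp
  qed (auto simp: intro!: always_eventually integral_abs_le_sqrt int)
  then obtain r where "strict_mono r" "AE x in M. (\<lambda>n. f (r n) x - g x) \<longlonglongrightarrow> 0"
    using tendsto_L1_AE_subseq[of M "\<lambda>n x. f n x - g x", OF integrable_if_square_integrable[OF _ int]]
    by auto
  with that show thesis by (simp add: LIM_zero_iff)
qed

text \<open>Riesz-Fischer: along a rapidly Cauchy subsequence the increments are absolutely summable
  almost everywhere, which defines \<open>g\<close>; Fatou's lemma then transfers the Cauchy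
  estimate to the distance from \<open>g\<close>.\<close>

lemma (in finite_measure) L2_complete:
  fixes f :: "nat \<Rightarrow> 'a \<Rightarrow> real"
  assumes [measurable]: "\<And>n. f n \<in> borel_measurable M"
    and f: "\<And>n. integrable M (\<lambda>x. (f n x)\<^sup>2)"
    and Cauchy: "\<And>e. e > 0 \<Longrightarrow> \<exists>N. \<forall>m\<ge>N. \<forall>n\<ge>N. (\<integral>x. (f m x - f n x)\<^sup>2 \<partial>M) < e"
  obtains g where "g \<in> borel_measurable M" "integrable M (\<lambda>x. (g x)\<^sup>2)"
    "(\<lambda>n. \<integral>x. (f n x - g x)\<^sup>2 \<partial>M) \<longlonglongrightarrow> 0"
proof -
  have int: "integrable M (\<lambda>x. (f m x - f n x)\<^sup>2)" for m n
    by (intro integrable_square_diff f) auto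
  have "\<exists>N. \<forall>m\<ge>N. \<forall>n\<ge>N. (\<integral>x. (f m x - f n x)\<^sup>2 \<partial>M) < (1/4)^i" for i :: nat
    by (rule Cauchy) simp
  then obtain B where B: "\<And>i m n. m \<ge> B i \<Longrightarrow> n \<ge> B i \<Longrightarrow> (\<integral>x. (f m x - f n x)\<^sup>2 \<partial>M) < (1/4)^i"
    by metis
  \<comment> \<open>Summing the thresholds makes \<open>r\<close> monotone and at least
    \<open>B i\<close> at once; the summand \<open>i\<close> forces \<open>r\<close> to
    infinity.\<close>
  define r where "r i = i + (\<Sum>k\<le>i. B k)" for i
  have rB: "B i \<le> r i" for i
    unfolding r_def by (intro trans_le_add2 member_le_sum) auto
  have r_ge: "r i \<ge> i" for i by (simp add: r_def)
  have r_mono: "r i \<le> r (Suc i)" for i by (simp add: r_def)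
  define h where "h i x = f (r (Suc i)) x - f (r i) x" for i x
  have [measurable]: "h i \<in> borel_measurable M" for i unfolding h_def by measurable
  have hsq: "integrable M (\<lambda>x. (h i x)\<^sup>2)" for i
    unfolding h_def by (rule int)
  have h1: "(\<integral>x. \<bar>h i x\<bar> \<partial>M) \<le> (1/2)^i * sqrt (measure M (space M))" for i
  proof -
    have "(\<integral>x. (h i x)\<^sup>2 \<partial>M) \<le> (1/4)^i"
      unfolding h_def using B[of i "r (Suc i)" "r i"] rB[of i] r_mono[of i] by simp
    then have "sqrt (\<integral>x. (h i x)\<^sup>2 \<partial>M) \<le> sqrt ((1/4)^i)"
      by simp
    also have "sqrt ((1/4)^i) = (1/2::real)^i"
      by (simp add: real_sqrt_power real_sqrt_divide)
    finally show ?thesis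
      using integral_abs_le_sqrt[of "h i"] hsq[of i]
      by (intro order_trans[OF integral_abs_le_sqrt[OF _ hsq]] mult_right_mono) auto
  qed
  have hint: "integrable M (h i)" for i
    by (rule integrable_if_square_integrable[OF _ hsq]) simp
  have "AE x in M. summable (\<lambda>i. \<bar>h i x\<bar>)"
  proof -
    have "(\<integral>\<^sup>+x. (\<Sum>i. ennreal \<bar>h i x\<bar>) \<partial>M) = (\<Sum>i. \<integral>\<^sup>+x. ennreal \<bar>h i x\<bar> \<partial>M)"
      by (intro nn_integral_suminf) auto
    also have "\<dots> = (\<Sum>i. ennreal (\<integral>x. \<bar>h i x\<bar> \<partial>M))"
      by (intro arg_cong[where f=suminf] ext nn_integral_eq_integral integrable_abs hint) auto
    also have "\<dots> \<le> (\<Sum>i. ennreal ((1/2)^i * sqrt (measure M (space M))))"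
      by (intro suminf_le ennreal_leI h1) auto
    also have "\<dots> < \<infinity>"
      using summable_mult2[OF summable_geometric[of "1/2::real"], of "sqrt (measure M (space M))"]
      by (subst suminf_ennreal2) auto
    finally have "AE x in M. (\<Sum>i. ennreal \<bar>h i x\<bar>) \<noteq> \<infinity>"
      by (intro nn_integral_noteq_infinite) auto
    then show ?thesis
      by eventually_elim (auto intro!: summable_suminf_not_top)
  qed
  define g where "g x = lim (\<lambda>i. f (r i) x)" for x
  have [measurable]: "g \<in> borel_measurable M"
    unfolding g_def by measurable
  have conv: "AE x in M. (\<lambda>i. f (r i) x) \<longlonglongrightarrow> g x"
    using \<open>AE x in M. summable (\<lambda>i. \<bar>h i x\<bar>)\<close>
  proof eventually_elim
    case (elim x)
    then have "summable (\<lambda>i. h i x)" by (rule summable_rabs_cancel)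
    then have "convergent (\<lambda>n. \<Sum>i<n. h i x)" by (simp add: summable_iff_convergent)
    moreover have "(\<Sum>i<n. h i x) = f (r n) x - f (r 0) x" for n
      unfolding h_def by (rule sum_lessThan_telescope)
    ultimately have "convergent (\<lambda>n. f (r n) x - f (r 0) x)" by simp
    then have "convergent (\<lambda>n. f (r n) x)" by (simp add: convergent_diff_const_right_iff)
    then show ?case unfolding g_def by (rule convergent_LIMSEQ_iff[THEN iffD1])
  qed
  have le: "(\<integral>\<^sup>+x. ennreal ((f n x - g x)\<^sup>2) \<partial>M) \<le> ennreal ((1/4)^i)" if "n \<ge> B i" for n i
  proof -
    have "(\<integral>\<^sup>+x. ennreal ((f n x - g x)\<^sup>2) \<partial>M) = (\<integral>\<^sup>+x. liminf (\<lambda>k. ennreal ((f n x - f (r k) x)\<^sup>2)) \<partial>M)"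
      by (rule nn_integral_cong_AE, use conv in eventually_elim)
         (intro lim_imp_Liminf[symmetric] tendsto_ennrealI tendsto_power tendsto_diff tendsto_const, auto)
    also have "\<dots> \<le> liminf (\<lambda>k. \<integral>\<^sup>+x. ennreal ((f n x - f (r k) x)\<^sup>2) \<partial>M)"
      by (rule nn_integral_liminf) auto
    also have "\<dots> \<le> liminf (\<lambda>k::nat. ennreal ((1/4)^i))"
    proof (rule Liminf_mono, rule eventually_mono[OF eventually_ge_at_top[of "B i"]])
      fix k assume "B i \<le> k"
      then have "B i \<le> r k" using r_ge[of k] by simp
      then show "(\<integral>\<^sup>+x. ennreal ((f n x - f (r k) x)\<^sup>2) \<partial>M) \<le> ennreal ((1/4)^i)"
        by (subst nn_integral_eq_integral) (use int that B[of i n "r k"] in \<open>auto simp: ennreal_leI\<close>)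
    qed
    finally show ?thesis by (simp add: Liminf_const)
  qed
  have int2: "integrable M (\<lambda>x. (f n x - g x)\<^sup>2)" if "n \<ge> B 0" for n
  proof (rule integrableI_bounded)
    show "(\<integral>\<^sup>+x. ennreal (norm ((f n x - g x)\<^sup>2)) \<partial>M) < \<infinity>"
      using le_less_trans[OF le[OF that] ennreal_less_top] by simp
  qed simp
  \<comment> \<open>\<open>g\<close> is written as a difference of two square integrable
    functions.\<close>
  have "integrable M (\<lambda>x. (f (B 0) x - (f (B 0) x - g x))\<^sup>2)"
    by (rule integrable_square_diff[OF _ _ f int2]) auto
  then have ig: "integrable M (\<lambda>x. (g x)\<^sup>2)" by simp
  have ile: "(\<integral>x. (f n x - g x)\<^sup>2 \<partial>M) \<le> (1/4)^i" if "n \<ge> B i" for n i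
  proof -
    have "integrable M (\<lambda>x. (f n x - g x)\<^sup>2)"
      by (intro integrable_square_diff f ig) auto
    from nn_integral_eq_integral[OF this] le[OF that] show ?thesis
      by (simp)
  qed
  have "(\<lambda>n. \<integral>x. (f n x - g x)\<^sup>2 \<partial>M) \<longlonglongrightarrow> 0"
  proof (rule LIMSEQ_I)
    fix e :: real assume "e > 0"
    then obtain i where i: "(1/4::real)^i < e"
      using real_arch_pow_inv[of e "1/4"] by auto
    show "\<exists>no. \<forall>n\<ge>no. norm ((\<integral>x. (f n x - g x)\<^sup>2 \<partial>M) - 0) < e"
      using ile[of i] i by (intro exI[of _ "B i"]) (auto intro: le_less_trans)
  qed
  with ig show thesis by (intro that[of g]) auto
qed

section \<open>The space L^2[0,1] and its inner product\<close>

interpretation unit_leb: prob_space unit_leb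
proof
  have "emeasure unit_leb (space unit_leb) = emeasure lebesgue {0..1::real}"
    by (subst emeasure_restrict_space) (auto simp: space_restrict_space)
  then show "emeasure unit_leb (space unit_leb) = 1" by simp
qed

lemma L2_unitI: "f \<in> borel_measurable unit_leb \<Longrightarrow> integrable unit_leb (\<lambda>x. (f x)\<^sup>2) \<Longrightarrow> f \<in> L2_unit"
  by (simp add: L2_unit_def)

lemma L2_unitD:
  assumes "f \<in> L2_unit"
  shows L2_unit_measurable: "f \<in> borel_measurable unit_leb"
    and L2_unit_integrable_square: "integrable unit_leb (\<lambda>x. (f x)\<^sup>2)"
  using assms by (auto simp: L2_unit_def)

lemma L2_unit_integrable_mult:
  "f \<in> L2_unit \<Longrightarrow> g \<in> L2_unit \<Longrightarrow> integrable unit_leb (\<lambda>x. f x * g x)"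
  by (intro integrable_mult_square_integrable) (auto dest: L2_unitD)

lemma L2_unit_integrable: "f \<in> L2_unit \<Longrightarrow> integrable unit_leb f"
  by (rule unit_leb.integrable_if_square_integrable) (auto dest: L2_unitD)

lemma L2_unit_add: "f \<in> L2_unit \<Longrightarrow> g \<in> L2_unit \<Longrightarrow> (\<lambda>x. f x + g x) \<in> L2_unit"
  by (intro L2_unitI integrable_square_add borel_measurable_add) (auto dest: L2_unitD)

lemma L2_unit_diff: "f \<in> L2_unit \<Longrightarrow> g \<in> L2_unit \<Longrightarrow> (\<lambda>x. f x - g x) \<in> L2_unit"
  by (intro L2_unitI integrable_square_diff borel_measurable_diff) (auto dest: L2_unitD)

lemma L2_unit_cmult: "f \<in> L2_unit \<Longrightarrow> (\<lambda>x. c * f x) \<in> L2_unit"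
  by (intro L2_unitI) (auto dest: L2_unitD simp: power_mult_distrib)

lemma L2_unit_zero: "(\<lambda>x. 0) \<in> L2_unit"
  by (intro L2_unitI) auto

lemma L2_unit_sum: "(\<And>i. i \<in> I \<Longrightarrow> f i \<in> L2_unit) \<Longrightarrow> (\<lambda>x. \<Sum>i\<in>I. c i * f i x) \<in> L2_unit"
  by (induction I rule: infinite_finite_induct)
     (auto intro!: L2_unit_zero L2_unit_add L2_unit_cmult)

lemma indicator_measurable_unit_leb:
  "A \<in> sets borel \<Longrightarrow> (indicator A :: real \<Rightarrow> real) \<in> borel_measurable unit_leb"
  by (intro measurable_restrict_space1 borel_measurable_indicator) auto

lemma L2_unit_indicator: "A \<in> sets borel \<Longrightarrow> indicator A \<in> L2_unit"
proof -
  assume A: "A \<in> sets borel"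
  have "(\<lambda>x. (indicator A x :: real)\<^sup>2) = indicator A"
    by (auto simp: fun_eq_iff indicator_def)
  with A show ?thesis
    by (intro L2_unitI unit_leb.integrable_const_bound[where B=1])
       (auto simp: indicator_measurable_unit_leb power_le_one indicator_le_1)
qed

lemma L2_inner_commute: "L2_inner f g = L2_inner g f"
  by (simp add: L2_inner_def mult.commute)

lemma L2_inner_diff_left:
  "f \<in> L2_unit \<Longrightarrow> g \<in> L2_unit \<Longrightarrow> h \<in> L2_unit \<Longrightarrow>
    L2_inner (\<lambda>x. f x - g x) h = L2_inner f h - L2_inner g h"
  unfolding L2_inner_def left_diff_distrib
  by (rule Bochner_Integration.integral_diff) (auto intro: L2_unit_integrable_mult)

lemma L2_inner_diff_right:
  "f \<in> L2_unit \<Longrightarrow> g \<in> L2_unit \<Longrightarrow> h \<in> L2_unit \<Longrightarrow>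
    L2_inner h (\<lambda>x. f x - g x) = L2_inner h f - L2_inner h g"
  by (simp add: L2_inner_commute[of h] L2_inner_diff_left)

lemma L2_inner_cmult_left: "L2_inner (\<lambda>x. c * f x) h = c * L2_inner f h"
  unfolding L2_inner_def by (simp add: mult.assoc)

lemma L2_inner_sum_left:
  assumes "\<And>i. i \<in> I \<Longrightarrow> f i \<in> L2_unit" "h \<in> L2_unit"
  shows "L2_inner (\<lambda>x. \<Sum>i\<in>I. c i * f i x) h = (\<Sum>i\<in>I. c i * L2_inner (f i) h)"
proof -
  have "L2_inner (\<lambda>x. \<Sum>i\<in>I. c i * f i x) h = (LINT x|unit_leb. (\<Sum>i\<in>I. c i * (f i x * h x)))"
    unfolding L2_inner_def by (simp add: sum_distrib_right mult.assoc)
  also have "\<dots> = (\<Sum>i\<in>I. c i * L2_inner (f i) h)"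
    unfolding L2_inner_def using assms
    by (subst Bochner_Integration.integral_sum) (auto intro!: L2_unit_integrable_mult)
  finally show ?thesis .
qed

lemma L2_inner_self: "L2_inner f f = (LINT x|unit_leb. (f x)\<^sup>2)"
  by (simp add: L2_inner_def power2_eq_square)

lemma L2_inner_self_nonneg: "0 \<le> L2_inner f f"
  by (simp add: L2_inner_self)

lemma L2_inner_self_diff:
  assumes "f \<in> L2_unit" "g \<in> L2_unit"
  shows "L2_inner (\<lambda>x. f x - g x) (\<lambda>x. f x - g x) = L2_inner f f - 2 * L2_inner g f + L2_inner g g"
  using assms by (simp add: L2_inner_diff_left L2_inner_diff_right L2_unit_diff L2_inner_commute)

section \<open>Dyadic approximation\<close>

definition drift :: "(real \<Rightarrow> real) \<Rightarrow> real \<Rightarrow> real" where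
  "drift f t = (LINT u|lebesgue_on {0..t}. f u)"

text \<open>Half-open cells of one level are pairwise disjoint and refine exactly; the point 0,
  which they miss, is a null set.\<close>

definition dyadic_cell :: "nat \<Rightarrow> nat \<Rightarrow> real set" where
  "dyadic_cell N j = {real j / 2^N <.. real (Suc j) / 2^N}"

definition dyadic_inc :: "nat \<Rightarrow> (real \<Rightarrow> real) \<Rightarrow> nat \<Rightarrow> real" where
  "dyadic_inc N x j = x (real (Suc j) / 2^N) - x (real j / 2^N)"

text \<open>For \<open>x\<close> the drift of \<open>f\<close> this is \<open>\<integral> f\<^sub>N dy\<close>, where \<open>f\<^sub>N\<close> (the \<open>dyadic_step\<close> below) averages
  \<open>f\<close> over dyadic cells.\<close>

definition dyadic_pairing :: "nat \<Rightarrow> (real \<Rightarrow> real) \<Rightarrow> (real \<Rightarrow> real) \<Rightarrow> real" where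
  "dyadic_pairing N x y = (\<Sum>j<2^N. 2^N * dyadic_inc N x j * dyadic_inc N y j)"

definition dyadic_step :: "nat \<Rightarrow> (real \<Rightarrow> real) \<Rightarrow> real \<Rightarrow> real" where
  "dyadic_step N x u = (\<Sum>j<2^N. 2^N * dyadic_inc N x j * indicator (dyadic_cell N j) u)"

text \<open>The domains {0..t} and {0<..t} differ by a null set. The half-open form turns increments
  of the primitive into inner products with indicators of disjoint cells. \<open>f\<close> is
  arbitrary here, which is why the proof asks whether the integrand is measurable.\<close>

lemma drift_eq_inner:
  assumes "t \<in> {0..1}"
  shows "drift f t = L2_inner f (indicator {0<..t})"
proof -
  have "drift f t = (LINT u|lebesgue. indicator {0..t} u *\<^sub>R f u)"
    unfolding drift_def by (rule integral_restrict_space) simp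
  also have "\<dots> = (LINT u|lebesgue. indicator {0..1} u *\<^sub>R (f u * indicator {0<..t} u))"
  proof (cases "(\<lambda>u. indicator {0..t} u *\<^sub>R f u) \<in> borel_measurable lebesgue")
    case True
    have "AE u in lebesgue. u \<noteq> (0::real)"
      by (rule AE_completion) (rule AE_lborel_singleton)
    then have AE: "AE u in lebesgue. indicator {0..t} u *\<^sub>R f u = indicator {0..1} u *\<^sub>R (f u * indicator {0<..t} u)"
      by eventually_elim (use assms in \<open>auto simp: indicator_def\<close>)
    show ?thesis
    proof (rule integral_cong_AE[OF True _ AE])
      show "(\<lambda>u. indicator {0..1} u *\<^sub>R (f u * indicator {0<..t} u)) \<in> borel_measurable lebesgue"
      proof (subst measurable_cong)
        show "(\<lambda>u. (indicator {0..t} u *\<^sub>R f u) * indicator {0<..t} u) \<in> borel_measurable lebesgue"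
          by (intro borel_measurable_times True borel_measurable_indicator) auto
      qed (use assms in \<open>auto simp: indicator_def\<close>)
    qed
  next
    case False
    \<comment> \<open>The two integrands differ at 0 only, so they fail to be measurable together,
      and both integrals take the default value 0.\<close>
    have "(\<lambda>u. indicator {0..1} u *\<^sub>R (f u * indicator {0<..t} u)) \<notin> borel_measurable lebesgue"
    proof
      assume "(\<lambda>u. indicator {0..1} u *\<^sub>R (f u * indicator {0<..t} u)) \<in> borel_measurable lebesgue"
      then have "(\<lambda>u. indicator {0..1} u *\<^sub>R (f u * indicator {0<..t} u) + f 0 * indicator {0} u) \<in> borel_measurable lebesgue"
        by (intro borel_measurable_add borel_measurable_times borel_measurable_const borel_measurable_indicator) auto
      also have "(\<lambda>u. indicator {0..1} u *\<^sub>R (f u * indicator {0<..t} u) + f 0 * indicator {0} u) = (\<lambda>u. indicator {0..t} u *\<^sub>R f u)"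
        using assms by (auto simp: indicator_def fun_eq_iff)
      finally show False using False by simp
    qed
    then show ?thesis
      using False by (metis borel_measurable_integrable not_integrable_integral_eq)
  qed
  also have "\<dots> = L2_inner f (indicator {0<..t})"
    unfolding L2_inner_def by (rule integral_restrict_space[symmetric]) simp
  finally show ?thesis .
qed

lemma drift_0 [simp]: "drift f 0 = 0"
  by (simp add: drift_eq_inner L2_inner_def)

lemma drift_diff_eq_inner:
  assumes f: "f \<in> L2_unit" and "0 \<le> s" "s \<le> t" "t \<le> 1"
  shows "drift f t - drift f s = L2_inner f (indicator {s<..t})"
proof -
  have "drift f t - drift f s = L2_inner f (\<lambda>x. indicator {0<..t} x - indicator {0<..s} x)"
    using assms by (subst L2_inner_diff_right) (auto simp: drift_eq_inner intro!: L2_unit_indicator)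
  also have "(\<lambda>x. indicator {0<..t} x - indicator {0<..s} x) = (indicator {s<..t} :: real \<Rightarrow> real)"
    using assms by (auto simp: fun_eq_iff indicator_def)
  finally show ?thesis .
qed

lemma drift_cmult: "drift (\<lambda>x. c * f x) t = c * drift f t"
  by (simp add: drift_def)

lemma drift_diff:
  assumes "f \<in> L2_unit" "g \<in> L2_unit" "t \<in> {0..1}"
  shows "drift (\<lambda>x. f x - g x) t = drift f t - drift g t"
  using assms by (simp add: drift_eq_inner L2_inner_diff_left L2_unit_indicator)

lemma drift_sum:
  assumes "\<And>i. i \<in> I \<Longrightarrow> f i \<in> L2_unit" "t \<in> {0..1}"
  shows "drift (\<lambda>x. \<Sum>i\<in>I. c i * f i x) t = (\<Sum>i\<in>I. c i * drift (f i) t)"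
  using assms by (simp add: drift_eq_inner L2_inner_sum_left L2_unit_indicator)

lemma measure_unit_leb_Ioc:
  assumes "0 \<le> s" "s \<le> t" "t \<le> 1"
  shows "L2_inner (indicator {s<..t}) (indicator {s<..t}) = t - s"
proof -
  have "L2_inner (indicator {s<..t}) (indicator {s<..t}) = (LINT x|unit_leb. indicator {s<..t} x)"
    by (simp add: L2_inner_def flip: indicator_inter_arith)
  also have "\<dots> = (LINT x|lebesgue. indicator {0..1} x *\<^sub>R indicator {s<..t} x)"
    by (rule integral_restrict_space) simp
  also have "(\<lambda>x. indicator {0..1} x *\<^sub>R indicator {s<..t} x) = (indicator {s<..t} :: real \<Rightarrow> real)"
    using assms by (auto simp: fun_eq_iff indicator_def)
  finally show ?thesis using assms by simp
qed

text \<open>Cauchy-Schwarz against the indicator of (s,t] gives a modulus of continuity of order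
  sqrt |t - s|.\<close>

lemma continuous_on_drift:
  assumes "f \<in> L2_unit"
  shows "continuous_on {0..1} (drift f)"
proof -
  have sq: "\<bar>drift f t - drift f s\<bar> \<le> sqrt (L2_inner f f) * sqrt (t - s)" if "0 \<le> s" "s \<le> t" "t \<le> 1" for s t
  proof -
    have "\<bar>drift f t - drift f s\<bar> \<le> (LINT x|unit_leb. \<bar>f x * indicator {s<..t} x\<bar>)"
      unfolding drift_diff_eq_inner[OF assms that] L2_inner_def by (rule integral_abs_bound)
    also have "\<dots> \<le> sqrt (L2_inner f f) * sqrt (L2_inner (indicator {s<..t}) (indicator {s<..t}))"
      unfolding L2_inner_self
      by (intro Cauchy_Schwarz_integral_sqrt L2_unitD assms L2_unit_indicator) auto
    finally show ?thesis using that by (simp add: measure_unit_leb_Ioc)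
  qed
  have le: "\<bar>drift f t - drift f s\<bar> \<le> sqrt (L2_inner f f) * sqrt \<bar>t - s\<bar>" if "s \<in> {0..1}" "t \<in> {0..1}" for s t
    using sq[of s t] sq[of t s] that by (cases "s \<le> t") (auto simp: abs_minus_commute)
  show ?thesis
    unfolding continuous_on_def
  proof
    fix s :: real assume s: "s \<in> {0..1}"
    have "((\<lambda>t. drift f t - drift f s) \<longlongrightarrow> 0) (at s within {0..1})"
    proof (rule Lim_null_comparison)
      show "\<forall>\<^sub>F t in at s within {0..1}. norm (drift f t - drift f s) \<le> sqrt (L2_inner f f) * sqrt \<bar>t - s\<bar>"
        unfolding eventually_at_filter by (rule always_eventually) (use le s in auto)
      have "((\<lambda>t. sqrt (L2_inner f f) * sqrt \<bar>t - s\<bar>) \<longlongrightarrow> sqrt (L2_inner f f) * sqrt \<bar>s - s\<bar>) (at s within {0..1})"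
        by (intro tendsto_intros)
      then show "((\<lambda>t. sqrt (L2_inner f f) * sqrt \<bar>t - s\<bar>) \<longlongrightarrow> 0) (at s within {0..1})" by simp
    qed
    then show "(drift f \<longlongrightarrow> drift f s) (at s within {0..1})" by (simp add: LIM_zero_iff)
  qed
qed

section \<open>Dyadic step functions as orthogonal projections\<close>

lemma dyadic_point_unit: "j \<le> 2^N \<Longrightarrow> real j / 2^N \<in> {0..1}"
proof -
  assume "j \<le> 2^N"
  then have "real j \<le> 2^N" by (metis of_nat_le_iff of_nat_numeral of_nat_power)
  then show ?thesis by simp
qed

lemma dyadic_inc_drift:
  assumes "f \<in> L2_unit" "j < 2^N"
  shows "dyadic_inc N (drift f) j = L2_inner f (indicator (dyadic_cell N j))"
  using assms dyadic_point_unit[of j N] dyadic_point_unit[of "Suc j" N]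
  unfolding dyadic_inc_def dyadic_cell_def
  by (subst drift_diff_eq_inner) (auto simp: divide_right_mono)

lemma dyadic_pairing_commute: "dyadic_pairing N x y = dyadic_pairing N y x"
  by (simp add: dyadic_pairing_def mult.assoc mult.commute[of "dyadic_inc N x _"])

lemma dyadic_pairing_cong:
  assumes "\<And>j. j < 2^N \<Longrightarrow> dyadic_inc N x j = dyadic_inc N x' j"
  shows "dyadic_pairing N x y = dyadic_pairing N x' y"
  unfolding dyadic_pairing_def using assms by (intro sum.cong) auto

lemma L2_unit_dyadic_step: "dyadic_step N x \<in> L2_unit"
  unfolding dyadic_step_def[abs_def] dyadic_cell_def
  by (intro L2_unit_sum L2_unit_indicator) auto

lemma L2_inner_dyadic_step:
  assumes "f \<in> L2_unit"
  shows "L2_inner (dyadic_step N x) f = dyadic_pairing N x (drift f)"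
  unfolding dyadic_step_def[abs_def] dyadic_pairing_def
  by (subst L2_inner_sum_left)
     (auto simp: assms dyadic_inc_drift L2_inner_commute[of f] intro!: L2_unit_indicator, auto simp: dyadic_cell_def)

lemma dyadic_inc_refine:
  fixes j :: nat
  assumes "N \<le> M"
  shows "dyadic_inc N x j = sum (dyadic_inc M x) {j * 2^(M-N)..<j * 2^(M-N) + 2^(M-N)}"
proof -
  have *: "(2::real)^M = 2^N * 2^(M-N)" using assms by (simp flip: power_add)
  have "sum (dyadic_inc M x) {j * 2^(M-N)..<j * 2^(M-N) + 2^(M-N)}
      = x (real (j * 2^(M-N) + 2^(M-N)) / 2^M) - x (real (j * 2^(M-N)) / 2^M)"
    unfolding dyadic_inc_def
    using sum_Suc_diff'[of "j * 2^(M-N)" "j * 2^(M-N) + 2^(M-N)" "\<lambda>k. x (real k / 2^M)"] by simp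
  also have "real (j * 2^(M-N) + 2^(M-N)) / 2^M = real (Suc j) / 2^N"
    by (simp add: * field_simps)
  also have "real (j * 2^(M-N)) / 2^M = real j / 2^N"
    by (simp add: * field_simps)
  finally show ?thesis by (simp add: dyadic_inc_def)
qed

lemma dyadic_index_bound:
  fixes j k :: nat
  assumes "N \<le> M" "j < 2^N" "k < j * 2^(M-N) + 2^(M-N)"
  shows "k < 2^M"
proof -
  have "k < Suc j * 2^(M-N)" using assms(3) by simp
  also have "\<dots> \<le> 2^N * 2^(M-N)" using assms(2) by (intro mult_right_mono) auto
  also have "\<dots> = 2^M" using assms(1) by (simp flip: power_add)
  finally show ?thesis .
qed

lemma dyadic_cell_refine:
  assumes "N \<le> M" "k \<in> {j * 2^(M-N)..<j * 2^(M-N) + 2^(M-N)}"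
  shows "dyadic_cell M k \<subseteq> dyadic_cell N j"
proof -
  have *: "(2::real)^M = 2^N * 2^(M-N)" using assms by (simp flip: power_add)
  have "j * 2^(M-N) \<le> k" "Suc k \<le> Suc j * 2^(M-N)"
    using assms(2) by auto
  then have "real (j * 2^(M-N)) \<le> real k" "real (Suc k) \<le> real (Suc j * 2^(M-N))"
    by (simp_all only: of_nat_le_iff)
  then have "real (j * 2^(M-N)) / 2^M \<le> real k / 2^M" "real (Suc k) / 2^M \<le> real (Suc j * 2^(M-N)) / 2^M"
    by (auto intro!: divide_right_mono simp del: of_nat_Suc)
  moreover have "real (Suc j * 2^(M-N)) / 2^M = real (Suc j) / 2^N"
    by (subst of_nat_mult) (simp add: * del: of_nat_Suc)
  ultimately have "real j / 2^N \<le> real k / 2^M" "real (Suc k) / 2^M \<le> real (Suc j) / 2^N"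
    by (simp_all add: * del: of_nat_Suc)
  then show ?thesis unfolding dyadic_cell_def by (auto simp del: of_nat_Suc)
qed

lemma dyadic_cell_disjoint:
  assumes "u \<in> dyadic_cell N i" "u \<in> dyadic_cell N j"
  shows "i = j"
proof -
  have "real i < u * 2^N" "u * 2^N \<le> real (Suc i)" "real j < u * 2^N" "u * 2^N \<le> real (Suc j)"
    using assms unfolding dyadic_cell_def by (auto simp: field_simps)
  then have "real i < real (Suc j)" "real j < real (Suc i)" by linarith+
  then show ?thesis by linarith
qed

lemma dyadic_step_on_cell:
  assumes "j < 2^N" "u \<in> dyadic_cell N j"
  shows "dyadic_step N x u = 2^N * dyadic_inc N x j"
proof -
  have "indicator (dyadic_cell N i) u = (if i = j then 1 else 0 :: real)" for i
    using dyadic_cell_disjoint[OF _ assms(2), of i] assms(2) by (cases "u \<in> dyadic_cell N i") auto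
  then have "dyadic_step N x u = (\<Sum>i<2^N. if i = j then 2^N * dyadic_inc N x j else 0)"
    unfolding dyadic_step_def by (intro sum.cong) auto
  with assms(1) show ?thesis by simp
qed

lemma dyadic_inc_drift_step:
  assumes "N \<le> M" "j < 2^N" "k \<in> {j * 2^(M-N)..<j * 2^(M-N) + 2^(M-N)}"
  shows "dyadic_inc M (drift (dyadic_step N x)) k = 2^N / 2^M * dyadic_inc N x j"
proof -
  have k: "k < 2^M" using dyadic_index_bound assms by auto
  have "dyadic_inc M (drift (dyadic_step N x)) k = L2_inner (dyadic_step N x) (indicator (dyadic_cell M k))"
    by (rule dyadic_inc_drift[OF L2_unit_dyadic_step k])
  also have "\<dots> = L2_inner (\<lambda>u. (2^N * dyadic_inc N x j) * indicator (dyadic_cell M k) u) (indicator (dyadic_cell M k))"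
    unfolding L2_inner_def using dyadic_cell_refine[OF assms(1,3)]
    by (intro Bochner_Integration.integral_cong)
       (auto simp: indicator_def intro!: dyadic_step_on_cell assms)
  also have "\<dots> = (2^N * dyadic_inc N x j) * (real (Suc k) / 2^M - real k / 2^M)"
    unfolding L2_inner_cmult_left dyadic_cell_def
    using k dyadic_point_unit[of k M] dyadic_point_unit[of "Suc k" M]
    by (subst measure_unit_leb_Ioc) (auto simp: divide_right_mono)
  finally show ?thesis by (simp add: field_simps)
qed

text \<open>The step function is constant on coarse cells, so the fine increments of its drift are
  equal within each coarse cell, and the fine increments of \<open>y\<close> add up to coarse ones.
  Pairings of different levels can thus be compared at one common level.\<close>

lemma dyadic_pairing_step:
  assumes "N \<le> M"
  shows "dyadic_pairing M (drift (dyadic_step N x)) y = dyadic_pairing N x y"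
proof -
  have M: "2^N * 2^(M-N) = (2::nat)^M" using assms by (simp flip: power_add)
  have "dyadic_pairing M (drift (dyadic_step N x)) y
      = (\<Sum>j<2^N. \<Sum>k=j * 2^(M-N)..<j * 2^(M-N) + 2^(M-N). 2^M * dyadic_inc M (drift (dyadic_step N x)) k * dyadic_inc M y k)"
    unfolding dyadic_pairing_def sum.nat_group M ..
  also have "\<dots> = (\<Sum>j<2^N. \<Sum>k=j * 2^(M-N)..<j * 2^(M-N) + 2^(M-N). 2^N * dyadic_inc N x j * dyadic_inc M y k)"
    by (intro sum.cong refl) (simp add: dyadic_inc_drift_step[OF assms])
  also have "\<dots> = dyadic_pairing N x y"
    unfolding dyadic_pairing_def dyadic_inc_refine[OF assms, of y] by (simp add: sum_distrib_left)
  finally show ?thesis .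
qed

lemma dyadic_inc_drift_step_coarse:
  assumes "N \<le> M" "j < 2^N"
  shows "dyadic_inc N (drift (dyadic_step M x)) j = dyadic_inc N x j"
proof -
  have "dyadic_inc M (drift (dyadic_step M x)) k = dyadic_inc M x k" if "k < 2^M" for k
    using dyadic_inc_drift_step[of M M k k x] that by simp
  then show ?thesis
    using dyadic_index_bound[OF assms] by (simp add: dyadic_inc_refine[OF assms(1)])
qed

text \<open>Averaging a finer average over coarse cells gives the coarse average: the steps are
  successive orthogonal projections, so only the coarser level is seen.\<close>

lemma L2_inner_dyadic_steps:
  assumes "N \<le> M"
  shows "L2_inner (dyadic_step N x) (dyadic_step M x) = dyadic_pairing N x x"
  unfolding L2_inner_dyadic_step[OF L2_unit_dyadic_step]
  using dyadic_pairing_cong[of N "drift (dyadic_step M x)" x x] dyadic_inc_drift_step_coarse[OF assms]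
  by (simp add: dyadic_pairing_commute)

lemma dyadic_pairing_diff_eq:
  assumes "f \<in> L2_unit"
  shows "L2_inner (\<lambda>u. f u - dyadic_step N (drift f) u) (\<lambda>u. f u - dyadic_step N (drift f) u)
    = L2_inner f f - dyadic_pairing N (drift f) (drift f)"
  using assms
  by (simp add: L2_inner_self_diff L2_unit_dyadic_step L2_inner_dyadic_step[OF assms] L2_inner_dyadic_steps)

lemma dyadic_pairing_le_inner:
  assumes "f \<in> L2_unit"
  shows "dyadic_pairing N (drift f) (drift f) \<le> L2_inner f f"
  using dyadic_pairing_diff_eq[OF assms, of N] L2_inner_self_nonneg[of "\<lambda>u. f u - dyadic_step N (drift f) u"]
  by simp

lemma dyadic_step_diff_eq:
  assumes "N \<le> M"
  shows "L2_inner (\<lambda>u. dyadic_step M x u - dyadic_step N x u) (\<lambda>u. dyadic_step M x u - dyadic_step N x u)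
    = dyadic_pairing M x x - dyadic_pairing N x x"
  using assms by (simp add: L2_inner_self_diff L2_unit_dyadic_step L2_inner_dyadic_steps)

lemma dyadic_pairing_mono:
  assumes "N \<le> M"
  shows "dyadic_pairing N x x \<le> dyadic_pairing M x x"
  using dyadic_step_diff_eq[OF assms, of x]
    L2_inner_self_nonneg[of "\<lambda>u. dyadic_step M x u - dyadic_step N x u"] by simp

section \<open>Recovering a function from its primitive at dyadic points\<close>

lemma dyadic_floor:
  assumes "t \<in> {0..1::real}"
  shows "nat \<lfloor>2^N * t\<rfloor> \<le> 2^N" "(\<lambda>N. real (nat \<lfloor>2^N * t\<rfloor>) / 2^N) \<longlonglongrightarrow> t"
proof -
  have "\<lfloor>2^N * t\<rfloor> \<le> \<lfloor>2^N * (1::real)\<rfloor>"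
    using assms by (intro floor_mono mult_left_mono) auto
  also have "\<dots> = 2^N" by (metis floor_of_int mult_1_right of_int_numeral of_int_power)
  finally show "nat \<lfloor>2^N * t\<rfloor> \<le> 2^N" by (simp add: nat_le_iff)
  show "(\<lambda>N. real (nat \<lfloor>2^N * t\<rfloor>) / 2^N) \<longlonglongrightarrow> t"
  proof (rule real_tendsto_sandwich[OF always_eventually always_eventually])
    have fl: "real (nat \<lfloor>2^N * t\<rfloor>) = of_int \<lfloor>2^N * t\<rfloor>" for N
      using assms by (simp add: of_nat_nat)
    show "\<forall>N. t - (1/2)^N \<le> real (nat \<lfloor>2^N * t\<rfloor>) / 2^N"
    proof
      fix N
      have "2^N * t - 1 \<le> of_int \<lfloor>2^N * t\<rfloor>" by linarith
      then have "(2^N * t - 1) / 2^N \<le> of_int \<lfloor>2^N * t\<rfloor> / 2^N"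
        by (rule divide_right_mono) simp
      then show "t - (1/2)^N \<le> real (nat \<lfloor>2^N * t\<rfloor>) / 2^N"
        unfolding fl by (simp add: diff_divide_distrib power_divide)
    qed
    show "\<forall>N. real (nat \<lfloor>2^N * t\<rfloor>) / 2^N \<le> t"
    proof
      fix N
      have "of_int \<lfloor>2^N * t\<rfloor> \<le> 2^N * t" by (rule of_int_floor_le)
      then show "real (nat \<lfloor>2^N * t\<rfloor>) / 2^N \<le> t" unfolding fl by (simp add: field_simps)
    qed
    show "(\<lambda>N. t - (1/2)^N) \<longlonglongrightarrow> t"
      using tendsto_diff[OF tendsto_const LIMSEQ_power_zero[of "1/2::real"], of t] by simp
  qed simp
qed

text \<open>Half-lines form an intersection-stable generator of the Borel sets, so the integral
  vanishes over every Borel set; \<open>tot\<close> serves the complement case of this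
  induction.\<close>

lemma AE_zero_if_half_line_integrals_zero:
  fixes g :: "real \<Rightarrow> real"
  assumes g: "integrable lborel g" and z: "\<And>a. (LINT u:{..a}|lborel. g u) = 0"
    and tot: "(LINT u|lborel. g u) = 0"
  shows "AE u in lborel. g u = 0"
proof (rule density_unique_real[OF g integrable_zero])
  fix A :: "real set"
  assume "A \<in> sets lborel"
  then have A: "A \<in> sigma_sets UNIV (range (\<lambda>a. {..a}))"
    by (simp add: borel_eq_atMost)
  have stable: "Int_stable (range (\<lambda>a::real. {..a}))"
    by (auto simp: Int_stable_def)
  have "range (\<lambda>a::real. {..a}) \<subseteq> Pow UNIV" by simp
  from stable this A have "(LINT u:A|lborel. g u) = 0"
  proof (induction rule: sigma_sets_induct_disjoint)
    case (union A)
    then have "A i \<in> sets lborel" for i by (auto simp: borel_eq_atMost)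
    moreover from this have "(\<Union>i. A i) \<in> sets lborel" by auto
    ultimately have "(LINT u:(\<Union>i. A i)|lborel. g u) = (\<Sum>i. (LINT u:A i|lborel. g u))"
      using union g by (intro lebesgue_integral_countable_add)
        (auto simp: disjoint_family_on_def set_integrable_def simp del: real_scaleR_def intro!: integrable_mult_indicator)
    with union show ?case by simp
  next
    case (compl A)
    have A: "A \<in> sets lborel" using compl by (simp add: borel_eq_atMost)
    have "(LINT u:UNIV - A|lborel. g u) + (LINT u:A|lborel. g u) = (LINT u:(UNIV - A) \<union> A|lborel. g u)"
      using A g by (intro set_integral_Un[symmetric]) (auto simp: set_integrable_def simp del: real_scaleR_def intro!: integrable_mult_indicator)
    also have "(UNIV - A) \<union> A = UNIV" by auto
    finally show ?case using compl tot by (simp add: set_lebesgue_integral_def)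
  qed (use z in \<open>auto simp: set_lebesgue_integral_def\<close>)
  then show "(LINT u:A|lborel. g u) = (LINT u:A|lborel. 0)"
    by (simp add: set_lebesgue_integral_def)
qed

text \<open>Continuity of the drift extends its vanishing from dyadic points to all of [0,1], after
  which all half-line integrals are zero.\<close>

lemma L2_unit_AE_zero_if_drift_zero:
  assumes h: "h \<in> L2_unit" and zero: "\<And>N j. j \<le> 2^N \<Longrightarrow> drift h (real j / 2^N) = 0"
  shows "AE x in unit_leb. h x = 0"
proof -
  have d0: "drift h t = 0" if t: "t \<in> {0..1}" for t
  proof -
    have "(\<lambda>N. drift h (real (nat \<lfloor>2^N * t\<rfloor>) / 2^N)) \<longlonglongrightarrow> drift h t"
      using dyadic_floor[OF t] dyadic_point_unit
      by (intro continuous_on_tendsto_compose[OF continuous_on_drift[OF h]] t always_eventually) auto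
    then show ?thesis
      using zero dyadic_floor(1)[OF t] by (simp add: LIMSEQ_const_iff)
  qed
  define H where "H u = indicator {0..1} u * h u" for u :: real
  have H: "integrable lebesgue H"
    using L2_unit_integrable[OF h] unfolding H_def
    by (subst (asm) integrable_restrict_space) auto
  \<comment> \<open>The uniqueness argument runs over Borel sets and \<open>lborel\<close>, so the
    Lebesgue measurable \<open>H\<close> is replaced by a Borel version.\<close>
  then obtain g where g[measurable]: "g \<in> borel_measurable lborel" and gH: "AE u in lborel. H u = g u"
    using completion_ex_borel_measurable_real[of H lborel] by auto
  have gH': "AE u in lebesgue. H u = g u" using gH by (rule AE_completion)
  have gi': "integrable lebesgue g"
    using H by (rule integrable_cong_AE_imp) (use gH' g in \<open>auto intro: measurable_completion elim: eventually_mono\<close>)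
  then have gi: "integrable lborel g" by (simp add: integrable_completion)
  have int: "(LINT u:A|lborel. g u) = (LINT u|lebesgue. indicator A u * H u)" if "A \<in> sets borel" for A
  proof -
    have "(LINT u:A|lborel. g u) = (LINT u|lebesgue. indicator A u * g u)"
      using that unfolding set_lebesgue_integral_def by (subst integral_completion) auto
    also have "\<dots> = (LINT u|lebesgue. indicator A u * H u)"
      using that gH' borel_measurable_integrable[OF H] borel_measurable_integrable[OF gi']
      by (intro integral_cong_AE borel_measurable_times borel_measurable_indicator) (auto elim: eventually_mono)
    finally show ?thesis .
  qed
  have half: "(LINT u:{..a}|lborel. g u) = 0" for a
  proof (cases "a < 0")
    case True
    then have "(\<lambda>u. indicator {..a} u * H u) = (\<lambda>_. 0)" by (auto simp: H_def indicator_def)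
    then show ?thesis by (simp add: int)
  next
    case False
    have "drift h (min a 1) = (LINT u|lebesgue. indicator {0..min a 1} u *\<^sub>R h u)"
      unfolding drift_def by (rule integral_restrict_space) simp
    also have "(\<lambda>u. indicator {0..min a 1} u *\<^sub>R h u) = (\<lambda>u. indicator {..a} u * H u)"
      by (auto simp: H_def indicator_def)
    finally show ?thesis using d0[of "min a 1"] False by (simp add: int)
  qed
  have "(LINT u|lborel. g u) = (LINT u|lebesgue. indicator UNIV u * H u)"
    using int[of UNIV] by (simp add: set_lebesgue_integral_def)
  also have "(\<lambda>u. indicator UNIV u * H u) = (\<lambda>u. indicator {..1} u * H u)"
    by (auto simp: H_def indicator_def)
  finally have "(LINT u|lborel. g u) = 0" using half[of 1] by (simp add: int)
  then have "AE u in lborel. g u = 0"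
    by (intro AE_zero_if_half_line_integrals_zero gi half)
  then have "AE u in lebesgue. g u = 0" by (rule AE_completion)
  with gH' have "AE u in lebesgue. u \<in> {0..1} \<longrightarrow> h u = 0"
    by eventually_elim (auto simp: H_def)
  then show ?thesis by (subst AE_restrict_space_iff) auto
qed

lemma drift_dyadic_step:
  assumes "N \<le> M" "j \<le> 2^N"
  shows "drift (dyadic_step M (drift f)) (real j / 2^N) = drift f (real j / 2^N)"
  using assms(2)
proof (induction j)
  case (Suc j)
  then have "dyadic_inc N (drift (dyadic_step M (drift f))) j = dyadic_inc N (drift f) j"
    by (intro dyadic_inc_drift_step_coarse assms) simp
  with Suc show ?case by (simp add: dyadic_inc_def)
qed simp

text \<open>The projections have increasing norms bounded by that of \<open>f\<close>, hence form a
  Cauchy sequence. Each step interpolates the drift of \<open>f\<close> at the dyadic points of its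
  level, so the limit has the same drift as \<open>f\<close> at all dyadic points and equals
  \<open>f\<close> almost everywhere.\<close>

lemma dyadic_step_converges:
  assumes f: "f \<in> L2_unit"
  shows "(\<lambda>N. L2_inner (\<lambda>u. f u - dyadic_step N (drift f) u) (\<lambda>u. f u - dyadic_step N (drift f) u)) \<longlonglongrightarrow> 0"
proof -
  let ?s = "\<lambda>N. dyadic_step N (drift f)"
  let ?q = "\<lambda>N. dyadic_pairing N (drift f) (drift f)"
  have "incseq ?q" by (auto simp: incseq_def dyadic_pairing_mono)
  then obtain q where "?q \<longlonglongrightarrow> q"
    using dyadic_pairing_le_inner[OF f] incseq_convergent by metis
  then have C: "Cauchy ?q" by (intro LIMSEQ_imp_Cauchy)
  obtain g where g: "g \<in> borel_measurable unit_leb" "integrable unit_leb (\<lambda>x. (g x)\<^sup>2)"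
    and lim: "(\<lambda>n. \<integral>x. (?s n x - g x)\<^sup>2 \<partial>unit_leb) \<longlonglongrightarrow> 0"
  proof (rule unit_leb.L2_complete[of ?s])
    fix e :: real assume "e > 0"
    then obtain K where K: "\<And>m n. m \<ge> K \<Longrightarrow> n \<ge> K \<Longrightarrow> \<bar>?q m - ?q n\<bar> < e"
      using C unfolding Cauchy_def dist_real_def by meson
    have le: "(\<integral>x. (?s m x - ?s n x)\<^sup>2 \<partial>unit_leb) < e" if "n \<le> m" "n \<ge> K" for m n
      using dyadic_step_diff_eq[OF that(1), of "drift f"] K[of m n] that
      by (auto simp: L2_inner_self)
    have "(\<integral>x. (?s m x - ?s n x)\<^sup>2 \<partial>unit_leb) < e" if "m \<ge> K" "n \<ge> K" for m n
      using le[of n m] le[of m n] that by (cases "n \<le> m") (auto simp: power2_commute)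
    then show "\<exists>N. \<forall>m\<ge>N. \<forall>n\<ge>N. (\<integral>x. (?s m x - ?s n x)\<^sup>2 \<partial>unit_leb) < e" by blast
  qed (use L2_unit_dyadic_step L2_unitD in auto)
  then have gL: "g \<in> L2_unit" by (intro L2_unitI)
  have "drift (\<lambda>x. f x - g x) (real j / 2^N) = 0" if j: "j \<le> 2^N" for N j
  proof -
    let ?t = "real j / 2^N"
    have t: "?t \<in> {0..1}" by (rule dyadic_point_unit[OF j])
    have "(\<lambda>M. drift (?s M) ?t - drift g ?t) \<longlonglongrightarrow> 0"
    proof (rule Lim_null_comparison)
      show "\<forall>\<^sub>F M in sequentially. norm (drift (?s M) ?t - drift g ?t)
          \<le> sqrt (\<integral>x. (?s M x - g x)\<^sup>2 \<partial>unit_leb) * sqrt ?t"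
      proof (rule always_eventually, rule)
        fix M
        have d: "(\<lambda>x. ?s M x - g x) \<in> L2_unit" by (intro L2_unit_diff L2_unit_dyadic_step gL)
        have "\<bar>drift (?s M) ?t - drift g ?t\<bar> = \<bar>drift (\<lambda>x. ?s M x - g x) ?t\<bar>"
          using t by (simp add: drift_diff gL L2_unit_dyadic_step)
        also have "\<dots> \<le> (LINT x|unit_leb. \<bar>(?s M x - g x) * indicator {0<..?t} x\<bar>)"
          unfolding drift_eq_inner[OF t] L2_inner_def by (rule integral_abs_bound)
        also have "\<dots> \<le> sqrt (\<integral>x. (?s M x - g x)\<^sup>2 \<partial>unit_leb) * sqrt (L2_inner (indicator {0<..?t}) (indicator {0<..?t}))"
          unfolding L2_inner_self
          by (rule Cauchy_Schwarz_integral_sqrt) (use L2_unitD[OF d] L2_unitD[OF L2_unit_indicator[of "{0<..?t}"]] in auto)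
        finally show "norm (drift (?s M) ?t - drift g ?t) \<le> sqrt (\<integral>x. (?s M x - g x)\<^sup>2 \<partial>unit_leb) * sqrt ?t"
          using t by (simp add: measure_unit_leb_Ioc)
      qed
      show "(\<lambda>M. sqrt (\<integral>x. (?s M x - g x)\<^sup>2 \<partial>unit_leb) * sqrt ?t) \<longlonglongrightarrow> 0"
        using tendsto_mult[OF tendsto_real_sqrt[OF lim] tendsto_const] by simp
    qed
    moreover have "\<forall>\<^sub>F M in sequentially. drift (?s M) ?t - drift g ?t = drift f ?t - drift g ?t"
      using eventually_ge_at_top[of N] by eventually_elim (simp add: drift_dyadic_step j)
    ultimately have "(\<lambda>M. drift f ?t - drift g ?t) \<longlonglongrightarrow> 0"
      by (simp add: tendsto_cong)
    then show ?thesis using t f gL by (simp add: drift_diff LIMSEQ_const_iff)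
  qed
  then have "AE x in unit_leb. f x - g x = 0"
    by (intro L2_unit_AE_zero_if_drift_zero L2_unit_diff f gL)
  then have "L2_inner (\<lambda>u. f u - ?s N u) (\<lambda>u. f u - ?s N u) = (\<integral>x. (?s N x - g x)\<^sup>2 \<partial>unit_leb)" for N
    unfolding L2_inner_self
    using f gL L2_unit_dyadic_step[of N "drift f"]
    by (intro integral_cong_AE borel_measurable_power borel_measurable_diff L2_unit_measurable)
       (auto elim!: eventually_mono simp: power2_commute)
  with lim show ?thesis by simp
qed

lemma dyadic_pairing_converges:
  assumes "f \<in> L2_unit"
  shows "(\<lambda>N. dyadic_pairing N (drift f) (drift f)) \<longlonglongrightarrow> L2_inner f f"
  using tendsto_diff[OF tendsto_const dyadic_step_converges[OF assms], of "L2_inner f f"]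
  by (simp add: dyadic_pairing_diff_eq[OF assms])

section \<open>The Cameron--Martin formula\<close>

lemma wiener_measureD:
  assumes "wiener_measure \<W>"
  shows wiener_measure_prob_space: "prob_space \<W>"
    and wiener_measure_sets: "sets \<W> = sets path_space"
    and wiener_measure_space: "space \<W> = space path_space"
    and wiener_measure_start: "AE w in \<W>. w 0 = 0"
  using assms sets_eq_imp_space_eq[of \<W> path_space]
  unfolding wiener_measure_def wiener_process_def by auto

lemma space_path_space: "space path_space = {w. w \<in> extensional {0..1} \<and> continuous_on {0..1} w}"
  by (auto simp: path_space_def space_restrict_space space_PiM PiE_def)

lemma measurable_path_eval: "t \<in> {0..1} \<Longrightarrow> (\<lambda>w. w t) \<in> borel_measurable path_space"
  unfolding path_space_def by (intro measurable_restrict_space1 measurable_component_singleton)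

lemma measurable_into_path_space:
  assumes "\<And>t. t \<in> {0..1} \<Longrightarrow> (\<lambda>w. X w t) \<in> borel_measurable M"
    and "\<And>w. w \<in> space M \<Longrightarrow> X w \<in> space path_space"
  shows "X \<in> M \<rightarrow>\<^sub>M path_space"
  unfolding path_space_def
proof (rule measurable_restrict_space2)
  show "X \<in> M \<rightarrow>\<^sub>M Pi\<^sub>M {0..1} (\<lambda>_. borel)"
    using assms by (intro measurable_PiM_single') (auto simp: space_path_space PiE_def)
  show "X \<in> space M \<rightarrow> {x. continuous_on {0..1} x}"
    using assms by (auto simp: space_path_space)
qed

lemma measurable_drift_shift:
  assumes "f \<in> L2_unit"
  shows "(\<lambda>w. \<lambda>t\<in>{0..1}. drift f t + \<sigma> * w t) \<in> path_space \<rightarrow>\<^sub>M path_space"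
proof (rule measurable_into_path_space)
  fix w :: "real \<Rightarrow> real"
  assume "w \<in> space path_space"
  then have "continuous_on {0..1} (\<lambda>t. drift f t + \<sigma> * w t)"
    using continuous_on_drift[OF assms] by (auto simp: space_path_space intro!: continuous_intros)
  then show "(\<lambda>t\<in>{0..1}. drift f t + \<sigma> * w t) \<in> space path_space"
    by (auto simp: space_path_space intro: continuous_on_eq)
next
  fix t :: real assume "t \<in> {0..1}"
  then show "(\<lambda>w. (\<lambda>t\<in>{0..1}. drift f t + \<sigma> * w t) t) \<in> borel_measurable path_space"
    by (auto intro!: borel_measurable_add borel_measurable_times measurable_path_eval)
qed

lemma measurable_dyadic_inc:
  "j < 2^N \<Longrightarrow> (\<lambda>w. dyadic_inc N w j) \<in> borel_measurable path_space"
  unfolding dyadic_inc_def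
  by (intro borel_measurable_diff measurable_path_eval dyadic_point_unit) auto

lemma measurable_dyadic_pairing:
  "dyadic_pairing N x \<in> borel_measurable path_space"
  unfolding dyadic_pairing_def[abs_def]
  by (intro borel_measurable_sum borel_measurable_times borel_measurable_const measurable_dyadic_inc) auto

lemma measurable_dyadic_pairing_wiener:
  "wiener_measure \<W> \<Longrightarrow> dyadic_pairing N x \<in> borel_measurable \<W>"
  by (simp add: measurable_cong_sets[OF wiener_measure_sets refl] measurable_dyadic_pairing)

section \<open>Gaussian shifts of finitely many increments\<close>

lemma normal_density_mult_exp:
  assumes "s > 0"
  shows "normal_density 0 s x * exp (b * x / s\<^sup>2 - b\<^sup>2 / (2 * s\<^sup>2)) = normal_density b s x"
proof -
  have "- (x - 0)\<^sup>2 / (2 * s\<^sup>2) + (b * x / s\<^sup>2 - b\<^sup>2 / (2 * s\<^sup>2)) = - (x - b)\<^sup>2 / (2 * s\<^sup>2)"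
    using assms by (simp add: field_simps power2_eq_square)
  then show ?thesis
    unfolding normal_density_def by (simp add: mult.assoc exp_add[symmetric])
qed

text \<open>Both sides are compared on rectangles, where the exponential factorises and completing
  the square in each coordinate moves the mean from 0 to \<open>b i\<close>.\<close>

lemma PiM_normal_shift:
  assumes I: "finite I" and s: "s > 0"
  shows "density (Pi\<^sub>M I (\<lambda>_. density lborel (normal_density 0 s)))
      (\<lambda>x. ennreal (exp (\<Sum>i\<in>I. b i * x i / s\<^sup>2 - (b i)\<^sup>2 / (2 * s\<^sup>2))))
    = Pi\<^sub>M I (\<lambda>i. density lborel (normal_density (b i) s))" (is "density ?P ?D = Pi\<^sub>M I ?N")
proof -
  interpret N: product_prob_space ?N I
    by (intro product_prob_spaceI prob_space_normal_density s)
  interpret P: product_prob_space "\<lambda>_. density lborel (normal_density 0 s)" I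
    by (intro product_prob_spaceI prob_space_normal_density s)
  let ?d = "\<lambda>i y. ennreal (exp (b i * y / s\<^sup>2 - (b i)\<^sup>2 / (2 * s\<^sup>2)))"
  have [measurable]: "?D \<in> borel_measurable ?P" by measurable
  show ?thesis
  proof (rule N.PiM_eqI[OF I])
    show "sets (density ?P ?D) = sets (Pi\<^sub>M I ?N)"
      by (simp, intro sets_PiM_cong) auto
    fix A :: "'a \<Rightarrow> real set"
    assume "\<And>i. i \<in> I \<Longrightarrow> A i \<in> sets (?N i)"
    then have A: "\<And>i. i \<in> I \<Longrightarrow> A i \<in> sets borel" by simp
    have "emeasure (density ?P ?D) (Pi\<^sub>E I A) = (\<integral>\<^sup>+x. ?D x * indicator (Pi\<^sub>E I A) x \<partial>?P)"
      using A I by (intro emeasure_density) (auto intro!: sets_PiM_I_finite)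
    also have "\<dots> = (\<integral>\<^sup>+x. (\<Prod>i\<in>I. ?d i (x i) * indicator (A i) (x i)) \<partial>?P)"
    proof (rule nn_integral_cong)
      fix x assume "x \<in> space ?P"
      then have "indicator (Pi\<^sub>E I A) x = (\<Prod>i\<in>I. indicator (A i) (x i) :: ennreal)"
        using I by (auto simp: space_PiM PiE_iff indicator_def prod_zero_iff)
      moreover have "?D x = (\<Prod>i\<in>I. ?d i (x i))"
        by (simp add: exp_sum I prod_ennreal)
      ultimately show "?D x * indicator (Pi\<^sub>E I A) x = (\<Prod>i\<in>I. ?d i (x i) * indicator (A i) (x i))"
        by (simp add: prod.distrib)
    qed
    also have "\<dots> = (\<Prod>i\<in>I. \<integral>\<^sup>+y. ?d i y * indicator (A i) y \<partial>density lborel (normal_density 0 s))"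
      using A by (intro P.product_nn_integral_prod I) auto
    also have "\<dots> = (\<Prod>i\<in>I. emeasure (?N i) (A i))"
    proof (rule prod.cong[OF refl])
      fix i assume i: "i \<in> I"
      have "(\<integral>\<^sup>+y. ?d i y * indicator (A i) y \<partial>density lborel (normal_density 0 s))
          = (\<integral>\<^sup>+y. ennreal (normal_density 0 s y) * (?d i y * indicator (A i) y) \<partial>lborel)"
        using A[OF i] by (intro nn_integral_density) auto
      also have "\<dots> = (\<integral>\<^sup>+y. ennreal (normal_density (b i) s y) * indicator (A i) y \<partial>lborel)"
      proof (rule nn_integral_cong)
        fix y
        have "ennreal (normal_density (b i) s y) = ennreal (normal_density 0 s y) * ?d i y"
          unfolding normal_density_mult_exp[OF s, of y "b i", symmetric] by (rule ennreal_mult) auto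
        then show "ennreal (normal_density 0 s y) * (?d i y * indicator (A i) y)
            = ennreal (normal_density (b i) s y) * indicator (A i) y"
          by (simp add: mult.assoc)
      qed
      also have "\<dots> = emeasure (?N i) (A i)"
        using A[OF i] by (subst emeasure_density) auto
      finally show "(\<integral>\<^sup>+y. ?d i y * indicator (A i) y \<partial>density lborel (normal_density 0 s)) = emeasure (?N i) (A i)" .
    qed
    finally show "emeasure (density ?P ?D) (Pi\<^sub>E I A) = (\<Prod>i\<in>I. emeasure (?N i) (A i))" .
  qed
qed

lemma distr_dyadic_inc_shift:
  assumes W: "wiener_measure \<W>"
  shows "distr \<W> (Pi\<^sub>M {..<2^N} (\<lambda>_. borel)) (\<lambda>w. \<lambda>j\<in>{..<2^N}. b j + dyadic_inc N w j)
    = Pi\<^sub>M {..<2^N} (\<lambda>j. density lborel (normal_density (b j) (sqrt (1/2^N))))"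
proof -
  interpret prob_space \<W> by (rule wiener_measure_prob_space[OF W])
  have wp: "wiener_process \<W> (\<lambda>t w. w t)" using W by (simp add: wiener_measure_def)
  define \<tau> where "\<tau> i = real i / 2^N" for i
  have t: "0 \<le> \<tau> 0" "\<forall>i<2^N. \<tau> i < \<tau> (Suc i)" "\<tau> (2^N) \<le> 1"
    by (auto simp: \<tau>_def divide_strict_right_mono)
  have "indep_vars (\<lambda>_. borel) (\<lambda>j w. dyadic_inc N w j) {..<2^N}"
  proof -
    have "indep_vars (\<lambda>_. borel) (\<lambda>i w. w (\<tau> (Suc i)) - w (\<tau> i)) {..<2^N}"
      using wp[unfolded wiener_process_def, THEN conjunct2, THEN conjunct2, THEN conjunct2,
          THEN conjunct2, THEN conjunct2, rule_format, of \<tau> "2^N"] t by blast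
    then show ?thesis unfolding dyadic_inc_def \<tau>_def .
  qed
  then have ind: "indep_vars (\<lambda>_. borel) (\<lambda>j w. b j + dyadic_inc N w j) {..<2^N}"
    by (rule indep_vars_compose2[where Y = "\<lambda>j y. b j + y"]) auto
  have m: "(\<lambda>w. b j + dyadic_inc N w j) \<in> borel_measurable \<W>" if "j < 2^N" for j
    using measurable_dyadic_inc[OF that] by (simp add: measurable_cong_sets[OF wiener_measure_sets[OF W] refl])
  have "distr \<W> (Pi\<^sub>M {..<2^N} (\<lambda>_. borel)) (\<lambda>w. \<lambda>j\<in>{..<2^N}. b j + dyadic_inc N w j)
    = Pi\<^sub>M {..<2^N} (\<lambda>j. distr \<W> borel (\<lambda>w. b j + dyadic_inc N w j))"
    using ind m by (subst indep_vars_iff_distr_eq_PiM'[symmetric]) (auto simp: lessThan_empty_iff)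
  also have "\<dots> = Pi\<^sub>M {..<2^N} (\<lambda>j. density lborel (normal_density (b j) (sqrt (1/2^N))))"
  proof (rule PiM_cong[OF refl])
    fix j :: nat assume "j \<in> {..<2^N}"
    then have j: "j < 2^N" by simp
    have "0 \<le> real j / 2^N" "real j / 2^N < real (Suc j) / 2^N" "real (Suc j) / 2^N \<le> 1"
      using dyadic_point_unit[of "Suc j" N] j by (auto simp: divide_strict_right_mono)
    moreover have "real (Suc j) / 2^N - real j / 2^N = 1 / 2^N"
      by (simp add: diff_divide_distrib[symmetric])
    ultimately have "distributed \<W> lborel (\<lambda>w. dyadic_inc N w j) (\<lambda>x. ennreal (normal_density 0 (sqrt (1/2^N)) x))"
      using wp[unfolded wiener_process_def, THEN conjunct2, THEN conjunct2, THEN conjunct2,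
          THEN conjunct2, THEN conjunct1, rule_format, of "real j / 2^N" "real (Suc j) / 2^N"]
      unfolding dyadic_inc_def by simp
    from normal_density_affine[OF this, of 1 "b j"]
    have "distributed \<W> lborel (\<lambda>w. b j + dyadic_inc N w j) (\<lambda>x. ennreal (normal_density (b j) (sqrt (1/2^N)) x))"
      by simp
    from distributed_distr_eq_density[OF this]
    have "distr \<W> lborel (\<lambda>w. b j + dyadic_inc N w j) = density lborel (normal_density (b j) (sqrt (1/2^N)))" .
    moreover have "distr \<W> lborel (\<lambda>w. b j + dyadic_inc N w j) = distr \<W> borel (\<lambda>w. b j + dyadic_inc N w j)"
      by (rule distr_cong) auto
    ultimately show "distr \<W> borel (\<lambda>w. b j + dyadic_inc N w j) = density lborel (normal_density (b j) (sqrt (1/2^N)))"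
      by simp
  qed
  finally show ?thesis .
qed

text \<open>The increments of level \<open>N\<close> are independent with variance 1/2^N; dividing
  by this variance turns the exponent of the finite-dimensional shift into
  \<open>dyadic_pairing\<close>. This is the Cameron-Martin formula for functionals of finitely many
  increments.\<close>

lemma nn_integral_dyadic_inc_shift:
  assumes W: "wiener_measure \<W>"
    and F[measurable]: "F \<in> borel_measurable (Pi\<^sub>M {..<2^N} (\<lambda>_. borel))"
  shows "(\<integral>\<^sup>+w. F (\<lambda>j\<in>{..<2^N}. dyadic_inc N x j + dyadic_inc N w j) \<partial>\<W>)
    = (\<integral>\<^sup>+w. F (\<lambda>j\<in>{..<2^N}. dyadic_inc N w j) * ennreal (exp (dyadic_pairing N x w - dyadic_pairing N x x / 2)) \<partial>\<W>)"
proof -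
  let ?I = "{..<(2::nat)^N}" and ?s = "sqrt (1/2^N)" and ?b = "dyadic_inc N x"
  let ?V = "\<lambda>b w. \<lambda>j\<in>?I. b j + dyadic_inc N w j"
  have m: "?V b \<in> \<W> \<rightarrow>\<^sub>M Pi\<^sub>M ?I (\<lambda>_. borel)" for b
    using measurable_dyadic_inc
    by (intro measurable_restrict) (auto simp: measurable_cong_sets[OF wiener_measure_sets[OF W] refl])
  let ?D = "\<lambda>y. ennreal (exp (\<Sum>i\<in>?I. ?b i * y i / ?s\<^sup>2 - (?b i)\<^sup>2 / (2 * ?s\<^sup>2)))"
  have [measurable]: "?D \<in> borel_measurable (Pi\<^sub>M ?I (\<lambda>_. borel))" by measurable
  have "(\<integral>\<^sup>+w. F (?V ?b w) \<partial>\<W>) = (\<integral>\<^sup>+y. F y \<partial>distr \<W> (Pi\<^sub>M ?I (\<lambda>_. borel)) (?V ?b))"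
    by (rule nn_integral_distr[symmetric, OF m]) simp
  also have "distr \<W> (Pi\<^sub>M ?I (\<lambda>_. borel)) (?V ?b) = density (distr \<W> (Pi\<^sub>M ?I (\<lambda>_. borel)) (?V (\<lambda>_. 0))) ?D"
    unfolding distr_dyadic_inc_shift[OF W] by (rule PiM_normal_shift[symmetric]) auto
  also have "(\<integral>\<^sup>+y. F y \<partial>\<dots>) = (\<integral>\<^sup>+y. ?D y * F y \<partial>distr \<W> (Pi\<^sub>M ?I (\<lambda>_. borel)) (?V (\<lambda>_. 0)))"
    by (rule nn_integral_density) auto
  also have "\<dots> = (\<integral>\<^sup>+w. ?D (?V (\<lambda>_. 0) w) * F (?V (\<lambda>_. 0) w) \<partial>\<W>)"
    by (rule nn_integral_distr[OF m]) measurable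
  also have "\<dots> = (\<integral>\<^sup>+w. F (?V (\<lambda>_. 0) w) * ennreal (exp (dyadic_pairing N x w - dyadic_pairing N x x / 2)) \<partial>\<W>)"
  proof (rule nn_integral_cong)
    fix w
    have "(\<Sum>i\<in>?I. ?b i * ?V (\<lambda>_. 0) w i / ?s\<^sup>2 - (?b i)\<^sup>2 / (2 * ?s\<^sup>2))
        = dyadic_pairing N x w - dyadic_pairing N x x / 2"
      unfolding dyadic_pairing_def sum_divide_distrib sum_subtractf[symmetric]
      by (intro sum.cong) (auto simp: power2_eq_square field_simps)
    then show "?D (?V (\<lambda>_. 0) w) * F (?V (\<lambda>_. 0) w)
      = F (?V (\<lambda>_. 0) w) * ennreal (exp (dyadic_pairing N x w - dyadic_pairing N x x / 2))"
      by (simp only: mult.commute)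
  qed
  finally show ?thesis by (simp only: add_0_left)
qed

text \<open>The shift formula with F = 1 says that the density has total mass one. The pairing thus
  behaves like a centred normal variable of variance \<open>dyadic_pairing N x x\<close>.\<close>

lemma nn_integral_exp_dyadic_pairing:
  assumes W: "wiener_measure \<W>"
  shows "(\<integral>\<^sup>+w. ennreal (exp (dyadic_pairing N x w)) \<partial>\<W>) = ennreal (exp (dyadic_pairing N x x / 2))"
proof -
  interpret prob_space \<W> by (rule wiener_measure_prob_space[OF W])
  note measurable_dyadic_pairing_wiener[OF W, measurable]
  have "(\<integral>\<^sup>+w. ennreal (exp (dyadic_pairing N x w)) \<partial>\<W>)
      = (\<integral>\<^sup>+w. ennreal (exp (dyadic_pairing N x x / 2)) * ennreal (exp (dyadic_pairing N x w - dyadic_pairing N x x / 2)) \<partial>\<W>)"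
    by (intro nn_integral_cong) (simp add: ennreal_mult[symmetric] exp_add[symmetric])
  also have "\<dots> = ennreal (exp (dyadic_pairing N x x / 2)) * (\<integral>\<^sup>+w. ennreal (exp (dyadic_pairing N x w - dyadic_pairing N x x / 2)) \<partial>\<W>)"
    by (rule nn_integral_cmult) simp
  also have "(\<integral>\<^sup>+w. ennreal (exp (dyadic_pairing N x w - dyadic_pairing N x x / 2)) \<partial>\<W>) = 1"
    using nn_integral_dyadic_inc_shift[OF W, of "\<lambda>_. 1" N x] by (simp add: emeasure_space_1)
  finally show ?thesis by simp
qed

lemma square_le_exp: "x\<^sup>2 \<le> 2 * (exp x + exp (- x))" for x :: real
proof -
  have "y\<^sup>2 \<le> 2 * exp y" if "0 \<le> y" for y :: real
    using exp_lower_Taylor_quadratic[OF that] that by (simp add: power2_eq_square)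
  from this[of "\<bar>x\<bar>"] show ?thesis
    using exp_gt_zero[of x] exp_gt_zero[of "-x"] by (cases "0 \<le> x") (auto simp: algebra_simps intro: order_trans)
qed

text \<open>Only exponential moments are at hand, so the square is dominated by two exponentials.
  The constant 8 in place of 1 is harmless where the bound only has to force convergence.\<close>

lemma nn_integral_square_le:
  fixes X :: "'a \<Rightarrow> real"
  assumes [measurable]: "X \<in> borel_measurable M" and v: "v > 0"
    and "(\<integral>\<^sup>+w. ennreal (exp (X w / sqrt v)) \<partial>M) \<le> ennreal (exp (1/2))"
    and "(\<integral>\<^sup>+w. ennreal (exp (- X w / sqrt v)) \<partial>M) \<le> ennreal (exp (1/2))"
  shows "(\<integral>\<^sup>+w. ennreal ((X w)\<^sup>2) \<partial>M) \<le> ennreal (8 * v)"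
proof -
  have "(\<integral>\<^sup>+w. ennreal ((X w)\<^sup>2) \<partial>M)
      \<le> (\<integral>\<^sup>+w. ennreal (2 * v) * (ennreal (exp (X w / sqrt v)) + ennreal (exp (- X w / sqrt v))) \<partial>M)"
  proof (rule nn_integral_mono)
    fix w
    have "(X w)\<^sup>2 = v * (X w / sqrt v)\<^sup>2" using v by (simp add: power_divide)
    also have "\<dots> \<le> v * (2 * (exp (X w / sqrt v) + exp (- (X w / sqrt v))))"
      using v square_le_exp by (intro mult_left_mono) auto
    also have "\<dots> = (2 * v) * (exp (X w / sqrt v) + exp (- X w / sqrt v))" by simp
    finally have "ennreal ((X w)\<^sup>2) \<le> ennreal ((2 * v) * (exp (X w / sqrt v) + exp (- X w / sqrt v)))"
      by (rule ennreal_leI)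
    then show "ennreal ((X w)\<^sup>2) \<le> ennreal (2 * v) * (ennreal (exp (X w / sqrt v)) + ennreal (exp (- X w / sqrt v)))"
      using v by (simp add: ennreal_mult)
  qed
  also have "\<dots> = ennreal (2 * v) * ((\<integral>\<^sup>+w. ennreal (exp (X w / sqrt v)) \<partial>M) + (\<integral>\<^sup>+w. ennreal (exp (- X w / sqrt v)) \<partial>M))"
    by (subst nn_integral_cmult, simp, subst nn_integral_add) simp_all
  also have "\<dots> \<le> ennreal (2 * v) * (ennreal (exp (1/2)) + ennreal (exp (1/2)))"
    by (intro mult_left_mono add_mono assms) simp
  also have "\<dots> = ennreal ((2 * v) * (2 * exp (1/2)))"
    using v by (subst ennreal_plus[symmetric], simp, simp, subst ennreal_mult[symmetric]) auto
  also have "\<dots> \<le> ennreal (8 * v)"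
    using exp_bound[of "1/2"] v by (intro ennreal_leI) (auto simp: power2_eq_square)
  finally show ?thesis .
qed

section \<open>Second moments of pairings and the Wiener integral\<close>

lemma dyadic_pairing_cmult_left: "dyadic_pairing N (\<lambda>s. c * x s) y = c * dyadic_pairing N x y"
  unfolding dyadic_pairing_def dyadic_inc_def sum_distrib_left
  by (intro sum.cong) (auto simp: algebra_simps)

lemma dyadic_pairing_cmult_right: "dyadic_pairing N x (\<lambda>s. c * y s) = c * dyadic_pairing N x y"
  by (simp add: dyadic_pairing_commute[of N x] dyadic_pairing_cmult_left)

text \<open>An upper bound \<open>v > 0\<close> stands in for the variance, which may be zero,
  because the variable is rescaled by 1 / sqrt v.\<close>

lemma dyadic_pairing_second_moment:
  assumes W: "wiener_measure \<W>" and v: "v > 0" "dyadic_pairing N x x \<le> v"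
  shows "integrable \<W> (\<lambda>w. (dyadic_pairing N x w)\<^sup>2)"
    and "(\<integral>w. (dyadic_pairing N x w)\<^sup>2 \<partial>\<W>) \<le> 8 * v"
proof -
  note measurable_dyadic_pairing_wiener[OF W, measurable]
  have *: "(\<integral>\<^sup>+w. ennreal (exp (c * dyadic_pairing N x w)) \<partial>\<W>) \<le> ennreal (exp (1/2))" if "c\<^sup>2 = 1 / v" for c
  proof -
    have "(\<integral>\<^sup>+w. ennreal (exp (c * dyadic_pairing N x w)) \<partial>\<W>) = ennreal (exp (c\<^sup>2 * dyadic_pairing N x x / 2))"
      using nn_integral_exp_dyadic_pairing[OF W, of N "\<lambda>s. c * x s"]
      by (simp add: dyadic_pairing_cmult_left dyadic_pairing_cmult_right power2_eq_square mult.assoc)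
    also have "\<dots> \<le> ennreal (exp (1/2))"
      using v that mult_left_mono[OF v(2), of "c\<^sup>2"] by (intro ennreal_leI) simp
    finally show ?thesis .
  qed
  have le: "(\<integral>\<^sup>+w. ennreal ((dyadic_pairing N x w)\<^sup>2) \<partial>\<W>) \<le> ennreal (8 * v)"
    using v *[of "1 / sqrt v"] *[of "- (1 / sqrt v)"]
    by (intro nn_integral_square_le) (auto simp: power_divide)
  show int: "integrable \<W> (\<lambda>w. (dyadic_pairing N x w)\<^sup>2)"
    using le by (intro integrableI_bounded) (auto intro: le_less_trans)
  show "(\<integral>w. (dyadic_pairing N x w)\<^sup>2 \<partial>\<W>) \<le> 8 * v"
    using le v unfolding nn_integral_eq_integral[OF int, simplified] by simp
qed

text \<open>A relation rather than a function of \<open>f\<close>, since an L^2 limit is determined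
  only up to null sets.\<close>

definition is_wiener_integral :: "(real \<Rightarrow> real) measure \<Rightarrow> (real \<Rightarrow> real) \<Rightarrow> ((real \<Rightarrow> real) \<Rightarrow> real) \<Rightarrow> bool" where
  "is_wiener_integral \<W> f \<xi> \<longleftrightarrow> \<xi> \<in> borel_measurable \<W> \<and> integrable \<W> (\<lambda>w. (\<xi> w)\<^sup>2) \<and>
     (\<lambda>N. \<integral>w. (dyadic_pairing N (drift f) w - \<xi> w)\<^sup>2 \<partial>\<W>) \<longlonglongrightarrow> 0"

lemma dyadic_pairing_diff_left: "dyadic_pairing N (\<lambda>s. x s - x' s) y = dyadic_pairing N x y - dyadic_pairing N x' y"
  unfolding dyadic_pairing_def dyadic_inc_def sum_subtractf[symmetric]
  by (intro sum.cong) (auto simp: algebra_simps)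

lemma dyadic_pairing_sum_left:
  "dyadic_pairing N (\<lambda>s. \<Sum>i\<in>I. c i * x i s) y = (\<Sum>i\<in>I. c i * dyadic_pairing N (x i) y)"
proof -
  have "dyadic_inc N (\<lambda>s. \<Sum>i\<in>I. c i * x i s) j = (\<Sum>i\<in>I. c i * dyadic_inc N (x i) j)" for j
    unfolding dyadic_inc_def by (simp add: sum_subtractf right_diff_distrib)
  then show ?thesis
    unfolding dyadic_pairing_def
    by (simp add: sum_distrib_left sum_distrib_right mult.assoc mult.left_commute)
       (rule sum.swap)
qed

lemma dyadic_inc_cong:
  assumes "\<And>t. t \<in> {0..1} \<Longrightarrow> x t = y t" "j < 2^N"
  shows "dyadic_inc N x j = dyadic_inc N y j"
  using assms dyadic_point_unit[of j N] dyadic_point_unit[of "Suc j" N] by (simp add: dyadic_inc_def)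

text \<open>For M \<ge> N, the difference of the pairings of levels M and N is the level M pairing
  with the drift of f minus its level N step. Its variance is at most the squared norm of that
  difference, which tends to zero, and completeness supplies the limit.\<close>

lemma wiener_integral_exists:
  assumes W: "wiener_measure \<W>" and f: "f \<in> L2_unit"
  shows "\<exists>\<xi>. is_wiener_integral \<W> f \<xi>"
proof -
  interpret prob_space \<W> by (rule wiener_measure_prob_space[OF W])
  note m = measurable_dyadic_pairing_wiener[OF W]
  let ?I = "\<lambda>N. dyadic_pairing N (drift f)"
  let ?d = "\<lambda>N u. f u - dyadic_step N (drift f) u"
  have le: "(\<integral>w. (?I M w - ?I N w)\<^sup>2 \<partial>\<W>) \<le> 8 * v" if "N \<le> M" "v > 0" "L2_inner (?d N) (?d N) \<le> v" for M N v
  proof -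
    have "?I M w - ?I N w = dyadic_pairing M (drift (?d N)) w" for w
    proof -
      have "?I M w - ?I N w = dyadic_pairing M (\<lambda>s. drift f s - drift (dyadic_step N (drift f)) s) w"
        by (simp add: dyadic_pairing_diff_left dyadic_pairing_step[OF that(1)])
      also have "\<dots> = dyadic_pairing M (drift (?d N)) w"
        by (intro dyadic_pairing_cong dyadic_inc_cong) (auto simp: drift_diff f L2_unit_dyadic_step)
      finally show ?thesis .
    qed
    moreover have "dyadic_pairing M (drift (?d N)) (drift (?d N)) \<le> v"
      using dyadic_pairing_le_inner[of "?d N" M] that by (simp add: L2_unit_diff f L2_unit_dyadic_step)
    ultimately show ?thesis
      using dyadic_pairing_second_moment(2)[OF W that(2)] by simp
  qed
  obtain \<xi> where "\<xi> \<in> borel_measurable \<W>" "integrable \<W> (\<lambda>w. (\<xi> w)\<^sup>2)"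
    "(\<lambda>N. \<integral>w. (?I N w - \<xi> w)\<^sup>2 \<partial>\<W>) \<longlonglongrightarrow> 0"
  proof (rule L2_complete[of ?I, OF m])
    show "integrable \<W> (\<lambda>w. (?I n w)\<^sup>2)" for n
      by (rule dyadic_pairing_second_moment(1)[OF W, of "\<bar>dyadic_pairing n (drift f) (drift f)\<bar> + 1"]) auto
    fix e :: real assume "e > 0"
    \<comment> \<open>16 pays for the factor 8 of the second moment bound and still leaves a strict
      inequality.\<close>
    then have "\<forall>\<^sub>F N in sequentially. L2_inner (?d N) (?d N) < e / 16"
      by (intro order_tendstoD[OF dyadic_step_converges[OF f]]) auto
    then obtain K where K: "\<And>N. N \<ge> K \<Longrightarrow> L2_inner (?d N) (?d N) < e / 16"
      by (auto simp: eventually_sequentially)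
    have half: "(\<integral>w. (?I m w - ?I n w)\<^sup>2 \<partial>\<W>) < e" if "n \<le> m" "K \<le> n" for m n
      using le[OF that(1), of "e/16"] K[OF that(2)] \<open>e > 0\<close> by simp
    have "(\<integral>w. (?I m w - ?I n w)\<^sup>2 \<partial>\<W>) < e" if "m \<ge> K" "n \<ge> K" for m n
      using half[of n m] half[of m n] that by (cases "n \<le> m") (auto simp: power2_commute)
    then show "\<exists>N. \<forall>m\<ge>N. \<forall>n\<ge>N. (\<integral>w. (?I m w - ?I n w)\<^sup>2 \<partial>\<W>) < e" by blast
  qed
  then show ?thesis unfolding is_wiener_integral_def by blast
qed

text \<open>By Cauchy-Schwarz in the index, the squared error of a finite combination is at most the
  sum of the squared coefficients times the sum of the squared errors.\<close>

lemma is_wiener_integral_sum: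
  assumes W: "wiener_measure \<W>" and "finite I"
    and f: "\<And>i. i \<in> I \<Longrightarrow> f i \<in> L2_unit" and xi: "\<And>i. i \<in> I \<Longrightarrow> is_wiener_integral \<W> (f i) (\<xi> i)"
  shows "is_wiener_integral \<W> (\<lambda>x. \<Sum>i\<in>I. c i * f i x) (\<lambda>w. \<Sum>i\<in>I. c i * \<xi> i w)"
proof -
  note m = measurable_dyadic_pairing_wiener[OF W]
  have sq: "integrable \<W> (\<lambda>w. (dyadic_pairing N x w)\<^sup>2)" for N x
    by (rule dyadic_pairing_second_moment(1)[OF W, of "\<bar>dyadic_pairing N x x\<bar> + 1"]) auto
  have eq: "dyadic_pairing N (drift (\<lambda>x. \<Sum>i\<in>I. c i * f i x)) w = (\<Sum>i\<in>I. c i * dyadic_pairing N (drift (f i)) w)" for N w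
    unfolding dyadic_pairing_sum_left[symmetric]
    by (intro dyadic_pairing_cong dyadic_inc_cong drift_sum f) auto
  have D: "integrable \<W> (\<lambda>w. (dyadic_pairing N (drift (f i)) w - \<xi> i w)\<^sup>2)" if "i \<in> I" for N i
    using xi[OF that] unfolding is_wiener_integral_def by (intro integrable_square_diff m sq) auto
  have meas: "\<xi> i \<in> borel_measurable \<W>" if "i \<in> I" for i
    using xi[OF that] unfolding is_wiener_integral_def by auto
  have [measurable]: "(\<lambda>w. \<Sum>i\<in>I. c i * \<xi> i w) \<in> borel_measurable \<W>"
    using meas by (intro borel_measurable_sum borel_measurable_times) auto
  have CS: "(\<Sum>i\<in>I. c i * a i)\<^sup>2 \<le> (\<Sum>i\<in>I. (c i)\<^sup>2) * (\<Sum>i\<in>I. (a i)\<^sup>2)" for a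
    by (rule Cauchy_Schwarz_ineq_sum)
  have i1: "integrable \<W> (\<lambda>w. (\<Sum>i\<in>I. c i * \<xi> i w)\<^sup>2)"
  proof (rule Bochner_Integration.integrable_bound)
    show "integrable \<W> (\<lambda>w. (\<Sum>i\<in>I. (c i)\<^sup>2) * (\<Sum>i\<in>I. (\<xi> i w)\<^sup>2))"
      using xi unfolding is_wiener_integral_def by auto
  qed (use CS in \<open>auto simp: abs_of_nonneg sum_nonneg\<close>)
  have le: "(\<integral>w. (dyadic_pairing N (drift (\<lambda>x. \<Sum>i\<in>I. c i * f i x)) w - (\<Sum>i\<in>I. c i * \<xi> i w))\<^sup>2 \<partial>\<W>)
     \<le> (\<Sum>i\<in>I. (c i)\<^sup>2) * (\<Sum>i\<in>I. \<integral>w. (dyadic_pairing N (drift (f i)) w - \<xi> i w)\<^sup>2 \<partial>\<W>)" for N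
  proof -
    have "(\<integral>w. (dyadic_pairing N (drift (\<lambda>x. \<Sum>i\<in>I. c i * f i x)) w - (\<Sum>i\<in>I. c i * \<xi> i w))\<^sup>2 \<partial>\<W>)
      \<le> (\<integral>w. (\<Sum>i\<in>I. (c i)\<^sup>2) * (\<Sum>i\<in>I. (dyadic_pairing N (drift (f i)) w - \<xi> i w)\<^sup>2) \<partial>\<W>)"
    proof (rule integral_mono)
      show "integrable \<W> (\<lambda>w. (dyadic_pairing N (drift (\<lambda>x. \<Sum>i\<in>I. c i * f i x)) w - (\<Sum>i\<in>I. c i * \<xi> i w))\<^sup>2)"
        by (intro integrable_square_diff m sq i1) auto
      show "integrable \<W> (\<lambda>w. (\<Sum>i\<in>I. (c i)\<^sup>2) * (\<Sum>i\<in>I. (dyadic_pairing N (drift (f i)) w - \<xi> i w)\<^sup>2))"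
        using D by auto
      fix w
      show "(dyadic_pairing N (drift (\<lambda>x. \<Sum>i\<in>I. c i * f i x)) w - (\<Sum>i\<in>I. c i * \<xi> i w))\<^sup>2
        \<le> (\<Sum>i\<in>I. (c i)\<^sup>2) * (\<Sum>i\<in>I. (dyadic_pairing N (drift (f i)) w - \<xi> i w)\<^sup>2)"
        unfolding eq sum_subtractf[symmetric] right_diff_distrib[symmetric]
        using CS[of "\<lambda>i. dyadic_pairing N (drift (f i)) w - \<xi> i w"]
        .
    qed
    also have "\<dots> = (\<Sum>i\<in>I. (c i)\<^sup>2) * (\<Sum>i\<in>I. \<integral>w. (dyadic_pairing N (drift (f i)) w - \<xi> i w)\<^sup>2 \<partial>\<W>)"
      using D by (simp add: Bochner_Integration.integral_sum)
    finally show ?thesis .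
  qed
  have "(\<lambda>N. (\<Sum>i\<in>I. (c i)\<^sup>2) * (\<Sum>i\<in>I. \<integral>w. (dyadic_pairing N (drift (f i)) w - \<xi> i w)\<^sup>2 \<partial>\<W>)) \<longlonglongrightarrow> (\<Sum>i\<in>I. (c i)\<^sup>2) * (\<Sum>i\<in>I. 0)"
    using xi unfolding is_wiener_integral_def by (intro tendsto_mult tendsto_const tendsto_sum) auto
  then have "(\<lambda>N. (\<Sum>i\<in>I. (c i)\<^sup>2) * (\<Sum>i\<in>I. \<integral>w. (dyadic_pairing N (drift (f i)) w - \<xi> i w)\<^sup>2 \<partial>\<W>)) \<longlonglongrightarrow> 0"
    by simp
  then have "(\<lambda>N. \<integral>w. (dyadic_pairing N (drift (\<lambda>x. \<Sum>i\<in>I. c i * f i x)) w - (\<Sum>i\<in>I. c i * \<xi> i w))\<^sup>2 \<partial>\<W>) \<longlonglongrightarrow> 0"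
    by (rule tendsto_sandwich[OF always_eventually always_eventually tendsto_const, rotated 2]) (simp_all add: le)
  with i1 show ?thesis unfolding is_wiener_integral_def by auto
qed

lemma abs_exp_diff_le: "\<bar>exp x - exp y\<bar> \<le> \<bar>x - y\<bar> * (exp x + exp y)" for x y :: real
proof -
  have *: "exp a - exp b \<le> (a - b) * exp a" for a b :: real
  proof -
    have "exp a * (1 + (b - a)) \<le> exp a * exp (b - a)"
      by (intro mult_left_mono exp_ge_add_one_self) simp
    also have "\<dots> = exp b" by (simp add: exp_add[symmetric])
    finally show ?thesis by (simp add: algebra_simps)
  qed
  have "(a - b) * exp a \<le> \<bar>x - y\<bar> * (exp x + exp y)" if "{a, b} = {x, y}" for a b
  proof -
    have "(a - b) * exp a \<le> \<bar>a - b\<bar> * (exp a + exp b)"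
      by (intro mult_mono) auto
    also have "\<dots> = \<bar>x - y\<bar> * (exp x + exp y)"
      using that by (auto simp: doubleton_eq_iff abs_minus_commute add.commute)
    finally show ?thesis .
  qed
  from this[of x y] this[of y x] *[of x y] *[of y x] show ?thesis by (auto simp: insert_commute)
qed

text \<open>A difference of exponentials is at most the difference of the exponents times the sum of
  the exponentials. Cauchy-Schwarz separates an L^2 error that tends to zero from second moments
  that are bounded uniformly in the level. The L^1 form allows passage to the limit under the
  integral over any fixed event.\<close>

lemma wiener_integral_exp_L1:
  assumes W: "wiener_measure \<W>" and f: "f \<in> L2_unit" and xi: "is_wiener_integral \<W> f \<xi>"
  shows "integrable \<W> (\<lambda>w. exp (dyadic_pairing N (drift f) w - dyadic_pairing N (drift f) (drift f) / 2))" (is "integrable _ (?D N)")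
    and "integrable \<W> (\<lambda>w. exp (\<xi> w - L2_inner f f / 2))" (is "integrable _ ?E")
    and "(\<lambda>N. \<integral>w. \<bar>exp (dyadic_pairing N (drift f) w - dyadic_pairing N (drift f) (drift f) / 2)
      - exp (\<xi> w - L2_inner f f / 2)\<bar> \<partial>\<W>) \<longlonglongrightarrow> 0"
proof -
  interpret prob_space \<W> by (rule wiener_measure_prob_space[OF W])
  let ?I = "\<lambda>N. dyadic_pairing N (drift f)"
  let ?q = "\<lambda>N. dyadic_pairing N (drift f) (drift f)"
  let ?Q = "L2_inner f f"
  note m[measurable] = measurable_dyadic_pairing_wiener[OF W]
  have [measurable]: "\<xi> \<in> borel_measurable \<W>" and xi2: "integrable \<W> (\<lambda>w. (\<xi> w)\<^sup>2)"
    and lim: "(\<lambda>N. \<integral>w. (?I N w - \<xi> w)\<^sup>2 \<partial>\<W>) \<longlonglongrightarrow> 0"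
    using xi by (auto simp: is_wiener_integral_def)
  have I2: "integrable \<W> (\<lambda>w. (?I N w)\<^sup>2)" for N
    by (rule dyadic_pairing_second_moment(1)[OF W, of "\<bar>?q N\<bar> + 1"]) auto
  have q: "0 \<le> ?q N" "?q N \<le> ?Q" for N
    using dyadic_pairing_le_inner[OF f] by (auto simp: dyadic_pairing_def mult.assoc sum_nonneg)
  have a: "(\<integral>\<^sup>+w. ennreal (exp (2 * ?I N w)) \<partial>\<W>) \<le> ennreal (exp (2 * ?Q))" for N
  proof -
    have "(\<integral>\<^sup>+w. ennreal (exp (2 * ?I N w)) \<partial>\<W>) = ennreal (exp (2 * ?q N))"
      using nn_integral_exp_dyadic_pairing[OF W, of N "\<lambda>s. 2 * drift f s"]
      by (simp add: dyadic_pairing_cmult_left dyadic_pairing_cmult_right)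
    then show ?thesis using q by (simp add: ennreal_leI)
  qed
  obtain r where r: "strict_mono r" "AE w in \<W>. (\<lambda>n. ?I (r n) w) \<longlonglongrightarrow> \<xi> w"
    using L2_subseq_AE[OF m _ I2 xi2 lim] by auto
  \<comment> \<open>The exponential moment passes to \<xi> by Fatou's lemma along an almost
    everywhere convergent subsequence.\<close>
  have b: "(\<integral>\<^sup>+w. ennreal (exp (2 * \<xi> w)) \<partial>\<W>) \<le> ennreal (exp (2 * ?Q))"
  proof -
    have "(\<integral>\<^sup>+w. ennreal (exp (2 * \<xi> w)) \<partial>\<W>) = (\<integral>\<^sup>+w. liminf (\<lambda>n. ennreal (exp (2 * ?I (r n) w))) \<partial>\<W>)"
      by (rule nn_integral_cong_AE, use r(2) in eventually_elim)
         (intro lim_imp_Liminf[symmetric] tendsto_ennrealI tendsto_exp tendsto_mult tendsto_const, auto)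
    also have "\<dots> \<le> liminf (\<lambda>n. \<integral>\<^sup>+w. ennreal (exp (2 * ?I (r n) w)) \<partial>\<W>)"
      by (rule nn_integral_liminf) auto
    also have "\<dots> \<le> liminf (\<lambda>n::nat. ennreal (exp (2 * ?Q)))"
      by (intro Liminf_mono always_eventually allI a)
    finally show ?thesis by (simp add: Liminf_const)
  qed
  have sq: "integrable \<W> (\<lambda>w. (exp (X w - c / 2))\<^sup>2) \<and> (\<integral>w. (exp (X w - c / 2))\<^sup>2 \<partial>\<W>) \<le> exp (2 * ?Q)"
    if [measurable]: "X \<in> borel_measurable \<W>" and X: "(\<integral>\<^sup>+w. ennreal (exp (2 * X w)) \<partial>\<W>) \<le> ennreal (exp (2 * ?Q))"
      and c: "0 \<le> c" for X c
  proof -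
    have "(\<integral>\<^sup>+w. ennreal ((exp (X w - c / 2))\<^sup>2) \<partial>\<W>) \<le> (\<integral>\<^sup>+w. ennreal (exp (2 * X w)) \<partial>\<W>)"
      using c by (intro nn_integral_mono ennreal_leI) (simp add: power2_eq_square flip: exp_add)
    with X have le: "(\<integral>\<^sup>+w. ennreal ((exp (X w - c / 2))\<^sup>2) \<partial>\<W>) \<le> ennreal (exp (2 * ?Q))"
      by (rule order_trans[rotated])
    have int: "integrable \<W> (\<lambda>w. (exp (X w - c / 2))\<^sup>2)"
      using le by (intro integrableI_bounded) (auto intro: le_less_trans)
    then show ?thesis using le unfolding nn_integral_eq_integral[OF int, simplified] by simp
  qed
  note sqD = sq[OF m a q(1)]
  note sqE = sq[OF _ b L2_inner_self_nonneg[of f], simplified]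
  show iD: "integrable \<W> (?D N)" for N
    by (rule integrable_if_square_integrable[OF _ conjunct1[OF sqD]]) simp
  show iE: "integrable \<W> ?E"
    by (rule integrable_if_square_integrable[OF _ conjunct1[OF sqE]]) simp_all
  let ?Z = "\<lambda>N w. (?I N w - ?q N / 2) - (\<xi> w - ?Q / 2)"
  have iZ: "integrable \<W> (\<lambda>w. (?Z N w)\<^sup>2)" for N
    by (intro integrable_square_diff I2 xi2) auto
  have iIxi: "integrable \<W> (\<lambda>w. (?I N w - \<xi> w)\<^sup>2)" for N
    by (intro integrable_square_diff I2 xi2) auto
  have Z: "(\<integral>w. (?Z N w)\<^sup>2 \<partial>\<W>) \<le> 2 * (\<integral>w. (?I N w - \<xi> w)\<^sup>2 \<partial>\<W>) + (?Q - ?q N)\<^sup>2 / 2" for N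
  proof -
    have "(\<integral>w. (?Z N w)\<^sup>2 \<partial>\<W>) \<le> (\<integral>w. 2 * (?I N w - \<xi> w)\<^sup>2 + (?Q - ?q N)\<^sup>2 / 2 \<partial>\<W>)"
    proof (rule integral_mono[OF iZ])
      show "integrable \<W> (\<lambda>w. 2 * (?I N w - \<xi> w)\<^sup>2 + (?Q - ?q N)\<^sup>2 / 2)" using iIxi by simp
      fix w
      have "(u + v)\<^sup>2 \<le> 2 * u\<^sup>2 + 2 * v\<^sup>2" for u v :: real
        using sum_squares_bound[of u v] by (simp add: power2_sum)
      moreover have "?Z N w = (?I N w - \<xi> w) + (?Q - ?q N) / 2" by (simp add: field_simps)
      moreover have "(?Q - ?q N)\<^sup>2 / 2 = 2 * ((?Q - ?q N) / 2)\<^sup>2" by (simp add: power_divide)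
      ultimately
      show "(?Z N w)\<^sup>2 \<le> 2 * (?I N w - \<xi> w)\<^sup>2 + (?Q - ?q N)\<^sup>2 / 2"
        by (simp only:)
    qed
    also have "\<dots> = 2 * (\<integral>w. (?I N w - \<xi> w)\<^sup>2 \<partial>\<W>) + (?Q - ?q N)\<^sup>2 / 2"
      using iIxi by (simp add: prob_space)
    finally show ?thesis .
  qed
  have S: "integrable \<W> (\<lambda>w. (?D N w + ?E w)\<^sup>2) \<and> (\<integral>w. (?D N w + ?E w)\<^sup>2 \<partial>\<W>) \<le> 4 * exp (2 * ?Q)" for N
  proof
    show i: "integrable \<W> (\<lambda>w. (?D N w + ?E w)\<^sup>2)"
      by (intro integrable_square_add conjunct1[OF sqD] conjunct1[OF sqE]) simp_all
    have "(\<integral>w. (?D N w + ?E w)\<^sup>2 \<partial>\<W>) \<le> (\<integral>w. 2 * (?D N w)\<^sup>2 + 2 * (?E w)\<^sup>2 \<partial>\<W>)"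
    proof (rule integral_mono[OF i])
      show "integrable \<W> (\<lambda>w. 2 * (?D N w)\<^sup>2 + 2 * (?E w)\<^sup>2)"
        using conjunct1[OF sqD] conjunct1[OF sqE] by simp
      fix w
      show "(?D N w + ?E w)\<^sup>2 \<le> 2 * (?D N w)\<^sup>2 + 2 * (?E w)\<^sup>2"
        using sum_squares_bound[of "?D N w" "?E w"] by (simp add: power2_sum)
    qed
    also have "\<dots> = 2 * (\<integral>w. (?D N w)\<^sup>2 \<partial>\<W>) + 2 * (\<integral>w. (?E w)\<^sup>2 \<partial>\<W>)"
      using conjunct1[OF sqD] conjunct1[OF sqE] by simp
    also have "\<dots> \<le> 2 * exp (2 * ?Q) + 2 * exp (2 * ?Q)"
      by (intro add_mono mult_left_mono conjunct2[OF sqD] conjunct2[OF sqE]) auto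
    finally show "(\<integral>w. (?D N w + ?E w)\<^sup>2 \<partial>\<W>) \<le> 4 * exp (2 * ?Q)" by simp
  qed
  have le: "(\<integral>w. \<bar>?D N w - ?E w\<bar> \<partial>\<W>)
      \<le> sqrt (2 * (\<integral>w. (?I N w - \<xi> w)\<^sup>2 \<partial>\<W>) + (?Q - ?q N)\<^sup>2 / 2) * sqrt (4 * exp (2 * ?Q))" for N
  proof -
    have "(\<integral>w. \<bar>?D N w - ?E w\<bar> \<partial>\<W>) \<le> (\<integral>w. \<bar>?Z N w * (?D N w + ?E w)\<bar> \<partial>\<W>)"
    proof (rule integral_mono)
      show "integrable \<W> (\<lambda>w. \<bar>?D N w - ?E w\<bar>)" using iD iE by simp
      show "integrable \<W> (\<lambda>w. \<bar>?Z N w * (?D N w + ?E w)\<bar>)"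
        by (intro integrable_abs integrable_mult_square_integrable iZ conjunct1[OF S]) simp_all
      show "\<bar>?D N w - ?E w\<bar> \<le> \<bar>?Z N w * (?D N w + ?E w)\<bar>" for w
        using abs_exp_diff_le[of "?I N w - ?q N / 2" "\<xi> w - ?Q / 2"]
        by (simp add: abs_mult abs_of_pos add_pos_pos)
    qed
    also have "\<dots> \<le> sqrt (\<integral>w. (?Z N w)\<^sup>2 \<partial>\<W>) * sqrt (\<integral>w. (?D N w + ?E w)\<^sup>2 \<partial>\<W>)"
      by (intro Cauchy_Schwarz_integral_sqrt iZ conjunct1[OF S]) simp_all
    also have "\<dots> \<le> sqrt (2 * (\<integral>w. (?I N w - \<xi> w)\<^sup>2 \<partial>\<W>) + (?Q - ?q N)\<^sup>2 / 2) * sqrt (4 * exp (2 * ?Q))"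
      using Z[of N] conjunct2[OF S, of N] by (intro mult_mono) auto
    finally show ?thesis .
  qed
  have "(\<lambda>N. sqrt (2 * (\<integral>w. (?I N w - \<xi> w)\<^sup>2 \<partial>\<W>) + (?Q - ?q N)\<^sup>2 / 2) * sqrt (4 * exp (2 * ?Q)))
      \<longlonglongrightarrow> sqrt (2 * 0 + (?Q - ?Q)\<^sup>2 / 2) * sqrt (4 * exp (2 * ?Q))"
    by (intro tendsto_intros lim dyadic_pairing_converges[OF f]) simp
  then have "(\<lambda>N. sqrt (2 * (\<integral>w. (?I N w - \<xi> w)\<^sup>2 \<partial>\<W>) + (?Q - ?q N)\<^sup>2 / 2) * sqrt (4 * exp (2 * ?Q))) \<longlonglongrightarrow> 0"
    by simp
  then show "(\<lambda>N. \<integral>w. \<bar>?D N w - ?E w\<bar> \<partial>\<W>) \<longlonglongrightarrow> 0"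
    by (rule tendsto_sandwich[OF always_eventually always_eventually tendsto_const, rotated 2]) (simp_all add: le)
qed

section \<open>Cylinder sets and the Cameron-Martin theorem\<close>

definition dyadic_proj :: "nat \<Rightarrow> (real \<Rightarrow> real) \<Rightarrow> nat \<Rightarrow> real" where
  "dyadic_proj N w = (\<lambda>j\<in>{..2^N}. w (real j / 2^N))"

text \<open>Events that depend on the path at the points of one dyadic grid. Every grid sits inside
  all finer ones, which makes the family stable under intersection.\<close>

definition dyadic_cylinders :: "(real \<Rightarrow> real) set set" where
  "dyadic_cylinders = (\<Union>N. {dyadic_proj N -` B \<inter> space path_space |B. B \<in> sets (Pi\<^sub>M {..2^N} (\<lambda>_. borel))})"

lemma measurable_dyadic_proj: "dyadic_proj N \<in> path_space \<rightarrow>\<^sub>M Pi\<^sub>M {..2^N} (\<lambda>_. borel)"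
  unfolding dyadic_proj_def[abs_def]
  by (intro measurable_restrict measurable_path_eval dyadic_point_unit) auto

lemma dyadic_cylinder_refine:
  assumes "N \<le> M" and B: "B \<in> sets (Pi\<^sub>M {..2^N} (\<lambda>_. borel))"
  obtains B' where "B' \<in> sets (Pi\<^sub>M {..2^M} (\<lambda>_. borel))"
    "dyadic_proj N -` B \<inter> space path_space = dyadic_proj M -` B' \<inter> space path_space"
proof -
  define \<rho> where "\<rho> y = (\<lambda>j\<in>{..2^N}. y (j * 2^(M-N)) :: real)" for y :: "nat \<Rightarrow> real"
  have le: "j * 2^(M-N) \<le> 2^M" if "j \<le> 2^N" for j :: nat
  proof -
    have "j * 2^(M-N) \<le> 2^N * 2^(M-N)" using that by simp
    also have "\<dots> = 2^M" using assms(1) by (simp flip: power_add)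
    finally show ?thesis .
  qed
  have \<rho>: "\<rho> \<in> Pi\<^sub>M {..2^M} (\<lambda>_. borel) \<rightarrow>\<^sub>M Pi\<^sub>M {..2^N} (\<lambda>_. borel)"
    unfolding \<rho>_def[abs_def] using le by (intro measurable_restrict measurable_component_singleton) auto
  have M: "(2::real)^M = 2^N * 2^(M-N)" using assms(1) by (simp flip: power_add)
  have "dyadic_proj N w = \<rho> (dyadic_proj M w)" for w
    unfolding dyadic_proj_def \<rho>_def using le by (auto simp: fun_eq_iff restrict_def M)
  then have "dyadic_proj N -` B \<inter> space path_space
      = dyadic_proj M -` (\<rho> -` B \<inter> space (Pi\<^sub>M {..2^M} (\<lambda>_. borel))) \<inter> space path_space"
    using measurable_space[OF measurable_dyadic_proj] by auto
  with that measurable_sets[OF \<rho> B] show thesis by blast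
qed

lemma Int_stable_dyadic_cylinders: "Int_stable dyadic_cylinders"
proof (rule Int_stableI)
  fix a b
  assume "a \<in> dyadic_cylinders" "b \<in> dyadic_cylinders"
  then obtain N M A B where A: "A \<in> sets (Pi\<^sub>M {..2^N} (\<lambda>_. borel))" "a = dyadic_proj N -` A \<inter> space path_space"
    and B: "B \<in> sets (Pi\<^sub>M {..2^M} (\<lambda>_. borel))" "b = dyadic_proj M -` B \<inter> space path_space"
    unfolding dyadic_cylinders_def by auto
  obtain A' where A': "A' \<in> sets (Pi\<^sub>M {..2^(max N M)} (\<lambda>_. borel))" "a = dyadic_proj (max N M) -` A' \<inter> space path_space"
    using dyadic_cylinder_refine[of N "max N M", OF _ A(1)] A(2) by (metis max.cobounded1)
  obtain B' where B': "B' \<in> sets (Pi\<^sub>M {..2^(max N M)} (\<lambda>_. borel))" "b = dyadic_proj (max N M) -` B' \<inter> space path_space"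
    using dyadic_cylinder_refine[of M "max N M", OF _ B(1)] B(2) by (metis max.cobounded2)
  have "a \<inter> b = dyadic_proj (max N M) -` (A' \<inter> B') \<inter> space path_space"
    using A' B' by auto
  moreover have "A' \<inter> B' \<in> sets (Pi\<^sub>M {..2^(max N M)} (\<lambda>_. borel))"
    using A' B' by auto
  ultimately show "a \<inter> b \<in> dyadic_cylinders"
    unfolding dyadic_cylinders_def by blast
qed

lemma dyadic_cylinders_subset: "dyadic_cylinders \<subseteq> Pow (space path_space)"
  unfolding dyadic_cylinders_def by auto

lemma space_in_dyadic_cylinders: "space path_space \<in> dyadic_cylinders"
proof -
  have "dyadic_proj 0 -` space (Pi\<^sub>M {..2^0} (\<lambda>_. borel)) \<inter> space path_space = space path_space"
    using measurable_space[OF measurable_dyadic_proj[of 0]] by auto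
  then show ?thesis unfolding dyadic_cylinders_def by blast
qed

text \<open>Continuity of paths makes every evaluation a pointwise limit of evaluations at dyadic
  points, so the dyadic coordinates already generate the \<sigma>-algebra.\<close>

lemma sets_path_space_eq: "sets path_space = sigma_sets (space path_space) dyadic_cylinders"
proof
  show "sigma_sets (space path_space) dyadic_cylinders \<subseteq> sets path_space"
  proof (rule sets.sigma_sets_subset)
    show "dyadic_cylinders \<subseteq> sets path_space"
      unfolding dyadic_cylinders_def using measurable_sets[OF measurable_dyadic_proj] by auto
  qed
  let ?S = "sigma (space path_space) dyadic_cylinders"
  have space: "space ?S = space path_space"
    using dyadic_cylinders_subset by (simp add: space_measure_of_conv)
  have proj: "dyadic_proj N \<in> ?S \<rightarrow>\<^sub>M Pi\<^sub>M {..2^N} (\<lambda>_. borel)" for N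
  proof (rule measurableI)
    fix w assume "w \<in> space ?S"
    then show "dyadic_proj N w \<in> space (Pi\<^sub>M {..2^N} (\<lambda>_. borel))"
      using measurable_space[OF measurable_dyadic_proj] unfolding space by auto
  next
    fix B :: "(nat \<Rightarrow> real) set" assume "B \<in> sets (Pi\<^sub>M {..2^N} (\<lambda>_. borel))"
    then have "dyadic_proj N -` B \<inter> space path_space \<in> dyadic_cylinders"
      unfolding dyadic_cylinders_def by blast
    then show "dyadic_proj N -` B \<inter> space ?S \<in> sets ?S"
      unfolding space using dyadic_cylinders_subset by (auto simp: sets_measure_of)
  qed
  have dy: "(\<lambda>w. w (real j / 2^N)) \<in> borel_measurable ?S" if "j \<le> 2^N" for j N
  proof -
    have "(\<lambda>w. dyadic_proj N w j) \<in> borel_measurable ?S"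
      by (rule measurable_compose[OF proj measurable_component_singleton]) (use that in simp)
    then show ?thesis using that by (simp add: dyadic_proj_def)
  qed
  have "(\<lambda>w. w) \<in> ?S \<rightarrow>\<^sub>M path_space"
  proof (rule measurable_into_path_space)
    fix t :: real assume t: "t \<in> {0..1}"
    show "(\<lambda>w. w t) \<in> borel_measurable ?S"
    proof (rule borel_measurable_LIMSEQ_real)
      show "(\<lambda>w. w (real (nat \<lfloor>2^N * t\<rfloor>) / 2^N)) \<in> borel_measurable ?S" for N
        by (rule dy[OF dyadic_floor(1)[OF t]])
      fix w assume "w \<in> space ?S"
      then have "continuous_on {0..1} w" unfolding space by (simp add: space_path_space)
      then show "(\<lambda>N. w (real (nat \<lfloor>2^N * t\<rfloor>) / 2^N)) \<longlonglongrightarrow> w t"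
        by (rule continuous_on_tendsto_compose[OF _ dyadic_floor(2)[OF t] t])
           (use dyadic_point_unit[OF dyadic_floor(1)[OF t]] in auto)
    qed
  qed (simp add: space)
  then have id: "(\<lambda>w. w) \<in> ?S \<rightarrow>\<^sub>M path_space" .
  have "A \<in> sets ?S" if A: "A \<in> sets path_space" for A
  proof -
    have "(\<lambda>w. w) -` A \<inter> space ?S = A"
      using sets.sets_into_space[OF A] unfolding space by auto
    with measurable_sets[OF id A] show ?thesis by simp
  qed
  then show "sets path_space \<subseteq> sigma_sets (space path_space) dyadic_cylinders"
    using dyadic_cylinders_subset by (auto simp: sets_measure_of)
qed

text \<open>A path that starts at 0 is recovered on the grid by summing its increments (the map
  \<open>T\<close>), so the event is a function of the increments and the discrete shift formula
  applies. The start is 0 only almost surely, hence the almost everywhere comparisons.\<close>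

lemma emeasure_shift_dyadic_cylinder:
  assumes W: "wiener_measure \<W>" and f: "f \<in> L2_unit"
    and B: "B \<in> sets (Pi\<^sub>M {..2^N} (\<lambda>_. borel))"
    and E: "E = dyadic_proj N -` B \<inter> space path_space"
  shows "emeasure (distr \<W> path_space (\<lambda>w. \<lambda>t\<in>{0..1}. drift f t + w t)) E
    = (\<integral>\<^sup>+w. indicator E w * ennreal (exp (dyadic_pairing N (drift f) w - dyadic_pairing N (drift f) (drift f) / 2)) \<partial>\<W>)"
proof -
  let ?S = "\<lambda>w. \<lambda>t\<in>{0..1}. drift f t + w t"
  let ?I = "{..<(2::nat)^N}"
  have S: "?S \<in> \<W> \<rightarrow>\<^sub>M path_space"
    using measurable_drift_shift[OF f, of 1] by (simp add: measurable_cong_sets[OF wiener_measure_sets[OF W] refl])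
  have Es: "E \<in> sets path_space" unfolding E by (rule measurable_sets[OF measurable_dyadic_proj B])
  define T where "T y = (\<lambda>j\<in>{..2^N}. \<Sum>i<j. y i)" for y :: "nat \<Rightarrow> real"
  have [measurable]: "T \<in> Pi\<^sub>M ?I (\<lambda>_. borel) \<rightarrow>\<^sub>M Pi\<^sub>M {..2^N} (\<lambda>_. borel)"
    unfolding T_def[abs_def]
    by (intro measurable_restrict borel_measurable_sum measurable_component_singleton) auto
  have TB: "(\<lambda>y. indicator B (T y) :: ennreal) \<in> borel_measurable (Pi\<^sub>M ?I (\<lambda>_. borel))"
    using B by measurable
  have proj: "dyadic_proj N x = T (\<lambda>j\<in>?I. dyadic_inc N x j)" if "x 0 = 0" for x
  proof
    fix j
    have "(\<Sum>i<j. if i \<in> ?I then dyadic_inc N x i else undefined) = x (real j / 2^N)" if "j \<le> 2^N"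
    proof -
      have "(\<Sum>i<j. if i \<in> ?I then dyadic_inc N x i else undefined) = (\<Sum>i<j. x (real (Suc i) / 2^N) - x (real i / 2^N))"
        using that by (intro sum.cong) (auto simp: dyadic_inc_def)
      also have "\<dots> = x (real j / 2^N)"
        using \<open>x 0 = 0\<close> by (subst sum_lessThan_telescope) simp
      finally show ?thesis .
    qed
    then show "dyadic_proj N x j = T (\<lambda>j\<in>?I. dyadic_inc N x j) j"
      by (simp add: dyadic_proj_def T_def restrict_def)
  qed
  have inc: "dyadic_inc N (?S w) j = dyadic_inc N (drift f) j + dyadic_inc N w j" if "j < 2^N" for j w
    using dyadic_inc_cong[of "?S w" "\<lambda>t. drift f t + w t" j N] that by (simp add: dyadic_inc_def)
  have "emeasure (distr \<W> path_space ?S) E = (\<integral>\<^sup>+w. indicator E w \<partial>distr \<W> path_space ?S)"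
    using Es by simp
  also have "\<dots> = (\<integral>\<^sup>+w. indicator E (?S w) \<partial>\<W>)"
    using Es by (intro nn_integral_distr S) simp
  also have "\<dots> = (\<integral>\<^sup>+w. indicator B (T (\<lambda>j\<in>?I. dyadic_inc N (drift f) j + dyadic_inc N w j)) \<partial>\<W>)"
  proof (rule nn_integral_cong_AE)
    show "AE w in \<W>. indicator E (?S w) = (indicator B (T (\<lambda>j\<in>?I. dyadic_inc N (drift f) j + dyadic_inc N w j)) :: ennreal)"
      using wiener_measure_start[OF W] AE_space
    proof eventually_elim
      case (elim w)
      have "dyadic_proj N (?S w) = T (\<lambda>j\<in>?I. dyadic_inc N (?S w) j)"
        using elim by (intro proj) simp
      also have "(\<lambda>j\<in>?I. dyadic_inc N (?S w) j) = (\<lambda>j\<in>?I. dyadic_inc N (drift f) j + dyadic_inc N w j)"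
        using inc by (intro restrict_ext) simp
      finally show ?case
        using measurable_space[OF S elim(2)] unfolding E
        by (simp only: indicator_def Int_iff vimage_eq simp_thms)
    qed
  qed
  also have "\<dots> = (\<integral>\<^sup>+w. indicator B (T (\<lambda>j\<in>?I. dyadic_inc N w j)) *
      ennreal (exp (dyadic_pairing N (drift f) w - dyadic_pairing N (drift f) (drift f) / 2)) \<partial>\<W>)"
    by (rule nn_integral_dyadic_inc_shift[OF W TB])
  also have "\<dots> = (\<integral>\<^sup>+w. indicator E w *
      ennreal (exp (dyadic_pairing N (drift f) w - dyadic_pairing N (drift f) (drift f) / 2)) \<partial>\<W>)"
  proof (rule nn_integral_cong_AE)
    show "AE w in \<W>. indicator B (T (\<lambda>j\<in>?I. dyadic_inc N w j)) *
        ennreal (exp (dyadic_pairing N (drift f) w - dyadic_pairing N (drift f) (drift f) / 2))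
      = indicator E w * ennreal (exp (dyadic_pairing N (drift f) w - dyadic_pairing N (drift f) (drift f) / 2))"
      using wiener_measure_start[OF W] AE_space
    proof eventually_elim
      case (elim w)
      then have "indicator B (T (\<lambda>j\<in>?I. dyadic_inc N w j)) = (indicator E w :: ennreal)"
        using proj[of w] by (auto simp: E indicator_def wiener_measure_space[OF W])
      then show ?case by simp
    qed
  qed
  finally show ?thesis .
qed

text \<open>A cylinder of level N is also one of every finer level M, so its probability after the
  shift is given by the discrete density of each such level. As M grows these densities converge in
  L^1, and agreement on the cylinders identifies the two measures.\<close>

theorem cameron_martin:
  assumes W: "wiener_measure \<W>" and f: "f \<in> L2_unit" and xi: "is_wiener_integral \<W> f \<xi>"
  shows "distr \<W> path_space (\<lambda>w. \<lambda>t\<in>{0..1}. drift f t + w t)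
    = density \<W> (\<lambda>w. ennreal (exp (\<xi> w - L2_inner f f / 2)))" (is "distr \<W> path_space ?S = density \<W> ?D")
proof (rule measure_eqI_generator_eq[OF Int_stable_dyadic_cylinders dyadic_cylinders_subset])
  interpret prob_space \<W> by (rule wiener_measure_prob_space[OF W])
  have S: "?S \<in> \<W> \<rightarrow>\<^sub>M path_space"
    using measurable_drift_shift[OF f, of 1] by (simp add: measurable_cong_sets[OF wiener_measure_sets[OF W] refl])
  interpret S: prob_space "distr \<W> path_space ?S" by (rule prob_space_distr[OF S])
  show "sets (distr \<W> path_space ?S) = sigma_sets (space path_space) dyadic_cylinders"
    by (simp add: sets_path_space_eq)
  show "sets (density \<W> ?D) = sigma_sets (space path_space) dyadic_cylinders"
    by (simp add: sets_path_space_eq wiener_measure_sets[OF W])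
  show "range (\<lambda>_::nat. space path_space) \<subseteq> dyadic_cylinders"
    using space_in_dyadic_cylinders by auto
  show "emeasure (distr \<W> path_space ?S) (space path_space) \<noteq> \<infinity>" by simp
  show "(\<Union>i::nat. space path_space) = space path_space" by simp
  let ?DN = "\<lambda>N w. exp (dyadic_pairing N (drift f) w - dyadic_pairing N (drift f) (drift f) / 2)"
  let ?E = "\<lambda>w. exp (\<xi> w - L2_inner f f / 2)"
  note L1 = wiener_integral_exp_L1[OF W f xi]
  have [measurable]: "\<xi> \<in> borel_measurable \<W>" using xi by (simp add: is_wiener_integral_def)
  fix X assume "X \<in> dyadic_cylinders"
  then obtain N B where B: "B \<in> sets (Pi\<^sub>M {..2^N} (\<lambda>_. borel))" "X = dyadic_proj N -` B \<inter> space path_space"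
    unfolding dyadic_cylinders_def by auto
  then have Xs[measurable]: "X \<in> sets \<W>"
    using measurable_sets[OF measurable_dyadic_proj] by (simp add: wiener_measure_sets[OF W])
  have iN: "integrable \<W> (\<lambda>w. indicator X w * ?DN M w)" for M
    using integrable_mult_indicator[OF Xs L1(1)] by simp
  have iE: "integrable \<W> (\<lambda>w. indicator X w * ?E w)"
    using integrable_mult_indicator[OF Xs L1(2)] by simp
  have eN: "emeasure (distr \<W> path_space ?S) X = ennreal (\<integral>w. indicator X w * ?DN M w \<partial>\<W>)" if NM: "N \<le> M" for M
  proof -
    obtain B' where B': "B' \<in> sets (Pi\<^sub>M {..2^M} (\<lambda>_. borel))" "X = dyadic_proj M -` B' \<inter> space path_space"
      using dyadic_cylinder_refine[OF NM B(1)] B(2) by metis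
    have "emeasure (distr \<W> path_space ?S) X = (\<integral>\<^sup>+w. indicator X w * ennreal (?DN M w) \<partial>\<W>)"
      by (rule emeasure_shift_dyadic_cylinder[OF W f B'])
    also have "\<dots> = (\<integral>\<^sup>+w. ennreal (indicator X w * ?DN M w) \<partial>\<W>)"
      by (intro nn_integral_cong) (simp add: indicator_def)
    also have "\<dots> = ennreal (\<integral>w. indicator X w * ?DN M w \<partial>\<W>)"
      using iN by (rule nn_integral_eq_integral) simp
    finally show ?thesis .
  qed
  have "(\<lambda>M. (\<integral>w. indicator X w * ?DN M w \<partial>\<W>) - (\<integral>w. indicator X w * ?E w \<partial>\<W>)) \<longlonglongrightarrow> 0"
  proof (rule Lim_null_comparison[OF always_eventually L1(3)], rule)
    fix M
    have "norm ((\<integral>w. indicator X w * ?DN M w \<partial>\<W>) - (\<integral>w. indicator X w * ?E w \<partial>\<W>))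
      = \<bar>\<integral>w. indicator X w * ?DN M w - indicator X w * ?E w \<partial>\<W>\<bar>"
      using iN iE by simp
    also have "\<dots> \<le> (\<integral>w. \<bar>indicator X w * ?DN M w - indicator X w * ?E w\<bar> \<partial>\<W>)"
      by (rule integral_abs_bound)
    also have "\<dots> \<le> (\<integral>w. \<bar>?DN M w - ?E w\<bar> \<partial>\<W>)"
      using iN iE L1(1,2) by (intro integral_mono) (auto simp: indicator_def)
    finally show "norm ((\<integral>w. indicator X w * ?DN M w \<partial>\<W>) - (\<integral>w. indicator X w * ?E w \<partial>\<W>))
      \<le> (\<integral>w. \<bar>?DN M w - ?E w\<bar> \<partial>\<W>)" .
  qed
  then have "(\<lambda>M. \<integral>w. indicator X w * ?DN M w \<partial>\<W>) \<longlonglongrightarrow> (\<integral>w. indicator X w * ?E w \<partial>\<W>)"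
    by (simp add: LIM_zero_iff)
  then have "(\<lambda>M. ennreal (\<integral>w. indicator X w * ?DN M w \<partial>\<W>)) \<longlonglongrightarrow> ennreal (\<integral>w. indicator X w * ?E w \<partial>\<W>)"
    by (rule tendsto_ennrealI)
  moreover have "\<forall>\<^sub>F M in sequentially. ennreal (\<integral>w. indicator X w * ?DN M w \<partial>\<W>) = emeasure (distr \<W> path_space ?S) X"
    using eventually_ge_at_top[of N] by eventually_elim (simp add: eN)
  ultimately have "(\<lambda>M::nat. emeasure (distr \<W> path_space ?S) X) \<longlonglongrightarrow> ennreal (\<integral>w. indicator X w * ?E w \<partial>\<W>)"
    by (simp add: tendsto_cong)
  then have "emeasure (distr \<W> path_space ?S) X = ennreal (\<integral>w. indicator X w * ?E w \<partial>\<W>)"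
    by (simp add: LIMSEQ_const_iff)
  also have "\<dots> = (\<integral>\<^sup>+w. ennreal (indicator X w * ?E w) \<partial>\<W>)"
    using iE by (rule nn_integral_eq_integral[symmetric]) simp
  also have "\<dots> = (\<integral>\<^sup>+w. ?D w * indicator X w \<partial>\<W>)"
    by (intro nn_integral_cong) (simp add: indicator_def)
  also have "\<dots> = emeasure (density \<W> ?D) X"
    by (rule emeasure_density[symmetric]) auto
  finally show "emeasure (distr \<W> path_space ?S) X = emeasure (density \<W> ?D) X" .
qed

section \<open>White noise laws in orthonormal coordinates\<close>

definition scale_path :: "real \<Rightarrow> (real \<Rightarrow> real) \<Rightarrow> real \<Rightarrow> real" where
  "scale_path \<sigma> w = (\<lambda>t\<in>{0..1}. \<sigma> * w t)"

lemma measurable_scale_path: "scale_path \<sigma> \<in> path_space \<rightarrow>\<^sub>M path_space"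
  using measurable_drift_shift[OF L2_unit_zero, of \<sigma>]
  by (simp add: scale_path_def[abs_def] drift_def)

lemma L2_inner_self_sum:
  assumes "finite I" and psi: "\<And>i. i \<in> I \<Longrightarrow> \<psi> i \<in> L2_unit"
    and orth: "\<And>i j. i \<in> I \<Longrightarrow> j \<in> I \<Longrightarrow> L2_inner (\<psi> i) (\<psi> j) = (if i = j then 1 else 0)"
  shows "L2_inner (\<lambda>x. \<Sum>i\<in>I. c i * \<psi> i x) (\<lambda>x. \<Sum>i\<in>I. c i * \<psi> i x) = (\<Sum>i\<in>I. (c i)\<^sup>2)"
proof -
  have "L2_inner (\<psi> i) (\<lambda>x. \<Sum>i\<in>I. c i * \<psi> i x) = c i" if "i \<in> I" for i
  proof -
    have "L2_inner (\<lambda>x. \<Sum>i\<in>I. c i * \<psi> i x) (\<psi> i) = (\<Sum>j\<in>I. c j * L2_inner (\<psi> j) (\<psi> i))"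
      using psi that by (intro L2_inner_sum_left) auto
    also have "\<dots> = (\<Sum>j\<in>I. if j = i then c j else 0)"
      using orth that by (intro sum.cong) auto
    also have "\<dots> = c i" using that assms(1) by simp
    finally show ?thesis by (simp add: L2_inner_commute)
  qed
  then show ?thesis
    using psi by (subst L2_inner_sum_left) (auto intro: L2_unit_sum simp: power2_eq_square)
qed

text \<open>Taking the coefficients in units of the noise level \<sigma> reduces to unit noise, and
  scaling back is one fixed map of paths. The \<xi> are chosen before \<sigma> and \<open>c\<close>,
  so a single family of variables describes all signals in the span.\<close>

lemma white_noise_law_density:
  assumes W: "wiener_measure \<W>" and I: "finite I" and psi: "\<And>i. i \<in> I \<Longrightarrow> \<psi> i \<in> L2_unit"
    and orth: "\<And>i j. i \<in> I \<Longrightarrow> j \<in> I \<Longrightarrow> L2_inner (\<psi> i) (\<psi> j) = (if i = j then 1 else 0)"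
  obtains \<xi> where "\<And>i. i \<in> I \<Longrightarrow> \<xi> i \<in> borel_measurable \<W>"
    "\<And>\<sigma> c. white_noise_law \<W> \<sigma> (\<lambda>x. \<Sum>i\<in>I. (\<sigma> * c i) * \<psi> i x)
      = distr (density \<W> (\<lambda>w. ennreal (exp ((\<Sum>i\<in>I. c i * \<xi> i w) - (\<Sum>i\<in>I. (c i)\<^sup>2) / 2)))) path_space (scale_path \<sigma>)"
proof -
  have "\<forall>i\<in>I. \<exists>\<xi>. is_wiener_integral \<W> (\<psi> i) \<xi>"
    using wiener_integral_exists[OF W psi] by auto
  then obtain \<xi> where xi: "\<And>i. i \<in> I \<Longrightarrow> is_wiener_integral \<W> (\<psi> i) (\<xi> i)" by metis
  show thesis
  proof
    show "\<xi> i \<in> borel_measurable \<W>" if "i \<in> I" for i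
      using xi[OF that] by (simp add: is_wiener_integral_def)
    fix \<sigma> c
    let ?f = "\<lambda>x. \<Sum>i\<in>I. c i * \<psi> i x"
    have f: "?f \<in> L2_unit" by (intro L2_unit_sum psi)
    have S: "(\<lambda>w. \<lambda>t\<in>{0..1}. drift ?f t + w t) \<in> \<W> \<rightarrow>\<^sub>M path_space"
      using measurable_drift_shift[OF f, of 1] by (simp add: measurable_cong_sets[OF wiener_measure_sets[OF W] refl])
    have eq: "(\<lambda>x. \<Sum>i\<in>I. (\<sigma> * c i) * \<psi> i x) = (\<lambda>x. \<sigma> * ?f x)"
      by (simp add: sum_distrib_left mult.assoc)
    have "white_noise_law \<W> \<sigma> (\<lambda>x. \<Sum>i\<in>I. (\<sigma> * c i) * \<psi> i x)
        = distr \<W> path_space (\<lambda>w. \<lambda>t\<in>{0..1}. drift (\<lambda>x. \<sigma> * ?f x) t + \<sigma> * w t)"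
      unfolding white_noise_law_def eq drift_def ..
    also have "(\<lambda>w. \<lambda>t\<in>{0..1}. drift (\<lambda>x. \<sigma> * ?f x) t + \<sigma> * w t) = scale_path \<sigma> \<circ> (\<lambda>w. \<lambda>t\<in>{0..1}. drift ?f t + w t)"
      unfolding drift_cmult by (auto simp: scale_path_def fun_eq_iff distrib_left)
    also have "distr \<W> path_space \<dots> = distr (distr \<W> path_space (\<lambda>w. \<lambda>t\<in>{0..1}. drift ?f t + w t)) path_space (scale_path \<sigma>)"
      by (rule distr_distr[OF measurable_scale_path S, symmetric])
    also have "distr \<W> path_space (\<lambda>w. \<lambda>t\<in>{0..1}. drift ?f t + w t)
        = density \<W> (\<lambda>w. ennreal (exp ((\<Sum>i\<in>I. c i * \<xi> i w) - L2_inner ?f ?f / 2)))"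
      by (rule cameron_martin[OF W f is_wiener_integral_sum[OF W I psi xi]])
    also have "L2_inner ?f ?f = (\<Sum>i\<in>I. (c i)\<^sup>2)"
      by (rule L2_inner_self_sum[OF I psi orth])
    finally show "white_noise_law \<W> \<sigma> (\<lambda>x. \<Sum>i\<in>I. (\<sigma> * c i) * \<psi> i x)
      = distr (density \<W> (\<lambda>w. ennreal (exp ((\<Sum>i\<in>I. c i * \<xi> i w) - (\<Sum>i\<in>I. (c i)\<^sup>2) / 2)))) path_space (scale_path \<sigma>)" .
  qed
qed

lemma prob_space_white_noise_law:
  assumes W: "wiener_measure \<W>" and f: "f \<in> L2_unit"
  shows "prob_space (white_noise_law \<W> \<sigma> f)" "sets (white_noise_law \<W> \<sigma> f) = sets path_space"
proof -
  interpret prob_space \<W> by (rule wiener_measure_prob_space[OF W])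
  show "prob_space (white_noise_law \<W> \<sigma> f)"
    unfolding white_noise_law_def drift_def[symmetric]
    using measurable_drift_shift[OF f, of \<sigma>]
    by (intro prob_space_distr) (simp add: measurable_cong_sets[OF wiener_measure_sets[OF W] refl])
  show "sets (white_noise_law \<W> \<sigma> f) = sets path_space"
    by (simp add: white_noise_law_def)
qed

section \<open>Gaussian families seen through a channel\<close>

text \<open>Only the moment generating function of the \<open>\<xi> i\<close> is ever used, so this is how a family of
  independent standard normal variables enters.\<close>

locale gaussian_family = prob_space M for M :: "'a measure" +
  fixes I :: "'i set" and \<xi> :: "'i \<Rightarrow> 'a \<Rightarrow> real"
  assumes finite_I: "finite I"
    and measurable_xi [measurable]: "i \<in> I \<Longrightarrow> \<xi> i \<in> borel_measurable M"
    and nn_integral_exp_xi: "(\<integral>\<^sup>+w. ennreal (exp ((\<Sum>i\<in>I. c i * \<xi> i w) - (\<Sum>i\<in>I. (c i)\<^sup>2) / 2)) \<partial>M) = 1"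
begin

lemma measurable_lin [measurable]: "(\<lambda>w. \<Sum>i\<in>I. c i * \<xi> i w) \<in> borel_measurable M"
  by (intro borel_measurable_sum borel_measurable_times) auto

lemma has_bochner_integral_exp_lin:
  "has_bochner_integral M (\<lambda>w. exp ((\<Sum>i\<in>I. c i * \<xi> i w) - (\<Sum>i\<in>I. (c i)\<^sup>2) / 2)) 1"
  by (rule has_bochner_integral_nn_integral) (auto simp: nn_integral_exp_xi)

lemma has_bochner_integral_exp_xi:
  assumes i: "i \<in> I"
  shows "has_bochner_integral M (\<lambda>w. exp (t * \<xi> i w)) (exp (t\<^sup>2 / 2))"
proof -
  let ?c = "\<lambda>k. if k = i then t else 0"
  have "(\<Sum>k\<in>I. ?c k * \<xi> k w) = t * \<xi> i w" for w
    using i finite_I by (simp add: if_distribR if_distrib[of "\<lambda>x. x * _"] cong: if_cong)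
  moreover have "(\<Sum>k\<in>I. (?c k)\<^sup>2) = t\<^sup>2"
    using i finite_I by (simp add: if_distrib[of "\<lambda>x. x\<^sup>2"] cong: if_cong)
  ultimately have "has_bochner_integral M (\<lambda>w. exp (t * \<xi> i w - t\<^sup>2 / 2)) 1"
    using has_bochner_integral_exp_lin[of ?c] by simp
  then have "has_bochner_integral M (\<lambda>w. exp (t\<^sup>2 / 2) * exp (t * \<xi> i w - t\<^sup>2 / 2)) (exp (t\<^sup>2 / 2) * 1)"
    by (intro has_bochner_integral_mult_right)
  then show ?thesis by (simp flip: exp_add)
qed

lemma integrable_exp_xi: "i \<in> I \<Longrightarrow> integrable M (\<lambda>w. exp (t * \<xi> i w))"
  using has_bochner_integral_exp_xi by (simp add: has_bochner_integral_iff)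

lemma integral_exp_xi: "i \<in> I \<Longrightarrow> (\<integral>w. exp (t * \<xi> i w) \<partial>M) = exp (t\<^sup>2 / 2)"
  using has_bochner_integral_exp_xi by (simp add: has_bochner_integral_iff)

lemma integrable_xi:
  assumes i: "i \<in> I"
  shows "integrable M (\<xi> i)"
proof (rule Bochner_Integration.integrable_bound)
  show "integrable M (\<lambda>w. exp (1 * \<xi> i w) + exp (- 1 * \<xi> i w))"
    by (intro Bochner_Integration.integrable_add integrable_exp_xi i)
  have "\<bar>x\<bar> \<le> exp x + exp (- x)" for x :: real
    using exp_ge_add_one_self[of x] exp_ge_add_one_self[of "- x"] exp_gt_zero[of x] exp_gt_zero[of "-x"] by linarith
  then show "AE w in M. norm (\<xi> i w) \<le> norm (exp (1 * \<xi> i w) + exp (- 1 * \<xi> i w))"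
    by (simp add: abs_of_pos add_pos_pos)
qed (use i in simp)

text \<open>Once the variables are recentred, the exponents of two successive shifts add up to that
  of the total shift. Hence any signal, and not only zero, can be the base point of a likelihood
  expansion.\<close>

lemma shifted_gaussian_family:
  "gaussian_family (density M (\<lambda>w. ennreal (exp ((\<Sum>i\<in>I. c i * \<xi> i w) - (\<Sum>i\<in>I. (c i)\<^sup>2) / 2)))) I
    (\<lambda>i w. \<xi> i w - c i)" (is "gaussian_family (density M ?D) I _")
proof -
  interpret D: prob_space "density M ?D"
  proof
    show "emeasure (density M ?D) (space (density M ?D)) = 1"
      using nn_integral_exp_xi[of c] by (simp add: emeasure_density cong: nn_integral_cong)
  qed
  show ?thesis
  proof
    show "finite I" by (rule finite_I)
    show "(\<lambda>w. \<xi> i w - c i) \<in> borel_measurable (density M ?D)" if "i \<in> I" for i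
      using that by simp
    fix d
    have "(\<integral>\<^sup>+w. ennreal (exp ((\<Sum>i\<in>I. d i * (\<xi> i w - c i)) - (\<Sum>i\<in>I. (d i)\<^sup>2) / 2)) \<partial>density M ?D)
       = (\<integral>\<^sup>+w. ?D w * ennreal (exp ((\<Sum>i\<in>I. d i * (\<xi> i w - c i)) - (\<Sum>i\<in>I. (d i)\<^sup>2) / 2)) \<partial>M)"
    proof (rule nn_integral_density)
      have "(\<lambda>w. \<Sum>i\<in>I. d i * (\<xi> i w - c i)) \<in> borel_measurable M"
        by (intro borel_measurable_sum borel_measurable_times borel_measurable_diff) auto
      then show "(\<lambda>w. ennreal (exp ((\<Sum>i\<in>I. d i * (\<xi> i w - c i)) - (\<Sum>i\<in>I. (d i)\<^sup>2) / 2))) \<in> borel_measurable M"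
        by measurable
    qed simp
    also have "\<dots> = (\<integral>\<^sup>+w. ennreal (exp ((\<Sum>i\<in>I. (c i + d i) * \<xi> i w) - (\<Sum>i\<in>I. (c i + d i)\<^sup>2) / 2)) \<partial>M)"
    proof (rule nn_integral_cong)
      fix w
      have "(\<Sum>i\<in>I. c i * \<xi> i w) - (\<Sum>i\<in>I. (c i)\<^sup>2) / 2 + ((\<Sum>i\<in>I. d i * (\<xi> i w - c i)) - (\<Sum>i\<in>I. (d i)\<^sup>2) / 2)
          = (\<Sum>i\<in>I. (c i + d i) * \<xi> i w) - (\<Sum>i\<in>I. (c i + d i)\<^sup>2) / 2"
        unfolding sum_divide_distrib sum_subtractf[symmetric] sum.distrib[symmetric]
        by (intro sum.cong) (auto simp: power2_eq_square field_simps)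
      then show "?D w * ennreal (exp ((\<Sum>i\<in>I. d i * (\<xi> i w - c i)) - (\<Sum>i\<in>I. (d i)\<^sup>2) / 2))
          = ennreal (exp ((\<Sum>i\<in>I. (c i + d i) * \<xi> i w) - (\<Sum>i\<in>I. (c i + d i)\<^sup>2) / 2))"
        by (simp only: ennreal_mult[symmetric] exp_ge_zero exp_add[symmetric])
    qed
    also have "\<dots> = 1" by (rule nn_integral_exp_xi)
    finally show "(\<integral>\<^sup>+w. ennreal (exp ((\<Sum>i\<in>I. d i * (\<xi> i w - c i)) - (\<Sum>i\<in>I. (d i)\<^sup>2) / 2)) \<partial>density M ?D) = 1" .
  qed
qed

text \<open>The likelihood ratio of a shift by \<open>b\<close> in one coordinate minus its
  expansion to first order; a quantity of order b^2.\<close>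

definition rem :: "real \<Rightarrow> 'i \<Rightarrow> 'a \<Rightarrow> real" where
  "rem b i w = exp (b * \<xi> i w - b\<^sup>2 / 2) - 1 - b * \<xi> i w"

lemma measurable_rem [measurable]: "i \<in> I \<Longrightarrow> rem b i \<in> borel_measurable M"
  unfolding rem_def[abs_def] by measurable

lemma exp_remainder_le: "\<bar>exp x - 1 - x\<bar> \<le> x\<^sup>2 * exp \<bar>x\<bar>" for x :: real
proof -
  have le: "exp x - 1 \<le> x * exp x" for x :: real
  proof -
    have "exp x * (1 + (- x)) \<le> exp x * exp (- x)"
      by (intro mult_left_mono exp_ge_add_one_self) simp
    then show ?thesis by (simp add: exp_minus algebra_simps)
  qed
  have "0 \<le> exp x - 1 - x" using exp_ge_add_one_self[of x] by linarith
  moreover have "exp x - 1 - x \<le> x * (exp x - 1)" using le[of x] by (simp add: algebra_simps)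
  moreover have "x * (exp x - 1) \<le> x\<^sup>2 * exp \<bar>x\<bar>"
  proof (cases "0 \<le> x")
    case True
    then show ?thesis using mult_left_mono[OF le True] by (simp add: power2_eq_square mult.assoc)
  next
    case False
    have "(- x) * (1 - exp x) \<le> (- x) * (- x)"
    proof (rule mult_left_mono)
      show "1 - exp x \<le> - x" using exp_ge_add_one_self[of x] by linarith
    qed (use False in simp)
    also have "\<dots> \<le> (- x) * (- x) * exp \<bar>x\<bar>"
      using mult_left_mono[of 1 "exp \<bar>x\<bar>" "(- x) * (- x)"] by simp
    finally show ?thesis by (simp add: power2_eq_square algebra_simps)
  qed
  ultimately show ?thesis by simp
qed

text \<open>There are two sources of order b^2: the Taylor remainder of exp at x = b \<xi>, and the
  factor exp (- b^2 / 2). With |b| \<le> 1, |x| is replaced by |\<xi>|, which keeps \<open>b\<close>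
  out of the exponentials; then 3 b^2 exp (2 |\<xi>|) is squared.\<close>

lemma rem_square_le:
  assumes "\<bar>b\<bar> \<le> 1"
  shows "(rem b i w)\<^sup>2 \<le> 9 * b^4 * (exp (4 * \<xi> i w) + exp (- 4 * \<xi> i w))"
proof -
  let ?z = "\<xi> i w"
  define x where "x = b * ?z"
  have xz: "\<bar>x\<bar> \<le> \<bar>?z\<bar>" using assms unfolding x_def abs_mult by (simp add: mult_left_le_one_le)
  have "\<bar>rem b i w\<bar> = \<bar>(exp x - 1 - x) - exp x * (1 - exp (- b\<^sup>2 / 2))\<bar>"
  proof -
    have "exp (x - b\<^sup>2 / 2) = exp x * exp (- b\<^sup>2 / 2)" by (simp flip: exp_add)
    then show ?thesis unfolding rem_def x_def[symmetric] by (simp add: right_diff_distrib)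
  qed
  also have "\<dots> \<le> \<bar>exp x - 1 - x\<bar> + exp x * (1 - exp (- b\<^sup>2 / 2))"
    by (rule order_trans[OF abs_triangle_ineq4]) (simp add: abs_mult)
  also have "\<dots> \<le> x\<^sup>2 * exp \<bar>x\<bar> + exp \<bar>x\<bar> * (b\<^sup>2 / 2)"
  proof (intro add_mono mult_mono exp_remainder_le)
    show "1 - exp (- b\<^sup>2 / 2) \<le> b\<^sup>2 / 2" using exp_ge_add_one_self[of "- b\<^sup>2 / 2"] by simp
  qed simp_all
  also have "\<dots> = b\<^sup>2 * (exp \<bar>x\<bar> * (?z\<^sup>2 + 1 / 2))"
    unfolding x_def by (simp add: power_mult_distrib algebra_simps)
  also have "\<dots> \<le> b\<^sup>2 * (exp \<bar>?z\<bar> * (3 * exp \<bar>?z\<bar>))"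
  proof (intro mult_left_mono mult_mono)
    have "\<bar>?z\<bar>\<^sup>2 / 2 \<le> exp \<bar>?z\<bar>" using exp_lower_Taylor_quadratic[of "\<bar>?z\<bar>"] by linarith
    moreover have "1 \<le> exp \<bar>?z\<bar>" by simp
    ultimately show "?z\<^sup>2 + 1 / 2 \<le> 3 * exp \<bar>?z\<bar>" unfolding power2_abs by linarith
  qed (use xz in auto)
  also have "\<dots> = 3 * b\<^sup>2 * exp (2 * \<bar>?z\<bar>)"
    unfolding exp_double by (simp add: power2_eq_square)
  finally have "\<bar>rem b i w\<bar>\<^sup>2 \<le> (3 * b\<^sup>2 * exp (2 * \<bar>?z\<bar>))\<^sup>2"
    by (intro power_mono) auto
  also have "\<dots> = 9 * b^4 * exp (4 * \<bar>?z\<bar>)"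
  proof -
    have "(exp (2 * \<bar>?z\<bar>))\<^sup>2 = exp (4 * \<bar>?z\<bar>)" by (simp add: power2_eq_square flip: exp_add)
    then show ?thesis by (simp add: power_mult_distrib)
  qed
  also have "\<dots> \<le> 9 * b^4 * (exp (4 * ?z) + exp (- 4 * ?z))"
    by (intro mult_left_mono) (auto simp: abs_if)
  finally show ?thesis by simp
qed

lemma
  assumes b: "\<bar>b\<bar> \<le> 1" and i: "i \<in> I"
  shows integrable_rem_square: "integrable M (\<lambda>w. (rem b i w)\<^sup>2)"
    and integral_rem_square_le: "(\<integral>w. (rem b i w)\<^sup>2 \<partial>M) \<le> 18 * exp 8 * b^4"
proof -
  have int: "integrable M (\<lambda>w. 9 * b^4 * (exp (4 * \<xi> i w) + exp (- 4 * \<xi> i w)))"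
    using i integrable_exp_xi[of i 4] integrable_exp_xi[of i "-4"] by simp
  show int2: "integrable M (\<lambda>w. (rem b i w)\<^sup>2)"
    using int by (rule Bochner_Integration.integrable_bound)
      (use rem_square_le[OF b] i in \<open>auto intro!: order_trans[OF _ abs_ge_self]\<close>)
  have "(\<integral>w. (rem b i w)\<^sup>2 \<partial>M) \<le> (\<integral>w. 9 * b^4 * (exp (4 * \<xi> i w) + exp (- 4 * \<xi> i w)) \<partial>M)"
    by (rule integral_mono[OF int2 int rem_square_le[OF b]])
  \<comment> \<open>Each of the two exponential moments equals exp (4^2 / 2) = exp 8.\<close>
  also have "\<dots> = 18 * exp 8 * b^4"
    using i integrable_exp_xi[of i 4] integrable_exp_xi[of i "-4"] integral_exp_xi[of i 4] integral_exp_xi[of i "-4"]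
    by simp
  finally show "(\<integral>w. (rem b i w)\<^sup>2 \<partial>M) \<le> 18 * exp 8 * b^4" .
qed

end

text \<open>\<open>g y w\<close> is the conditional probability of message \<open>y\<close> given
  data \<open>w\<close>; as messages are countable, such point probabilities describe the whole
  channel.\<close>

locale gaussian_channel = gaussian_family M I \<xi> for M :: "'a measure" and I :: "'i set" and \<xi> +
  fixes g :: "'y::countable \<Rightarrow> 'a \<Rightarrow> real"
  assumes measurable_g [measurable]: "g y \<in> borel_measurable M"
    and g_nonneg: "w \<in> space M \<Longrightarrow> 0 \<le> g y w"
    and g_sum: "w \<in> space M \<Longrightarrow> (\<integral>\<^sup>+y. ennreal (g y w) \<partial>count_space UNIV) = 1"
begin

lemma g_le_1: "w \<in> space M \<Longrightarrow> g y w \<le> 1"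
proof -
  assume w: "w \<in> space M"
  have "ennreal (g y w) = (\<integral>\<^sup>+y'. ennreal (g y' w) * indicator {y} y' \<partial>count_space UNIV)"
    by (simp add: nn_integral_count_space_indicator[symmetric] nn_integral_count_space_finite)
  also have "\<dots> \<le> (\<integral>\<^sup>+y'. ennreal (g y' w) \<partial>count_space UNIV)"
    by (intro nn_integral_mono) (simp add: indicator_def)
  finally show ?thesis using g_sum[OF w] by simp
qed

lemma integrable_g_mult:
  assumes "integrable M f"
  shows "integrable M (\<lambda>w. g y w * f w)"
proof (rule Bochner_Integration.integrable_bound[OF assms])
  show "AE w in M. norm (g y w * f w) \<le> norm (f w)"
    using g_nonneg g_le_1 by (intro AE_I2) (auto simp: abs_mult mult_left_le_one_le)
qed (use assms in measurable)

lemma integrable_g: "integrable M (g y)"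
  using integrable_g_mult[of "\<lambda>_. 1" y] by simp

definition pm :: "'y \<Rightarrow> real" where
  "pm y = (\<integral>w. g y w \<partial>M)"

lemma pm_nonneg: "0 \<le> pm y"
  unfolding pm_def using g_nonneg by (intro integral_nonneg_AE AE_I2) auto

lemma sum_expectation_g:
  assumes [measurable]: "f \<in> borel_measurable M"
  shows "(\<integral>\<^sup>+y. (\<integral>\<^sup>+w. ennreal (g y w) * f w \<partial>M) \<partial>count_space UNIV) = (\<integral>\<^sup>+w. f w \<partial>M)"
proof -
  interpret C: sigma_finite_measure "count_space (UNIV :: 'y set)"
    by (rule sigma_finite_measure_count_space_countable) simp
  interpret P: pair_sigma_finite "count_space (UNIV :: 'y set)" M ..
  have "(\<lambda>(y, w). ennreal (g y w) * f w) \<in> borel_measurable (count_space UNIV \<Otimes>\<^sub>M M)"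
    by (rule measurable_pair_measure_countable1) auto
  then have "(\<integral>\<^sup>+y. (\<integral>\<^sup>+w. ennreal (g y w) * f w \<partial>M) \<partial>count_space UNIV)
      = (\<integral>\<^sup>+w. (\<integral>\<^sup>+y. ennreal (g y w) * f w \<partial>count_space UNIV) \<partial>M)"
    by (rule P.Fubini'[symmetric])
  also have "\<dots> = (\<integral>\<^sup>+w. f w \<partial>M)"
    by (intro nn_integral_cong) (simp add: nn_integral_multc g_sum)
  finally show ?thesis .
qed

lemma pm_sum: "(\<integral>\<^sup>+y. ennreal (pm y) \<partial>count_space UNIV) = 1"
proof -
  have "(\<integral>\<^sup>+w. ennreal (g y w) \<partial>M) = ennreal (pm y)" for y
    unfolding pm_def using g_nonneg by (intro nn_integral_eq_integral integrable_g) auto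
  with sum_expectation_g[of "\<lambda>_. 1"] show ?thesis by (simp add: emeasure_space_1)
qed

text \<open>Conditional expectation of \<xi> given the message; 0 by the convention for division if
  the message has probability zero.\<close>

definition post_mean :: "'i \<Rightarrow> 'y \<Rightarrow> real" where
  "post_mean i y = (\<integral>w. g y w * \<xi> i w \<partial>M) / pm y"

text \<open>Ratio of the probabilities of message \<open>y\<close> with coordinate \<open>i\<close>
  alone shifted by \<open>b i\<close> and with no shift.\<close>

definition lik_ratio :: "('i \<Rightarrow> real) \<Rightarrow> 'i \<Rightarrow> 'y \<Rightarrow> real" where
  "lik_ratio b i y = (\<integral>w. g y w * exp (b i * \<xi> i w - (b i)\<^sup>2 / 2) \<partial>M) / pm y"

lemma AE_g_zero: "pm y = 0 \<Longrightarrow> AE w in M. g y w = 0"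
  unfolding pm_def using g_nonneg integrable_g by (subst (asm) integral_nonneg_eq_0_iff_AE) auto

text \<open>\<open>x \<le> e\<^sup>x - 1\<close> is applied with \<open>x = log Q + \<langle>v, \<xi>\<rangle> - |v|\<^sup>2/2\<close>, where \<open>v\<close> is the posterior mean
  of \<open>\<xi>\<close>, under the expectation weighted by \<open>g y\<close>.\<close>

lemma post_mean_square_le:
  assumes Q: "Q > 0"
  shows "pm y * (\<Sum>i\<in>I. (post_mean i y)\<^sup>2) / 2 + pm y \<le> pm y * ln (1 / Q) + Q"
proof (cases "pm y = 0")
  case True
  then show ?thesis using Q by simp
next
  case False
  let ?v = "\<lambda>i. post_mean i y"
  let ?n = "\<Sum>i\<in>I. (?v i)\<^sup>2"
  let ?l = "\<lambda>w. \<Sum>i\<in>I. ?v i * \<xi> i w"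
  have il: "integrable M ?l"
    using integrable_xi by auto
  have gl: "(\<integral>w. g y w * ?l w \<partial>M) = pm y * ?n"
  proof -
    have "(\<integral>w. g y w * ?l w \<partial>M) = (\<integral>w. (\<Sum>i\<in>I. ?v i * (g y w * \<xi> i w)) \<partial>M)"
      by (simp add: sum_distrib_left mult.left_commute)
    also have "\<dots> = (\<Sum>i\<in>I. ?v i * (\<integral>w. g y w * \<xi> i w \<partial>M))"
      using integrable_g_mult integrable_xi by (subst Bochner_Integration.integral_sum) auto
    also have "\<dots> = (\<Sum>i\<in>I. pm y * (?v i)\<^sup>2)"
      using False by (intro sum.cong) (auto simp: post_mean_def power2_eq_square)
    finally show ?thesis by (simp add: sum_distrib_left)
  qed
  have e: "integrable M (\<lambda>w. exp (?l w - ?n / 2))" "(\<integral>w. exp (?l w - ?n / 2) \<partial>M) = 1"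
    using has_bochner_integral_exp_lin[of ?v] by (auto simp: has_bochner_integral_iff)
  have ig: "integrable M (\<lambda>w. g y w * (ln Q - ?n / 2) + g y w * ?l w + g y w)"
    by (intro Bochner_Integration.integrable_add integrable_g integrable_g_mult il) simp
  have "(\<integral>w. g y w * (ln Q - ?n / 2) + g y w * ?l w + g y w \<partial>M) \<le> (\<integral>w. Q * exp (?l w - ?n / 2) \<partial>M)"
  proof (rule integral_mono[OF ig])
    show "integrable M (\<lambda>w. Q * exp (?l w - ?n / 2))" using e by simp
    fix w assume w: "w \<in> space M"
    have "Q * exp (?l w - ?n / 2) = exp (ln Q + (?l w - ?n / 2))"
      using Q by (simp only: exp_add exp_ln)
    then have "ln Q + (?l w - ?n / 2) + 1 \<le> Q * exp (?l w - ?n / 2)"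
      using exp_ge_add_one_self[of "ln Q + (?l w - ?n / 2)"] by linarith
    then have "g y w * (ln Q + (?l w - ?n / 2) + 1) \<le> g y w * (Q * exp (?l w - ?n / 2))"
      using g_nonneg[OF w] by (rule mult_left_mono)
    \<comment> \<open>The bound g \<le> 1 is spent on the exponential side only, whose full integral
      is \<open>Q\<close>: the tilt by the posterior mean has total mass one.\<close>
    also have "\<dots> \<le> Q * exp (?l w - ?n / 2)"
      using g_nonneg[OF w] g_le_1[OF w] Q by (intro mult_left_le_one_le) auto
    finally show "g y w * (ln Q - ?n / 2) + g y w * ?l w + g y w \<le> Q * exp (?l w - ?n / 2)"
      by (simp add: algebra_simps)
  qed
  also have "\<dots> = Q" using e by simp
  also have "(\<integral>w. g y w * (ln Q - ?n / 2) + g y w * ?l w + g y w \<partial>M) = pm y * (ln Q - ?n / 2) + pm y * ?n + pm y"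
    using integrable_g[of y] integrable_g_mult[OF il, of y] gl unfolding pm_def by simp
  finally show ?thesis using Q by (simp add: ln_div algebra_simps)
qed

text \<open>The first order term of the likelihood ratio is \<open>b i\<close> times the posterior
  mean. What remains is the posterior expectation of \<open>rem\<close>, whose square is at most the
  posterior expectation of the square.\<close>

lemma lik_ratio_square_le:
  assumes b: "\<bar>b i\<bar> \<le> 1" and i: "i \<in> I"
  shows "pm y * (lik_ratio b i y - 1)\<^sup>2
    \<le> 2 * (b i)\<^sup>2 * (pm y * (post_mean i y)\<^sup>2) + 2 * (\<integral>w. g y w * (rem (b i) i w)\<^sup>2 \<partial>M)"
proof (cases "pm y = 0")
  case True
  then show ?thesis
    using g_nonneg by (auto intro!: integral_nonneg_AE AE_I2)
next
  case False
  then have p: "pm y > 0" using pm_nonneg[of y] by simp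
  let ?r = "\<integral>w. g y w * rem (b i) i w \<partial>M"
  have ir: "integrable M (rem (b i) i)"
    by (rule integrable_if_square_integrable[OF _ integrable_rem_square[OF b i]]) (use i in simp)
  have ig: "integrable M (\<lambda>w. g y w * (rem (b i) i w)\<^sup>2)"
    by (intro integrable_g_mult integrable_rem_square b i)
  have "(\<integral>w. g y w * exp (b i * \<xi> i w - (b i)\<^sup>2 / 2) \<partial>M) = (\<integral>w. g y w + b i * (g y w * \<xi> i w) + g y w * rem (b i) i w \<partial>M)"
    by (intro Bochner_Integration.integral_cong) (auto simp: rem_def algebra_simps)
  also have "\<dots> = pm y + b i * (\<integral>w. g y w * \<xi> i w \<partial>M) + ?r"
    using integrable_g[of y] integrable_g_mult[OF integrable_xi[OF i], of y] integrable_g_mult[OF ir, of y]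
    unfolding pm_def by simp
  finally have L: "lik_ratio b i y - 1 = b i * post_mean i y + ?r / pm y"
    using p unfolding lik_ratio_def post_mean_def by (simp add: field_simps)
  have "?r\<^sup>2 \<le> pm y * (\<integral>w. g y w * (rem (b i) i w)\<^sup>2 \<partial>M)"
  proof -
    \<comment> \<open>Splitting \<open>g\<close> into two square roots gives Cauchy-Schwarz with
      respect to the weight \<open>g\<close>.\<close>
    have *: "(sqrt (g y w))\<^sup>2 = g y w" "(sqrt (g y w) * rem (b i) i w)\<^sup>2 = g y w * (rem (b i) i w)\<^sup>2"
      "sqrt (g y w) * (sqrt (g y w) * rem (b i) i w) = g y w * rem (b i) i w" if "w \<in> space M" for w
      using g_nonneg[OF that, of y] by (auto simp: power_mult_distrib simp flip: mult.assoc)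
    have "(\<integral>w. \<bar>sqrt (g y w) * (sqrt (g y w) * rem (b i) i w)\<bar> \<partial>M)\<^sup>2
        \<le> (\<integral>w. (sqrt (g y w))\<^sup>2 \<partial>M) * (\<integral>w. (sqrt (g y w) * rem (b i) i w)\<^sup>2 \<partial>M)"
      using i integrable_g[of y] ig
      by (intro Cauchy_Schwarz_integral) (auto simp: * cong: Bochner_Integration.integrable_cong)
    also have "(\<integral>w. (sqrt (g y w))\<^sup>2 \<partial>M) = pm y"
      unfolding pm_def by (intro Bochner_Integration.integral_cong) (auto simp: *)
    also have "(\<integral>w. (sqrt (g y w) * rem (b i) i w)\<^sup>2 \<partial>M) = (\<integral>w. g y w * (rem (b i) i w)\<^sup>2 \<partial>M)"
      by (intro Bochner_Integration.integral_cong) (auto simp: *)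
    also have "(\<integral>w. \<bar>sqrt (g y w) * (sqrt (g y w) * rem (b i) i w)\<bar> \<partial>M) = (\<integral>w. \<bar>g y w * rem (b i) i w\<bar> \<partial>M)"
      by (intro Bochner_Integration.integral_cong) (auto simp: *)
    finally have "(\<integral>w. \<bar>g y w * rem (b i) i w\<bar> \<partial>M)\<^sup>2 \<le> pm y * (\<integral>w. g y w * (rem (b i) i w)\<^sup>2 \<partial>M)" .
    moreover have "\<bar>?r\<bar>\<^sup>2 \<le> (\<integral>w. \<bar>g y w * rem (b i) i w\<bar> \<partial>M)\<^sup>2"
      by (intro power_mono integral_abs_bound) simp
    ultimately show ?thesis by simp
  qed
  then have r: "pm y * (?r / pm y)\<^sup>2 \<le> (\<integral>w. g y w * (rem (b i) i w)\<^sup>2 \<partial>M)"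
    using p by (simp add: power2_eq_square field_simps)
  have "(u + v)\<^sup>2 \<le> 2 * u\<^sup>2 + 2 * v\<^sup>2" for u v :: real
    using sum_squares_bound[of u v] by (simp add: power2_sum)
  then have "pm y * (lik_ratio b i y - 1)\<^sup>2 \<le> pm y * (2 * (b i * post_mean i y)\<^sup>2 + 2 * (?r / pm y)\<^sup>2)"
    unfolding L using p by (intro mult_left_mono) auto
  with r show ?thesis by (simp add: algebra_simps power_mult_distrib)
qed

end

text \<open>There are 2^n words of length n, each of weight 4^(-n)/2, and the 2^(-n)/2 sum to 1.
  This is the reference law on words: the logarithm of its weights is affine in the length, so cross
  entropy against it is controlled by the mean length.\<close>

lemma nn_integral_length_weights:
  "(\<integral>\<^sup>+y. ennreal ((1/4) ^ length (y :: bool list) / 2) \<partial>count_space UNIV) = 1"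
proof -
  have "(\<integral>\<^sup>+y. ennreal ((1/4) ^ length (y :: bool list) / 2) \<partial>count_space UNIV)
     = (\<integral>\<^sup>+y. (\<Sum>n. ennreal ((1/4)^n / 2) * indicator {y. length y = n} (y :: bool list)) \<partial>count_space UNIV)"
  proof (rule nn_integral_cong)
    fix y :: "bool list"
    have "(\<Sum>n. ennreal ((1/4)^n / 2) * indicator {y. length y = n} y)
        = (\<Sum>n\<in>{length y}. ennreal ((1/4)^n / 2) * indicator {y. length y = n} y)"
      by (rule suminf_finite) auto
    then show "ennreal ((1/4) ^ length y / 2) = (\<Sum>n. ennreal ((1/4)^n / 2) * indicator {y. length y = n} y)"
      by simp
  qed
  also have "\<dots> = (\<Sum>n. \<integral>\<^sup>+y. ennreal ((1/4)^n / 2) * indicator {y. length y = n} (y :: bool list) \<partial>count_space UNIV)"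
    by (rule nn_integral_suminf) simp
  also have "\<dots> = (\<Sum>n. ennreal ((1/2)^n / 2))"
  proof (rule arg_cong[where f = suminf], rule ext)
    fix n
    have fin: "finite {y :: bool list. length y = n}" and card: "card {y :: bool list. length y = n} = 2^n"
      using finite_lists_length_eq[of "UNIV :: bool set" n] card_lists_length_eq[of "UNIV :: bool set" n] by auto
    have "(\<integral>\<^sup>+y. ennreal ((1/4)^n / 2) * indicator {y. length y = n} (y :: bool list) \<partial>count_space UNIV)
        = ennreal ((1/4)^n / 2) * of_nat (2^n)"
      using fin card by (subst nn_integral_cmult_indicator) auto
    also have "of_nat (2^n) = ennreal (2^n)"
      by (simp add: ennreal_of_nat_eq_real_of_nat)
    also have "ennreal ((1/4)^n / 2) * ennreal (2^n) = ennreal ((1/2)^n / 2)"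
      by (subst ennreal_mult[symmetric]) (auto simp flip: power_mult_distrib)
    finally show "(\<integral>\<^sup>+y. ennreal ((1/4)^n / 2) * indicator {y. length y = n} (y :: bool list) \<partial>count_space UNIV) = ennreal ((1/2)^n / 2)" .
  qed
  also have "\<dots> = ennreal (\<Sum>n. (1/2)^n / 2)"
    by (rule suminf_ennreal2) (auto intro: summable_divide summable_geometric)
  also have "(\<Sum>n. (1/2)^n / 2 :: real) = 1"
    using suminf_divide[OF summable_geometric[of "1/2::real"], of 2] suminf_geometric[of "1/2::real"] by simp
  finally show ?thesis by simp
qed

locale message_channel = gaussian_channel M I \<xi> g
  for M :: "'a measure" and I :: "'i set" and \<xi> and g :: "bool list \<Rightarrow> 'a \<Rightarrow> real"
begin

text \<open>With the length weights as \<open>Q\<close>, the posterior mean bound involves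
  \<open>real (length y) * ln 4 + ln 2\<close>, so the mean length controls all coordinates at once
  and not each of them separately. The remainders contribute their second moments, doubled: 36 = 2 *
  18.\<close>

lemma sum_lik_ratio_square_le:
  assumes b: "\<And>i. i \<in> I \<Longrightarrow> \<bar>b i\<bar> = \<beta>" and \<beta>: "0 \<le> \<beta>" "\<beta> \<le> 1"
    and len: "(\<integral>\<^sup>+y. ennreal (pm y * real (length y)) \<partial>count_space UNIV) \<le> ennreal l" and l: "0 \<le> l"
  shows "(\<Sum>i\<in>I. \<integral>\<^sup>+y. ennreal (pm y * (lik_ratio b i y - 1)\<^sup>2) \<partial>count_space UNIV)
    \<le> ennreal (4 * \<beta>\<^sup>2 * (ln 4 * l + ln 2) + 36 * exp 8 * real (card I) * \<beta>^4)"
proof -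
  let ?Q = "\<lambda>y :: bool list. (1/4) ^ length y / 2 :: real"
  let ?T = "\<lambda>i y. pm y * (lik_ratio b i y - 1)\<^sup>2"
  let ?R = "\<lambda>i y. \<integral>w. g y w * (rem (b i) i w)\<^sup>2 \<partial>M"
  have b2: "(b i)\<^sup>2 = \<beta>\<^sup>2" if "i \<in> I" for i using b[OF that] by (metis power2_abs)
  have R0: "0 \<le> ?R i y" for i y
    using g_nonneg by (auto intro!: integral_nonneg_AE AE_I2)
  \<comment> \<open>The term with \<open>pm y\<close> is kept on the left: summed over
    \<open>y\<close> it cancels against the weights, both having total mass one, and subtraction in
    \<open>ennreal\<close> is avoided.\<close>
  have pw: "(\<Sum>i\<in>I. ?T i y) + 4 * \<beta>\<^sup>2 * pm y
      \<le> 4 * \<beta>\<^sup>2 * ln 4 * (pm y * real (length y)) + 4 * \<beta>\<^sup>2 * ln 2 * pm y + 4 * \<beta>\<^sup>2 * ?Q y + 2 * (\<Sum>i\<in>I. ?R i y)" for y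
  proof -
    have lnQ: "ln (1 / ?Q y) = real (length y) * ln 4 + ln 2"
      by (simp add: ln_div ln_mult ln_realpow power_one_over)
    have "(\<Sum>i\<in>I. ?T i y) \<le> (\<Sum>i\<in>I. 2 * \<beta>\<^sup>2 * (pm y * (post_mean i y)\<^sup>2) + 2 * ?R i y)"
      using lik_ratio_square_le[of b] b \<beta> b2 by (intro sum_mono) (metis (no_types, lifting))
    also have "\<dots> = 4 * \<beta>\<^sup>2 * (pm y * (\<Sum>i\<in>I. (post_mean i y)\<^sup>2) / 2) + 2 * (\<Sum>i\<in>I. ?R i y)"
    proof -
      have "(\<Sum>i\<in>I. 2 * \<beta>\<^sup>2 * (pm y * (post_mean i y)\<^sup>2)) = 2 * \<beta>\<^sup>2 * (pm y * (\<Sum>i\<in>I. (post_mean i y)\<^sup>2))"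
        by (simp only: sum_distrib_left)
      then show ?thesis by (simp add: sum.distrib flip: sum_distrib_left)
    qed
    also have "\<dots> \<le> 4 * \<beta>\<^sup>2 * (pm y * ln (1 / ?Q y) + ?Q y - pm y) + 2 * (\<Sum>i\<in>I. ?R i y)"
      using post_mean_square_le[of "?Q y" y] by (intro add_mono mult_left_mono) auto
    finally show ?thesis unfolding lnQ by (simp add: algebra_simps)
  qed
  have R: "(\<integral>\<^sup>+y. ennreal (?R i y) \<partial>count_space UNIV) \<le> ennreal (18 * exp 8 * \<beta>^4)" if i: "i \<in> I" for i
  proof -
    have bi: "\<bar>b i\<bar> \<le> 1" using b[OF i] \<beta> by simp
    have "ennreal (?R i y) = (\<integral>\<^sup>+w. ennreal (g y w) * ennreal ((rem (b i) i w)\<^sup>2) \<partial>M)" for y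
      using g_nonneg integrable_g_mult[OF integrable_rem_square[OF bi i], of y]
      by (subst nn_integral_eq_integral[symmetric]) (auto simp: ennreal_mult intro!: nn_integral_cong)
    then have "(\<integral>\<^sup>+y. ennreal (?R i y) \<partial>count_space UNIV) = (\<integral>\<^sup>+w. ennreal ((rem (b i) i w)\<^sup>2) \<partial>M)"
      using sum_expectation_g[of "\<lambda>w. ennreal ((rem (b i) i w)\<^sup>2)"] i by simp
    also have "\<dots> = ennreal (\<integral>w. (rem (b i) i w)\<^sup>2 \<partial>M)"
      by (rule nn_integral_eq_integral[OF integrable_rem_square[OF bi i]]) simp
    also have "\<dots> \<le> ennreal (18 * exp 8 * (b i)^4)"
      by (intro ennreal_leI integral_rem_square_le bi i)
    also have "(b i)^4 = \<beta>^4" using b2[OF i] by (metis (no_types) mult_2 numeral_Bit0 power2_eq_square power_add)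
    finally show ?thesis .
  qed
  have "(\<Sum>i\<in>I. \<integral>\<^sup>+y. ennreal (?T i y) \<partial>count_space UNIV) + ennreal (4 * \<beta>\<^sup>2)
      = (\<integral>\<^sup>+y. (\<Sum>i\<in>I. ennreal (?T i y)) + ennreal (4 * \<beta>\<^sup>2) * ennreal (pm y) \<partial>count_space UNIV)"
    by (subst nn_integral_add) (simp_all add: nn_integral_sum nn_integral_cmult pm_sum)
  also have "\<dots> = (\<integral>\<^sup>+y. ennreal ((\<Sum>i\<in>I. ?T i y) + 4 * \<beta>\<^sup>2 * pm y) \<partial>count_space UNIV)"
  proof (rule nn_integral_cong)
    fix y
    have T: "0 \<le> ?T i y" for i using pm_nonneg by simp
    then have "(\<Sum>i\<in>I. ennreal (?T i y)) = ennreal (\<Sum>i\<in>I. ?T i y)" by (intro sum_ennreal)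
    moreover have "ennreal (4 * \<beta>\<^sup>2) * ennreal (pm y) = ennreal (4 * \<beta>\<^sup>2 * pm y)"
      by (rule ennreal_mult[symmetric]) (auto simp: pm_nonneg)
    ultimately show "(\<Sum>i\<in>I. ennreal (?T i y)) + ennreal (4 * \<beta>\<^sup>2) * ennreal (pm y)
        = ennreal ((\<Sum>i\<in>I. ?T i y) + 4 * \<beta>\<^sup>2 * pm y)"
      using T pm_nonneg by (simp only: ennreal_plus sum_nonneg mult_nonneg_nonneg zero_le_power2 zero_le_numeral)
  qed
  also have "\<dots> \<le> (\<integral>\<^sup>+y. ennreal (4 * \<beta>\<^sup>2 * ln 4 * (pm y * real (length y)) + 4 * \<beta>\<^sup>2 * ln 2 * pm y + 4 * \<beta>\<^sup>2 * ?Q y + 2 * (\<Sum>i\<in>I. ?R i y)) \<partial>count_space UNIV)"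
    by (intro nn_integral_mono ennreal_leI pw)
  also have "\<dots> = (\<integral>\<^sup>+y. ennreal (4 * \<beta>\<^sup>2 * ln 4) * ennreal (pm y * real (length y)) + ennreal (4 * \<beta>\<^sup>2 * ln 2) * ennreal (pm y)
      + ennreal (4 * \<beta>\<^sup>2) * ennreal (?Q y) + 2 * (\<Sum>i\<in>I. ennreal (?R i y)) \<partial>count_space UNIV)"
  proof (rule nn_integral_cong)
    fix y
    have "ennreal (2 * (\<Sum>i\<in>I. ?R i y)) = 2 * (\<Sum>i\<in>I. ennreal (?R i y))"
      by (simp add: ennreal_mult R0 sum_nonneg)
    moreover have "0 \<le> 4 * \<beta>\<^sup>2 * ln 4 * (pm y * real (length y))" "0 \<le> 4 * \<beta>\<^sup>2 * ln 2 * pm y" "0 \<le> 4 * \<beta>\<^sup>2 * ?Q y" "0 \<le> 2 * (\<Sum>i\<in>I. ?R i y)"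
      using pm_nonneg R0 by (auto intro!: mult_nonneg_nonneg sum_nonneg)
    moreover have "ennreal (4 * \<beta>\<^sup>2 * ln 4 * (pm y * real (length y))) = ennreal (4 * \<beta>\<^sup>2 * ln 4) * ennreal (pm y * real (length y))"
      "ennreal (4 * \<beta>\<^sup>2 * ln 2 * pm y) = ennreal (4 * \<beta>\<^sup>2 * ln 2) * ennreal (pm y)"
      "ennreal (4 * \<beta>\<^sup>2 * ?Q y) = ennreal (4 * \<beta>\<^sup>2) * ennreal (?Q y)"
      by (rule ennreal_mult, simp, simp add: pm_nonneg)+
    ultimately show "ennreal (4 * \<beta>\<^sup>2 * ln 4 * (pm y * real (length y)) + 4 * \<beta>\<^sup>2 * ln 2 * pm y + 4 * \<beta>\<^sup>2 * ?Q y + 2 * (\<Sum>i\<in>I. ?R i y))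
      = ennreal (4 * \<beta>\<^sup>2 * ln 4) * ennreal (pm y * real (length y)) + ennreal (4 * \<beta>\<^sup>2 * ln 2) * ennreal (pm y)
      + ennreal (4 * \<beta>\<^sup>2) * ennreal (?Q y) + 2 * (\<Sum>i\<in>I. ennreal (?R i y))"
      by (simp only: ennreal_plus add_nonneg_nonneg)
  qed
  also have "\<dots> = ennreal (4 * \<beta>\<^sup>2 * ln 4) * (\<integral>\<^sup>+y. ennreal (pm y * real (length y)) \<partial>count_space UNIV)
      + ennreal (4 * \<beta>\<^sup>2 * ln 2) + ennreal (4 * \<beta>\<^sup>2) + 2 * (\<Sum>i\<in>I. \<integral>\<^sup>+y. ennreal (?R i y) \<partial>count_space UNIV)"
    by (simp add: nn_integral_add nn_integral_cmult nn_integral_sum pm_sum nn_integral_length_weights)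
  also have "\<dots> \<le> ennreal (4 * \<beta>\<^sup>2 * ln 4) * ennreal l + ennreal (4 * \<beta>\<^sup>2 * ln 2) + ennreal (4 * \<beta>\<^sup>2)
      + 2 * (\<Sum>i\<in>I. ennreal (18 * exp 8 * \<beta>^4))"
    by (intro add_mono mult_left_mono sum_mono len R) auto
  also have "\<dots> = ennreal (4 * \<beta>\<^sup>2 * (ln 4 * l + ln 2) + 36 * exp 8 * real (card I) * \<beta>^4) + ennreal (4 * \<beta>\<^sup>2)"
  proof -
    have "2 * (\<Sum>i\<in>I. ennreal (18 * exp 8 * \<beta>^4)) = ennreal (2 * (real (card I) * (18 * exp 8 * \<beta>^4)))"
    proof -
      have "(\<Sum>i\<in>I. ennreal (18 * exp 8 * \<beta>^4)) = ennreal (real (card I) * (18 * exp 8 * \<beta>^4))"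
        using \<beta> by (subst sum_ennreal) auto
      then show ?thesis using ennreal_mult[of 2 "real (card I) * (18 * exp 8 * \<beta>^4)"] \<beta> by simp
    qed
    moreover have "ennreal (4 * \<beta>\<^sup>2 * ln 4) * ennreal l = ennreal (4 * \<beta>\<^sup>2 * ln 4 * l)"
      using l by (intro ennreal_mult[symmetric]) auto
    ultimately show ?thesis
      using l \<beta> by (simp add: algebra_simps flip: ennreal_plus)
  qed
  finally show ?thesis
    by (subst (asm) ennreal_add_left_cancel_le[of "ennreal (4 * \<beta>\<^sup>2)", unfolded add.commute[of "ennreal (4 * \<beta>\<^sup>2)"]]) simp
qed

end

section \<open>From Markov kernels to likelihood ratios of messages\<close>

lemma measure_eq_density_count_space:
  fixes \<mu> :: "'y::countable measure"
  assumes "sets \<mu> = UNIV"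
  shows "\<mu> = density (count_space UNIV) (\<lambda>y. emeasure \<mu> {y})"
proof (rule measure_eqI_countable[of _ UNIV])
  fix y :: 'y
  show "emeasure \<mu> {y} = emeasure (density (count_space UNIV) (\<lambda>y. emeasure \<mu> {y})) {y}"
    by (simp add: emeasure_density nn_integral_count_space_indicator[symmetric] nn_integral_count_space_finite)
qed (use assms in auto)

lemma bind_message:
  assumes "prob_space M" and K: "K \<in> M \<rightarrow>\<^sub>M prob_algebra (count_space UNIV)"
  shows sets_bind_message: "sets (M \<bind> K) = UNIV"
    and prob_space_bind_message: "prob_space (M \<bind> K)"
proof -
  interpret prob_space M by fact
  have "M \<bind> K \<in> space (prob_algebra (count_space UNIV))"
    by (rule measurable_space[OF measurable_bind_prob_space[OF measurable_const, OF _ K]])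
       (auto simp: space_prob_algebra prob_space_axioms)
  then show "sets (M \<bind> K) = UNIV" "prob_space (M \<bind> K)"
    by (auto simp: space_prob_algebra)
qed

text \<open>The kernel becomes a channel through the masses of single messages. The ratios of all
  coordinates refer to one base law, so that their chi-square distances can be summed and bounded by
  a single message length.\<close>

lemma message_lik_ratio:
  assumes G: "gaussian_family M I \<xi>"
    and K: "K \<in> M \<rightarrow>\<^sub>M prob_algebra (count_space (UNIV :: bool list set))"
    and b: "\<And>i. i \<in> I \<Longrightarrow> \<bar>b i\<bar> = \<beta>" and \<beta>: "0 \<le> \<beta>" "\<beta> \<le> 1"
    and len: "(\<integral>\<^sup>+y. of_nat (length y) \<partial>(M \<bind> K)) \<le> ennreal l" and l: "0 \<le> l"
  obtains L :: "'i \<Rightarrow> bool list \<Rightarrow> real" where "\<And>i y. i \<in> I \<Longrightarrow> 0 \<le> L i y"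
    "\<And>i. i \<in> I \<Longrightarrow> density M (\<lambda>w. ennreal (exp (b i * \<xi> i w - (b i)\<^sup>2 / 2))) \<bind> K
        = density (M \<bind> K) (\<lambda>y. ennreal (L i y))"
    "(\<Sum>i\<in>I. \<integral>\<^sup>+y. ennreal ((L i y - 1)\<^sup>2) \<partial>(M \<bind> K))
      \<le> ennreal (4 * \<beta>\<^sup>2 * (ln 4 * l + ln 2) + 36 * exp 8 * real (card I) * \<beta>^4)"
proof -
  interpret gaussian_family M I \<xi> by (rule G)
  note Ksub = measurable_prob_algebraD[OF K]
  have Kw: "prob_space (K w)" "sets (K w) = UNIV" if "w \<in> space M" for w
    using measurable_space[OF K that] by (auto simp: space_prob_algebra)
  define g where "g y w = measure (K w) {y}" for y w
  have eg: "emeasure (K w) {y} = ennreal (g y w)" if "w \<in> space M" for w y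
    unfolding g_def using Kw[OF that] by (simp add: finite_measure.emeasure_eq_measure prob_space_def)
  interpret message_channel M I \<xi> g
  proof
    show "g y \<in> borel_measurable M" for y
      unfolding g_def[abs_def] by (rule measurable_compose[OF Ksub measurable_measure_subprob_algebra]) simp
    show "0 \<le> g y w" for y w by (simp add: g_def)
    fix w assume w: "w \<in> space M"
    have "(\<integral>\<^sup>+y. ennreal (g y w) \<partial>count_space UNIV) = (\<integral>\<^sup>+y. emeasure (K w) {y} \<partial>count_space UNIV)"
      by (simp add: eg[OF w])
    also have "\<dots> = emeasure (K w) UNIV"
      using Kw[OF w] by (intro emeasure_countable_singleton[symmetric]) auto
    also have "\<dots> = 1"
      using prob_space.emeasure_space_1[OF Kw(1)[OF w]] sets_eq_imp_space_eq[of "K w" "count_space UNIV"] Kw(2)[OF w]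
      by simp
    finally show "(\<integral>\<^sup>+y. ennreal (g y w) \<partial>count_space UNIV) = 1" .
  qed
  have pm: "emeasure (M \<bind> K) {y} = ennreal (pm y)" for y
  proof -
    have "emeasure (M \<bind> K) {y} = (\<integral>\<^sup>+w. emeasure (K w) {y} \<partial>M)"
      using not_empty by (intro emeasure_bind[OF _ Ksub]) auto
    also have "\<dots> = (\<integral>\<^sup>+w. ennreal (g y w) \<partial>M)" by (intro nn_integral_cong) (simp add: eg)
    also have "\<dots> = ennreal (pm y)"
      unfolding pm_def using g_nonneg by (intro nn_integral_eq_integral integrable_g) auto
    finally show ?thesis .
  qed
  have bind: "M \<bind> K = density (count_space UNIV) (\<lambda>y. ennreal (pm y))"
    using measure_eq_density_count_space[OF sets_bind_message[OF prob_space_axioms K]] by (simp add: pm)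
  have int: "(\<integral>\<^sup>+y. ennreal (f y) \<partial>(M \<bind> K)) = (\<integral>\<^sup>+y. ennreal (pm y * f y) \<partial>count_space UNIV)" for f
    unfolding bind by (subst nn_integral_density) (auto simp: ennreal_mult' pm_nonneg)
  show thesis
  proof
    show L0: "0 \<le> lik_ratio b i y" for i y
      unfolding lik_ratio_def using g_nonneg pm_nonneg
      by (intro divide_nonneg_nonneg integral_nonneg_AE AE_I2) auto
    have "(\<integral>\<^sup>+y. ennreal (pm y * real (length y)) \<partial>count_space UNIV) \<le> ennreal l"
      using len by (simp add: ennreal_of_nat_eq_real_of_nat int)
    then show "(\<Sum>i\<in>I. \<integral>\<^sup>+y. ennreal ((lik_ratio b i y - 1)\<^sup>2) \<partial>(M \<bind> K))
      \<le> ennreal (4 * \<beta>\<^sup>2 * (ln 4 * l + ln 2) + 36 * exp 8 * real (card I) * \<beta>^4)"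
      unfolding int by (intro sum_lik_ratio_square_le b \<beta> l)
    fix i assume i: "i \<in> I"
    let ?D = "\<lambda>w. ennreal (exp (b i * \<xi> i w - (b i)\<^sup>2 / 2))"
    have iD: "integrable M (\<lambda>w. exp (b i * \<xi> i w - (b i)\<^sup>2 / 2))"
      using integrable_exp_xi[OF i, of "b i"] by (simp add: exp_diff)
    note borel_measurable_integrable[OF iD, measurable]
    have "(\<integral>\<^sup>+w. ?D w \<partial>M) = 1"
      using nn_integral_eq_integral[OF iD] integral_exp_xi[OF i, of "b i"] by (simp add: exp_diff)
    then have prob: "prob_space (density M ?D)"
      by (intro prob_spaceI) (subst emeasure_density, use borel_measurable_integrable[OF iD] in \<open>auto cong: nn_integral_cong\<close>)
    have K': "K \<in> density M ?D \<rightarrow>\<^sub>M prob_algebra (count_space UNIV)" using K by simp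
    show "density M ?D \<bind> K = density (M \<bind> K) (\<lambda>y. ennreal (lik_ratio b i y))"
    proof (rule measure_eqI_countable[of _ UNIV])
      show "sets (density M ?D \<bind> K) = Pow UNIV" using sets_bind_message[OF prob K'] by simp
      show "sets (density (M \<bind> K) (\<lambda>y. ennreal (lik_ratio b i y))) = Pow UNIV"
        using sets_bind_message[OF prob_space_axioms K] by simp
      fix y
      have "emeasure (density M ?D \<bind> K) {y} = (\<integral>\<^sup>+w. emeasure (K w) {y} \<partial>density M ?D)"
        using not_empty by (intro emeasure_bind[OF _ measurable_prob_algebraD[OF K']]) auto
      also have "\<dots> = (\<integral>\<^sup>+w. ?D w * emeasure (K w) {y} \<partial>M)"
        by (intro nn_integral_density) (auto intro: measurable_emeasure_kernel[OF Ksub])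
      also have "\<dots> = (\<integral>\<^sup>+w. ennreal (g y w * exp (b i * \<xi> i w - (b i)\<^sup>2 / 2)) \<partial>M)"
        using g_nonneg by (intro nn_integral_cong) (simp add: eg ennreal_mult mult.commute)
      also have "\<dots> = ennreal (\<integral>w. g y w * exp (b i * \<xi> i w - (b i)\<^sup>2 / 2) \<partial>M)"
        using g_nonneg by (intro nn_integral_eq_integral integrable_g_mult iD) auto
      also have "(\<integral>w. g y w * exp (b i * \<xi> i w - (b i)\<^sup>2 / 2) \<partial>M) = pm y * lik_ratio b i y"
      proof (cases "pm y = 0")
        case True
        \<comment> \<open>For a message of probability zero, \<open>g y\<close> vanishes almost
          everywhere, so the message keeps probability zero after the shift.\<close>
        have "(\<integral>w. g y w * exp (b i * \<xi> i w - (b i)\<^sup>2 / 2) \<partial>M) = 0"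
          using AE_g_zero[OF True] by (intro integral_eq_zero_AE) (auto elim: eventually_mono)
        with True show ?thesis by simp
      qed (simp add: lik_ratio_def)
      also have "ennreal (pm y * lik_ratio b i y) = (\<integral>\<^sup>+y'. ennreal (lik_ratio b i y') * indicator {y} y' \<partial>(M \<bind> K))"
        unfolding bind using pm_nonneg
        by (subst nn_integral_density)
           (auto simp: ennreal_mult' mult.assoc[symmetric] nn_integral_count_space_indicator[symmetric] nn_integral_count_space_finite)
      also have "\<dots> = emeasure (density (M \<bind> K) (\<lambda>y. ennreal (lik_ratio b i y))) {y}"
        using sets_bind_message[OF prob_space_axioms K]
        by (intro emeasure_density[symmetric]) (auto simp: measurable_cong_sets[of "M \<bind> K" "count_space UNIV", OF _ refl])
      finally show "emeasure (density M ?D \<bind> K) {y} = emeasure (density (M \<bind> K) (\<lambda>y. ennreal (lik_ratio b i y))) {y}" .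
    qed auto
  qed
qed

section \<open>Two-point bound for product experiments\<close>

text \<open>Finite tuples of messages form a countable set, so all sets of tuples, and then all
  functions of a tuple, are measurable.\<close>

lemma sets_PiM_countable:
  assumes "finite J" and "\<And>j. j \<in> J \<Longrightarrow> sets (\<mu> j) = (UNIV :: 'y::countable set set)"
  shows "sets (Pi\<^sub>M J \<mu>) = Pow (J \<rightarrow>\<^sub>E UNIV)"
proof -
  have "sets (Pi\<^sub>M J \<mu>) = sets (Pi\<^sub>M J (\<lambda>_. count_space (UNIV :: 'y set)))"
    using assms by (intro sets_PiM_cong) auto
  also have "\<dots> = Pow (J \<rightarrow>\<^sub>E UNIV)"
    using assms(1) by (subst count_space_PiM_finite) auto
  finally show ?thesis .
qed

lemma measurable_PiM_countable:
  assumes "finite J" and "\<And>j. j \<in> J \<Longrightarrow> sets (\<mu> j) = (UNIV :: 'y::countable set set)"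
  shows "(f :: ('j \<Rightarrow> 'y) \<Rightarrow> 'a::topological_space) \<in> borel_measurable (Pi\<^sub>M J \<mu>)"
  using sets_PiM_countable[OF assms] sets.sets_into_space[of _ "Pi\<^sub>M J \<mu>"] sets_eq_imp_space_eq[of "Pi\<^sub>M J \<mu>" "count_space (J \<rightarrow>\<^sub>E UNIV)"]
  by (intro measurableI) auto

lemma PiM_density:
  fixes \<mu> :: "'j \<Rightarrow> 'y::countable measure"
  assumes J: "finite J" and sets: "\<And>j. j \<in> J \<Longrightarrow> sets (\<mu> j) = UNIV"
    and \<mu>: "\<And>j. j \<in> J \<Longrightarrow> prob_space (\<mu> j)" and \<nu>: "\<And>j. j \<in> J \<Longrightarrow> prob_space (\<nu> j)"
    and dens: "\<And>j. j \<in> J \<Longrightarrow> \<nu> j = density (\<mu> j) (\<lambda>y. ennreal (L j y))"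
    and L: "\<And>j y. j \<in> J \<Longrightarrow> 0 \<le> L j y"
  shows "Pi\<^sub>M J \<nu> = density (Pi\<^sub>M J \<mu>) (\<lambda>y. ennreal (\<Prod>j\<in>J. L j (y j)))"
proof -
  \<comment> \<open>The product locale asks for a probability measure at every index; point masses
    fill the indices outside \<open>J\<close>.\<close>
  define \<mu>' where "\<mu>' j = (if j \<in> J then \<mu> j else return (count_space UNIV) undefined)" for j
  define \<nu>' where "\<nu>' j = (if j \<in> J then \<nu> j else return (count_space UNIV) undefined)" for j
  interpret M: product_prob_space \<mu>' J
    by (intro product_prob_spaceI) (auto simp: \<mu>'_def \<mu> intro: prob_space_return)
  interpret N: product_prob_space \<nu>' J
    by (intro product_prob_spaceI) (auto simp: \<nu>'_def \<nu> intro: prob_space_return)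
  have eq: "Pi\<^sub>M J \<mu> = Pi\<^sub>M J \<mu>'" "Pi\<^sub>M J \<nu> = Pi\<^sub>M J \<nu>'"
    by (auto intro!: PiM_cong simp: \<mu>'_def \<nu>'_def)
  have setsn: "sets (\<nu> j) = UNIV" if "j \<in> J" for j using that by (simp add: dens sets)
  let ?D = "\<lambda>y. ennreal (\<Prod>j\<in>J. L j (y j))"
  have mP: "f \<in> borel_measurable (Pi\<^sub>M J \<mu>)" for f :: "_ \<Rightarrow> ennreal"
    by (rule measurable_PiM_countable[OF J sets])
  have mu_m: "f \<in> borel_measurable (\<mu> j)" if "j \<in> J" for j and f :: "_ \<Rightarrow> ennreal"
    using sets[OF that] by (simp add: measurable_cong_sets[of "\<mu> j" "count_space UNIV", OF _ refl])
  have "density (Pi\<^sub>M J \<mu>) ?D = Pi\<^sub>M J \<nu>'"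
  proof (rule N.PiM_eqI[OF J])
    show "sets (density (Pi\<^sub>M J \<mu>) ?D) = sets (Pi\<^sub>M J \<nu>')"
      unfolding eq(2)[symmetric] by (simp add: sets_PiM_countable[OF J sets] sets_PiM_countable[OF J setsn])
    fix A :: "'j \<Rightarrow> 'y set"
    have "emeasure (density (Pi\<^sub>M J \<mu>) ?D) (Pi\<^sub>E J A) = (\<integral>\<^sup>+y. ?D y * indicator (Pi\<^sub>E J A) y \<partial>Pi\<^sub>M J \<mu>)"
      by (rule emeasure_density[OF mP]) (auto simp: sets_PiM_countable[OF J sets])
    also have "\<dots> = (\<integral>\<^sup>+y. (\<Prod>j\<in>J. ennreal (L j (y j)) * indicator (A j) (y j)) \<partial>Pi\<^sub>M J \<mu>')"
      unfolding eq(1)[symmetric]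
    proof (rule nn_integral_cong)
      fix y assume "y \<in> space (Pi\<^sub>M J \<mu>)"
      then have "indicator (Pi\<^sub>E J A) y = (\<Prod>j\<in>J. indicator (A j) (y j) :: ennreal)"
        using J by (auto simp: space_PiM PiE_iff indicator_def prod_zero_iff)
      moreover have "?D y = (\<Prod>j\<in>J. ennreal (L j (y j)))"
        using L by (simp add: prod_ennreal)
      ultimately show "?D y * indicator (Pi\<^sub>E J A) y = (\<Prod>j\<in>J. ennreal (L j (y j)) * indicator (A j) (y j))"
        by (simp add: prod.distrib)
    qed
    also have "\<dots> = (\<Prod>j\<in>J. \<integral>\<^sup>+y. ennreal (L j y) * indicator (A j) y \<partial>\<mu>' j)"
      by (rule M.product_nn_integral_prod[OF J]) (auto simp: \<mu>'_def mu_m)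
    also have "\<dots> = (\<Prod>j\<in>J. emeasure (\<nu>' j) (A j))"
      using sets by (intro prod.cong refl) (auto simp: \<mu>'_def \<nu>'_def dens emeasure_density mu_m)
    finally show "emeasure (density (Pi\<^sub>M J \<mu>) ?D) (Pi\<^sub>E J A) = (\<Prod>j\<in>J. emeasure (\<nu>' j) (A j))" .
  qed
  then show ?thesis unfolding eq(2) by simp
qed

text \<open>Minimising over \<open>x\<close> leaves the squared distance times \<Lambda>/(1 +
  \<Lambda>), and this factor is at least 2 c \<Lambda> - c^2 (\<Lambda> + \<Lambda>^2) because (1 -
  c (1 + \<Lambda>))^2 \<ge> 0. The bound is quadratic in the likelihood ratio \<Lambda>, so two
  moments of it suffice.\<close>

lemma two_point_pointwise:
  fixes \<Lambda> :: real
  assumes "0 \<le> \<Lambda>"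
  shows "2 * c * (\<theta> - \<theta>')\<^sup>2 * \<Lambda> \<le> (x - \<theta>)\<^sup>2 + \<Lambda> * (x - \<theta>')\<^sup>2 + (\<theta> - \<theta>')\<^sup>2 * c\<^sup>2 * (\<Lambda> + \<Lambda>\<^sup>2)"
proof -
  let ?X = "(x - \<theta>)\<^sup>2 + \<Lambda> * (x - \<theta>')\<^sup>2" and ?D = "(\<theta> - \<theta>')\<^sup>2"
  have "(1 + \<Lambda>) * ?X - \<Lambda> * ?D = ((x - \<theta>) + \<Lambda> * (x - \<theta>'))\<^sup>2"
    by (simp add: power2_eq_square algebra_simps)
  then have "0 \<le> (1 + \<Lambda>) * ?X - \<Lambda> * ?D" by (metis zero_le_power2)
  moreover have "(1 + \<Lambda>) * (?D * c\<^sup>2 * (\<Lambda> + \<Lambda>\<^sup>2) - 2 * c * ?D * \<Lambda>) + \<Lambda> * ?D = \<Lambda> * ?D * (1 - c * (1 + \<Lambda>))\<^sup>2"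
    by (simp add: power2_eq_square algebra_simps)
  moreover have "0 \<le> \<Lambda> * ?D * (1 - c * (1 + \<Lambda>))\<^sup>2" using assms by simp
  ultimately have "0 \<le> (1 + \<Lambda>) * (?X + ?D * c\<^sup>2 * (\<Lambda> + \<Lambda>\<^sup>2) - 2 * c * ?D * \<Lambda>)"
    by (simp only: distrib_left right_diff_distrib)
  with assms show ?thesis by (simp add: zero_le_mult_iff)
qed

text \<open>Independence makes the second moment of the product likelihood ratio a product of
  factors at most 1 + \<kappa>, hence at most e^S with S the sum of the \<kappa>. Integrating the
  pointwise inequality with a suitable \<open>c\<close> gives the squared distance over 1 + e^S, and
  1/(1 + e^S) \<ge> (1 - S)/2 for S < 1; otherwise the claim is trivial.\<close>

lemma two_point_risk:
  fixes \<mu> :: "'j \<Rightarrow> 'y::countable measure" and G :: "('j \<Rightarrow> 'y) \<Rightarrow> real"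
  assumes J: "finite J" and sets: "\<And>j. j \<in> J \<Longrightarrow> sets (\<mu> j) = UNIV"
    and \<mu>: "\<And>j. j \<in> J \<Longrightarrow> prob_space (\<mu> j)" and \<nu>: "\<And>j. j \<in> J \<Longrightarrow> prob_space (\<nu> j)"
    and dens: "\<And>j. j \<in> J \<Longrightarrow> \<nu> j = density (\<mu> j) (\<lambda>y. ennreal (L j y))"
    and L: "\<And>j y. j \<in> J \<Longrightarrow> 0 \<le> L j y"
    and chi: "\<And>j. j \<in> J \<Longrightarrow> (\<integral>\<^sup>+y. ennreal ((L j y - 1)\<^sup>2) \<partial>\<mu> j) \<le> ennreal (\<kappa> j)"
    and chi0: "\<And>j. j \<in> J \<Longrightarrow> 0 \<le> \<kappa> j"
  shows "ennreal ((\<theta> - \<theta>')\<^sup>2 * (1 - (\<Sum>j\<in>J. \<kappa> j)) / 2)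
    \<le> (\<integral>\<^sup>+y. ennreal ((G y - \<theta>)\<^sup>2) \<partial>Pi\<^sub>M J \<mu>) + (\<integral>\<^sup>+y. ennreal ((G y - \<theta>')\<^sup>2) \<partial>Pi\<^sub>M J \<nu>)"
proof -
  let ?S = "\<Sum>j\<in>J. \<kappa> j" and ?D = "(\<theta> - \<theta>')\<^sup>2"
  let ?\<Lambda> = "\<lambda>y. \<Prod>j\<in>J. L j (y j)"
  let ?P = "Pi\<^sub>M J \<mu>"
  \<comment> \<open>The maximiser of 2 c - c^2 (1 + e^S), the coefficient left after integration;
    the maximum equals \<open>c\<close> itself.\<close>
  define c where "c = 1 / (1 + exp ?S)"
  have c0: "0 < c" unfolding c_def by (simp add: add_pos_pos)
  have m: "f \<in> borel_measurable ?P" for f :: "_ \<Rightarrow> ennreal"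
    by (rule measurable_PiM_countable[OF J sets])
  have mj: "f \<in> borel_measurable (\<mu> j)" if "j \<in> J" for j and f :: "_ \<Rightarrow> ennreal"
    using sets[OF that] by (simp add: measurable_cong_sets[of "\<mu> j" "count_space UNIV", OF _ refl])
  have mjr: "f \<in> borel_measurable (\<mu> j)" if "j \<in> J" for j and f :: "_ \<Rightarrow> real"
    using sets[OF that] by (simp add: measurable_cong_sets[of "\<mu> j" "count_space UNIV", OF _ refl])
  have \<Lambda>0: "0 \<le> ?\<Lambda> y" for y using L by (intro prod_nonneg) auto
  have \<nu>P: "Pi\<^sub>M J \<nu> = density ?P (\<lambda>y. ennreal (?\<Lambda> y))"
    by (rule PiM_density[OF J sets \<mu> \<nu> dens L])
  have \<nu>int: "(\<integral>\<^sup>+y. f y \<partial>Pi\<^sub>M J \<nu>) = (\<integral>\<^sup>+y. ennreal (?\<Lambda> y) * f y \<partial>?P)" for f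
    unfolding \<nu>P by (rule nn_integral_density[OF m m])
  have "prob_space (Pi\<^sub>M J \<nu>)" by (rule prob_space_PiM[OF \<nu>])
  then have \<Lambda>1: "(\<integral>\<^sup>+y. ennreal (?\<Lambda> y) \<partial>?P) = 1"
    using \<nu>int[of "\<lambda>_. 1"] by (simp add: prob_space.emeasure_space_1)
  have \<Lambda>2: "(\<integral>\<^sup>+y. ennreal ((?\<Lambda> y)\<^sup>2) \<partial>?P) \<le> ennreal (exp ?S)"
  proof -
    define \<mu>' where "\<mu>' j = (if j \<in> J then \<mu> j else return (count_space UNIV) undefined)" for j
    interpret M: product_prob_space \<mu>' J
      by (intro product_prob_spaceI) (auto simp: \<mu>'_def \<mu> intro: prob_space_return)
    have P: "?P = Pi\<^sub>M J \<mu>'" by (auto intro!: PiM_cong simp: \<mu>'_def)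
    have "(\<integral>\<^sup>+y. ennreal ((?\<Lambda> y)\<^sup>2) \<partial>?P) = (\<integral>\<^sup>+y. (\<Prod>j\<in>J. ennreal ((L j (y j))\<^sup>2)) \<partial>Pi\<^sub>M J \<mu>')"
      unfolding P by (simp add: prod_power_distrib prod_ennreal)
    also have "\<dots> = (\<Prod>j\<in>J. \<integral>\<^sup>+y. ennreal ((L j y)\<^sup>2) \<partial>\<mu>' j)"
      by (rule M.product_nn_integral_prod[OF J]) (auto simp: \<mu>'_def mjr)
    also have "\<dots> \<le> (\<Prod>j\<in>J. ennreal (1 + \<kappa> j))"
    proof (rule prod_mono_ennreal)
      fix j assume j: "j \<in> J"
      interpret prob_space "\<mu> j" by (rule \<mu>[OF j])
      have L1: "(\<integral>\<^sup>+y. ennreal (L j y) \<partial>\<mu> j) = 1"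
        using prob_space.emeasure_space_1[OF \<nu>[OF j]] unfolding dens[OF j]
        by (subst (asm) emeasure_density) (auto simp: mj[OF j] cong: nn_integral_cong)
      \<comment> \<open>The identity E L^2 = 1 + E (L - 1)^2, arranged so that nothing is subtracted
        in \<open>ennreal\<close>.\<close>
      have "(\<integral>\<^sup>+y. ennreal ((L j y)\<^sup>2) \<partial>\<mu> j) + 1 = (\<integral>\<^sup>+y. ennreal ((L j y)\<^sup>2) + 1 \<partial>\<mu> j)"
        by (subst nn_integral_add) (auto simp: mj[OF j] emeasure_space_1)
      also have "\<dots> = (\<integral>\<^sup>+y. ennreal ((L j y - 1)\<^sup>2) + 2 * ennreal (L j y) \<partial>\<mu> j)"
      proof (rule nn_integral_cong)
        fix y
        have "ennreal ((L j y)\<^sup>2 + 1) = ennreal ((L j y - 1)\<^sup>2 + 2 * L j y)"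
          by (simp add: power2_eq_square algebra_simps)
        then show "ennreal ((L j y)\<^sup>2) + 1 = ennreal ((L j y - 1)\<^sup>2) + 2 * ennreal (L j y)"
          using L[OF j, of y] by (simp add: ennreal_mult)
      qed
      also have "\<dots> = (\<integral>\<^sup>+y. ennreal ((L j y - 1)\<^sup>2) \<partial>\<mu> j) + 2"
        by (simp add: nn_integral_add nn_integral_cmult mj[OF j] L1)
      also have "\<dots> \<le> ennreal (\<kappa> j) + 2"
        by (intro add_mono chi j order_refl)
      also have "\<dots> = ennreal (1 + \<kappa> j) + 1"
      proof -
        have "ennreal (\<kappa> j) + ennreal 2 = ennreal (\<kappa> j + 2)" "ennreal (1 + \<kappa> j) + ennreal 1 = ennreal (1 + \<kappa> j + 1)"
          using chi0[OF j] by (intro ennreal_plus[symmetric]; simp)+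
        then show ?thesis by (simp add: add.commute)
      qed
      finally have "(\<integral>\<^sup>+y. ennreal ((L j y)\<^sup>2) \<partial>\<mu> j) \<le> ennreal (1 + \<kappa> j)"
        by (simp add: ennreal_add_left_cancel_le add.commute[of _ 1])
      then show "(\<integral>\<^sup>+y. ennreal ((L j y)\<^sup>2) \<partial>\<mu>' j) \<le> ennreal (1 + \<kappa> j)"
        using j by (simp add: \<mu>'_def)
    qed
    also have "\<dots> = ennreal (\<Prod>j\<in>J. 1 + \<kappa> j)"
      using chi0 by (intro prod_ennreal) (simp add: add_nonneg_nonneg)
    also have "\<dots> \<le> ennreal (\<Prod>j\<in>J. exp (\<kappa> j))"
      using chi0 by (intro ennreal_leI prod_mono) (auto simp: add_nonneg_nonneg)
    also have "(\<Prod>j\<in>J. exp (\<kappa> j)) = exp ?S" using J by (simp add: exp_sum)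
    finally show ?thesis .
  qed
  let ?R = "(\<integral>\<^sup>+y. ennreal ((G y - \<theta>)\<^sup>2) \<partial>?P) + (\<integral>\<^sup>+y. ennreal ((G y - \<theta>')\<^sup>2) \<partial>Pi\<^sub>M J \<nu>)"
  have "ennreal (c * ?D) + ennreal (c * ?D) = (\<integral>\<^sup>+y. ennreal (2 * c * ?D) * ennreal (?\<Lambda> y) \<partial>?P)"
    using c0 by (subst nn_integral_cmult[OF m]) (simp add: \<Lambda>1 flip: ennreal_plus)
  also have "\<dots> \<le> (\<integral>\<^sup>+y. (ennreal ((G y - \<theta>)\<^sup>2) + ennreal (?\<Lambda> y) * ennreal ((G y - \<theta>')\<^sup>2))
      + ennreal (?D * c\<^sup>2) * (ennreal (?\<Lambda> y) + ennreal ((?\<Lambda> y)\<^sup>2)) \<partial>?P)"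
  proof (rule nn_integral_mono)
    fix y
    have "ennreal (2 * c * ?D * ?\<Lambda> y) \<le> ennreal ((G y - \<theta>)\<^sup>2 + ?\<Lambda> y * (G y - \<theta>')\<^sup>2 + ?D * c\<^sup>2 * (?\<Lambda> y + (?\<Lambda> y)\<^sup>2))"
      by (intro ennreal_leI two_point_pointwise \<Lambda>0)
    also have "\<dots> = (ennreal ((G y - \<theta>)\<^sup>2) + ennreal (?\<Lambda> y) * ennreal ((G y - \<theta>')\<^sup>2))
      + ennreal (?D * c\<^sup>2) * (ennreal (?\<Lambda> y) + ennreal ((?\<Lambda> y)\<^sup>2))"
      using \<Lambda>0[of y] by (simp add: ennreal_mult)
    also have "ennreal (2 * c * ?D * ?\<Lambda> y) = ennreal (2 * c * ?D) * ennreal (?\<Lambda> y)"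
      using \<Lambda>0[of y] c0 by (intro ennreal_mult) auto
    finally show "ennreal (2 * c * ?D) * ennreal (?\<Lambda> y) \<le> (ennreal ((G y - \<theta>)\<^sup>2) + ennreal (?\<Lambda> y) * ennreal ((G y - \<theta>')\<^sup>2))
      + ennreal (?D * c\<^sup>2) * (ennreal (?\<Lambda> y) + ennreal ((?\<Lambda> y)\<^sup>2))" .
  qed
  also have "\<dots> = ?R + ennreal (?D * c\<^sup>2) * (1 + (\<integral>\<^sup>+y. ennreal ((?\<Lambda> y)\<^sup>2) \<partial>?P))"
    by (simp add: nn_integral_add nn_integral_cmult m \<nu>int \<Lambda>1)
  also have "\<dots> \<le> ?R + ennreal (?D * c\<^sup>2) * (1 + ennreal (exp ?S))"
    by (intro add_mono mult_left_mono \<Lambda>2 order_refl) simp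
  also have "ennreal (?D * c\<^sup>2) * (1 + ennreal (exp ?S)) = ennreal (c * ?D)"
  proof -
    have "1 + ennreal (exp ?S) = ennreal (1 + exp ?S)" by simp
    then have "ennreal (?D * c\<^sup>2) * (1 + ennreal (exp ?S)) = ennreal ((?D * c\<^sup>2) * (1 + exp ?S))"
      by (simp only: ennreal_mult zero_le_mult_iff zero_le_power2 simp_thms add_nonneg_nonneg zero_le_one exp_ge_zero)
    also have "(?D * c\<^sup>2) * (1 + exp ?S) = ?D * c * (c * (1 + exp ?S))"
      by (simp add: power2_eq_square)
    also have "c * (1 + exp ?S) = 1"
      unfolding c_def by (simp add: add_pos_pos less_imp_neq[symmetric])
    finally show ?thesis by (simp add: mult.commute)
  qed
  finally have R: "ennreal (c * ?D) \<le> ?R"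
    by (simp add: add.commute[of ?R] ennreal_add_left_cancel_le)
  have "?D * (1 - ?S) / 2 \<le> c * ?D"
  proof (cases "?S < 1")
    case True
    have "exp ?S * (1 + (- ?S)) \<le> exp ?S * exp (- ?S)"
      by (intro mult_left_mono exp_ge_add_one_self) simp
    then have "exp ?S * (1 - ?S) \<le> 1" by (simp flip: exp_add)
    then have "(1 + exp ?S) * (1 - ?S) \<le> 2"
      using sum_nonneg[of J \<kappa>] chi0 by (simp add: algebra_simps)
    then have "(1 - ?S) / 2 \<le> c"
      unfolding c_def by (subst pos_le_divide_eq) (auto simp: add_pos_pos mult.commute)
    then have "?D * ((1 - ?S) / 2) \<le> ?D * c" by (intro mult_left_mono) auto
    then show ?thesis by (simp add: mult.commute)
  next
    case False
    then have "?D * (1 - ?S) \<le> 0" by (intro mult_nonneg_nonpos) auto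
    moreover have "0 \<le> c * ?D" using c0 by simp
    ultimately show ?thesis by linarith
  qed
  then have "ennreal (?D * (1 - ?S) / 2) \<le> ennreal (c * ?D)" by (rule ennreal_leI)
  with R show ?thesis by (rule order_trans[rotated])
qed

section \<open>Sign perturbations\<close>

text \<open>A sign vector is encoded by the set of its positive coordinates, so that averages over
  sign vectors are sums over \<open>Pow I\<close>.\<close>

definition sign_of :: "'i set \<Rightarrow> 'i \<Rightarrow> real" where
  "sign_of A k = (if k \<in> A then 1 else - 1)"

definition flip :: "'i \<Rightarrow> 'i set \<Rightarrow> 'i set" where
  "flip k A = (if k \<in> A then A - {k} else insert k A)"

lemma sign_of_square [simp]: "(sign_of A k)\<^sup>2 = 1"
  by (simp add: sign_of_def)

lemma abs_sign_of [simp]: "\<bar>sign_of A k\<bar> = 1"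
  by (simp add: sign_of_def)

lemma sign_of_flip: "sign_of (flip k A) l = (if l = k then - sign_of A l else sign_of A l)"
proof (cases "l = k")
  case True
  then show ?thesis by (simp add: sign_of_def flip_def)
next
  case False
  then have "l \<in> flip k A \<longleftrightarrow> l \<in> A" by (simp add: flip_def)
  with False show ?thesis by (simp add: sign_of_def)
qed

lemma sum_Pow_flip:
  assumes "k \<in> I"
  shows "(\<Sum>A\<in>Pow I. f (flip k A)) = (\<Sum>A\<in>Pow I. f A)"
proof (rule sum.reindex_bij_witness[of _ "flip k" "flip k"])
  have inv: "flip k (flip k A) = A" for A :: "'a set"
    by (auto simp: flip_def)
  fix A assume "A \<in> Pow I"
  then show "flip k A \<in> Pow I" using assms by (auto simp: flip_def)
  then show "flip k A \<in> Pow I" .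
qed (auto simp: flip_def)

text \<open>Expansion of the product over k of e^(t b) + e^(-t b), where b is the sign of
  \<open>B\<close> at k. Each factor is even in b, so \<open>B\<close> drops out.\<close>

lemma sum_Pow_exp_sign:
  fixes t :: real
  assumes I: "finite I"
  shows "(\<Sum>A\<in>Pow I. exp (\<Sum>k\<in>I. t * sign_of A k * sign_of B k)) = (exp t + exp (- t)) ^ card I"
proof -
  have "(exp t + exp (- t)) ^ card I = (\<Prod>k\<in>I. exp (t * sign_of B k) + exp (- (t * sign_of B k)))"
    by (simp flip: prod_constant) (intro prod.cong, auto simp: sign_of_def)
  also have "\<dots> = (\<Sum>A\<in>Pow I. (\<Prod>k\<in>A. exp (t * sign_of B k)) * (\<Prod>k\<in>I-A. exp (- (t * sign_of B k))))"
    by (rule prod_add[OF I])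
  also have "\<dots> = (\<Sum>A\<in>Pow I. exp (\<Sum>k\<in>I. t * sign_of A k * sign_of B k))"
  proof (rule sum.cong[OF refl])
    fix A assume "A \<in> Pow I"
    then have A: "A \<subseteq> I" "finite A" using I finite_subset by auto
    have "(\<Sum>k\<in>I. t * sign_of A k * sign_of B k)
        = (\<Sum>k\<in>I-A. t * sign_of A k * sign_of B k) + (\<Sum>k\<in>A. t * sign_of A k * sign_of B k)"
      by (rule sum.subset_diff[OF A(1) I])
    also have "\<dots> = (\<Sum>k\<in>A. t * sign_of B k) + (\<Sum>k\<in>I-A. - (t * sign_of B k))"
      by (simp add: sign_of_def)
    finally show "(\<Prod>k\<in>A. exp (t * sign_of B k)) * (\<Prod>k\<in>I-A. exp (- (t * sign_of B k)))
        = exp (\<Sum>k\<in>I. t * sign_of A k * sign_of B k)"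
      using I A by (simp add: exp_add exp_sum)
  qed
  finally show ?thesis by simp
qed

text \<open>cosh t \<le> 1 + t^2 \<le> exp (t^2), so the power is at most exp (d t^2); d t^2 \<le> 1
  turns the quadratic Taylor bound for this into a linear one.\<close>

lemma cosh_pow_le:
  fixes t :: real
  assumes t: "0 \<le> t" "t \<le> 1" and d: "real d * t\<^sup>2 \<le> 1"
  shows "((exp t + exp (- t)) / 2) ^ d \<le> 1 + 2 * real d * t\<^sup>2"
proof -
  have "exp (- t) \<le> 1 - t + t\<^sup>2"
  proof -
    have "exp (- t) * (1 + t) \<le> exp (- t) * exp t"
      by (intro mult_left_mono exp_ge_add_one_self) simp
    also have "\<dots> = 1" by (simp flip: exp_add)
    also have "1 \<le> (1 - t + t\<^sup>2) * (1 + t)"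
      using t by (simp add: algebra_simps power2_eq_square)
    finally show ?thesis using t by (simp add: mult_le_cancel_right)
  qed
  with exp_bound[OF t] have "(exp t + exp (- t)) / 2 \<le> 1 + t\<^sup>2" by simp
  also have "\<dots> \<le> exp (t\<^sup>2)" by (rule exp_ge_add_one_self)
  finally have "((exp t + exp (- t)) / 2) ^ d \<le> exp (t\<^sup>2) ^ d"
    by (intro power_mono) (auto simp: add_nonneg_nonneg)
  also have "\<dots> = exp (real d * t\<^sup>2)" by (simp add: exp_of_nat_mult)
  also have "\<dots> \<le> 1 + real d * t\<^sup>2 + (real d * t\<^sup>2)\<^sup>2"
    using d by (intro exp_bound) auto
  also have "(real d * t\<^sup>2)\<^sup>2 \<le> real d * t\<^sup>2"
    unfolding power2_eq_square[of "real d * t\<^sup>2"] using d by (intro mult_left_le) auto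
  finally show ?thesis by simp
qed

section \<open>Sign vectors, their mixture and its effect on message lengths\<close>

context gaussian_family
begin

text \<open>Density of the data under the signal with coordinates \<open>c\<close>, in units of the
  noise level, relative to no signal.\<close>

definition tilt :: "('i \<Rightarrow> real) \<Rightarrow> 'a \<Rightarrow> real" where
  "tilt c w = exp ((\<Sum>i\<in>I. c i * \<xi> i w) - (\<Sum>i\<in>I. (c i)\<^sup>2) / 2)"

lemma measurable_tilt [measurable]: "tilt c \<in> borel_measurable M"
  unfolding tilt_def[abs_def] by measurable

lemma tilt_nonneg: "0 \<le> tilt c w"
  by (simp add: tilt_def)

lemma integrable_tilt: "integrable M (tilt c)"
  and integral_tilt: "(\<integral>w. tilt c w \<partial>M) = 1"
  using has_bochner_integral_exp_lin[of c] by (auto simp: has_bochner_integral_iff tilt_def[abs_def])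

lemma prob_space_tilt: "prob_space (density M (\<lambda>w. ennreal (tilt c w)))"
  using shifted_gaussian_family[of c] unfolding tilt_def gaussian_family_def by simp

lemma tilt_mult: "tilt c w * tilt c' w = exp (\<Sum>i\<in>I. c i * c' i) * tilt (\<lambda>i. c i + c' i) w"
proof -
  have "(\<Sum>i\<in>I. c i * \<xi> i w) - (\<Sum>i\<in>I. (c i)\<^sup>2) / 2 + ((\<Sum>i\<in>I. c' i * \<xi> i w) - (\<Sum>i\<in>I. (c' i)\<^sup>2) / 2)
      = (\<Sum>i\<in>I. c i * c' i) + ((\<Sum>i\<in>I. (c i + c' i) * \<xi> i w) - (\<Sum>i\<in>I. (c i + c' i)\<^sup>2) / 2)"
    unfolding sum_divide_distrib sum_subtractf[symmetric] sum.distrib[symmetric]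
    by (intro sum.cong) (auto simp: power2_eq_square field_simps)
  then show ?thesis by (simp add: tilt_def flip: exp_add)
qed

abbreviation sign_tilt :: "real \<Rightarrow> 'i set \<Rightarrow> 'a \<Rightarrow> real" where
  "sign_tilt a A \<equiv> tilt (\<lambda>i. a * sign_of A i)"

text \<open>Seen from the signal of \<open>A\<close>, flipping sign \<open>k\<close> shifts
  coordinate \<open>k\<close> alone, by -2 a times its sign, and leaves the norm of the signal
  unchanged.\<close>

lemma sign_tilt_flip:
  assumes k: "k \<in> I"
  shows "sign_tilt a (flip k A) w
    = sign_tilt a A w * exp (- 2 * a * sign_of A k * (\<xi> k w - a * sign_of A k) - (- 2 * a * sign_of A k)\<^sup>2 / 2)"
proof -
  have "(\<Sum>i\<in>I. a * sign_of (flip k A) i * \<xi> i w) = (\<Sum>i\<in>I. a * sign_of A i * \<xi> i w) - 2 * a * sign_of A k * \<xi> k w"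
  proof -
    have "(\<Sum>i\<in>I. a * sign_of (flip k A) i * \<xi> i w) = (\<Sum>i\<in>I. a * sign_of A i * \<xi> i w - (if i = k then 2 * a * sign_of A k * \<xi> k w else 0))"
      by (intro sum.cong) (auto simp: sign_of_flip)
    then show ?thesis using k finite_I by (simp add: sum_subtractf)
  qed
  moreover have "- 2 * a * sign_of A k * (\<xi> k w - a * sign_of A k) - (- 2 * a * sign_of A k)\<^sup>2 / 2 = - 2 * a * sign_of A k * \<xi> k w"
    by (simp add: power2_eq_square algebra_simps)
  ultimately show ?thesis
    unfolding tilt_def by (simp add: power_mult_distrib flip: exp_add)
qed

text \<open>The mixed moment of the densities of \<open>A\<close> and \<open>B\<close> is exp of a^2
  times the scalar product of the sign vectors. Its sum over \<open>B\<close> does not depend on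
  \<open>A\<close>, which leaves a power of cosh (a^2).\<close>

lemma mixture_second_moment:
  defines "Z \<equiv> \<lambda>a w. (\<Sum>A\<in>Pow I. sign_tilt a A w) / 2 ^ card I"
  shows "integrable M (\<lambda>w. (Z a w)\<^sup>2)"
    and "(\<integral>w. (Z a w)\<^sup>2 \<partial>M) = ((exp (a\<^sup>2) + exp (- a\<^sup>2)) / 2) ^ card I"
    and "integrable M (Z a)" and "(\<integral>w. Z a w \<partial>M) = 1"
proof -
  let ?N = "(2::real) ^ card I"
  have card: "real (card (Pow I)) = ?N" using finite_I by (simp add: card_Pow)
  have sq: "(Z a w)\<^sup>2 = (\<Sum>A\<in>Pow I. \<Sum>B\<in>Pow I. exp (\<Sum>i\<in>I. a\<^sup>2 * sign_of A i * sign_of B i) / ?N\<^sup>2 *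
      tilt (\<lambda>i. a * sign_of A i + a * sign_of B i) w)" for w
  proof -
    have "sign_tilt a A w * sign_tilt a B w = exp (\<Sum>i\<in>I. a\<^sup>2 * sign_of A i * sign_of B i) *
        tilt (\<lambda>i. a * sign_of A i + a * sign_of B i) w" for A B
      unfolding tilt_mult by (simp add: power2_eq_square mult.assoc mult.left_commute)
    then have "(\<Sum>A\<in>Pow I. sign_tilt a A w)\<^sup>2 = (\<Sum>A\<in>Pow I. \<Sum>B\<in>Pow I. exp (\<Sum>i\<in>I. a\<^sup>2 * sign_of A i * sign_of B i) *
        tilt (\<lambda>i. a * sign_of A i + a * sign_of B i) w)"
      unfolding power2_eq_square[of "sum _ _"] sum_product by simp
    then show ?thesis
      unfolding Z_def power_divide by (simp only: sum_divide_distrib times_divide_eq_left)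
  qed
  show "integrable M (\<lambda>w. (Z a w)\<^sup>2)"
    unfolding sq by (intro Bochner_Integration.integrable_sum integrable_mult_right integrable_tilt)
  have "(\<integral>w. (Z a w)\<^sup>2 \<partial>M) = (\<Sum>A\<in>Pow I. \<Sum>B\<in>Pow I. exp (\<Sum>i\<in>I. a\<^sup>2 * sign_of A i * sign_of B i) / ?N\<^sup>2)"
    unfolding sq
    by (simp add: Bochner_Integration.integral_sum integrable_tilt Bochner_Integration.integrable_sum integral_tilt)
  also have "\<dots> = (\<Sum>A\<in>Pow I. (\<Sum>B\<in>Pow I. exp (\<Sum>i\<in>I. a\<^sup>2 * sign_of B i * sign_of A i)) / ?N\<^sup>2)"
  proof -
    have "(\<Sum>i\<in>I. a\<^sup>2 * sign_of A i * sign_of B i) = (\<Sum>i\<in>I. a\<^sup>2 * sign_of B i * sign_of A i)" for A B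
      by (simp only: mult.assoc mult.commute[of "sign_of A _"])
    then show ?thesis unfolding sum_divide_distrib
      by (intro sum.cong refl arg_cong2[where f = "(/)"] arg_cong[where f = exp]) simp
  qed
  also have "\<dots> = (\<Sum>A\<in>Pow I. (exp (a\<^sup>2) + exp (- a\<^sup>2)) ^ card I / ?N\<^sup>2)"
    by (simp only: sum_Pow_exp_sign[OF finite_I])
  also have "\<dots> = ((exp (a\<^sup>2) + exp (- a\<^sup>2)) / 2) ^ card I"
    by (simp add: card power_divide power2_eq_square)
  finally show "(\<integral>w. (Z a w)\<^sup>2 \<partial>M) = ((exp (a\<^sup>2) + exp (- a\<^sup>2)) / 2) ^ card I" .
  show "integrable M (Z a)" unfolding Z_def by (simp add: integrable_tilt)
  show "(\<integral>w. Z a w \<partial>M) = 1"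
    unfolding Z_def by (simp add: integrable_tilt integral_tilt card)
qed

text \<open>Averaging over sign vectors replaces their densities by the mixture \<open>Z\<close>,
  integrated against the conditional mean length \<open>h\<close> given the data. As h \<le> B, the
  change against zero signal is at most \<open>B\<close> times the integral of |Z - 1|, and this is
  at most the square root of the chi-square distance of the mixture.\<close>

lemma average_length_le:
  assumes K: "K \<in> M \<rightarrow>\<^sub>M prob_algebra (count_space (UNIV :: bool list set))"
    and B: "AE y in M \<bind> K. real (length y) \<le> B" and B0: "0 \<le> B"
    and len: "(\<integral>\<^sup>+y. of_nat (length y) \<partial>(M \<bind> K)) \<le> ennreal l" and l0: "0 \<le> l"
    and a: "a\<^sup>2 \<le> 1" "real (card I) * a^4 \<le> 1"
  shows "(\<Sum>A\<in>Pow I. \<integral>\<^sup>+y. of_nat (length y) \<partial>(density M (\<lambda>w. ennreal (sign_tilt a A w)) \<bind> K))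
    \<le> ennreal (2 ^ card I * (l + B * (sqrt (2 * real (card I)) * a\<^sup>2)))"
proof -
  note Ksub = measurable_prob_algebraD[OF K]
  define h where "h w = (\<integral>\<^sup>+y. of_nat (length y) \<partial>K w)" for w
  have [measurable]: "h \<in> borel_measurable M"
    unfolding h_def[abs_def] by (rule measurable_compose[OF Ksub nn_integral_measurable_subprob_algebra]) simp
  \<comment> \<open>The cap under zero signal passes to almost every \<open>w\<close>; since all
    tilted measures are densities over \<open>M\<close>, it also serves under the mixture.\<close>
  have "AE w in M. AE y in K w. real (length y) \<le> B"
    using B by (subst (asm) AE_bind[OF Ksub]) auto
  then have hB: "AE w in M. h w \<le> ennreal B"
    using AE_space
  proof eventually_elim
    case (elim w)
    then interpret Kw: prob_space "K w" using measurable_space[OF K elim(2)] by (simp add: space_prob_algebra)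
    have "h w \<le> (\<integral>\<^sup>+y. ennreal B \<partial>K w)"
      unfolding h_def by (intro nn_integral_mono_AE) (use elim(1) in \<open>auto simp: ennreal_of_nat_eq_real_of_nat elim!: eventually_mono intro: ennreal_leI\<close>)
    then show ?case by (simp add: Kw.emeasure_space_1)
  qed
  define hr where "hr w = enn2real (h w)" for w
  have [measurable]: "hr \<in> borel_measurable M" unfolding hr_def[abs_def] by measurable
  have hr: "AE w in M. h w = ennreal (hr w)"
    using hB by eventually_elim (metis ennreal_enn2real hr_def le_less_trans ennreal_less_top)
  have hr0: "0 \<le> hr w" for w by (simp add: hr_def)
  have hrB: "AE w in M. hr w \<le> B"
    using hB by eventually_elim (use B0 in \<open>simp add: hr_def enn2real_leI\<close>)
  have ihr: "integrable M hr"
    by (rule integrable_const_bound[of _ B]) (use hrB hr0 in \<open>auto elim: eventually_mono\<close>)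
  have tot: "(\<integral>w. hr w \<partial>M) \<le> l"
  proof -
    have "ennreal (\<integral>w. hr w \<partial>M) = (\<integral>\<^sup>+w. ennreal (hr w) \<partial>M)"
      using ihr hr0 by (intro nn_integral_eq_integral[symmetric]) auto
    also have "\<dots> = (\<integral>\<^sup>+w. h w \<partial>M)" using hr by (intro nn_integral_cong_AE) (auto elim: eventually_mono)
    also have "\<dots> = (\<integral>\<^sup>+y. of_nat (length y) \<partial>(M \<bind> K))"
      unfolding h_def by (rule nn_integral_bind[OF _ Ksub, symmetric]) simp
    finally show ?thesis using len l0 by (metis ennreal_le_iff)
  qed
  define Z where "Z w = (\<Sum>A\<in>Pow I. sign_tilt a A w) / 2 ^ card I" for w
  note Z2 = mixture_second_moment(1)[of a, folded Z_def] and Z2e = mixture_second_moment(2)[of a, folded Z_def]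
    and Z1 = mixture_second_moment(3)[of a, folded Z_def] and Z1e = mixture_second_moment(4)[of a, folded Z_def]
  have [measurable]: "Z \<in> borel_measurable M" using Z1 by simp
  have Z0: "0 \<le> Z w" for w unfolding Z_def by (simp add: sum_nonneg tilt_nonneg)
  have iZ: "integrable M (\<lambda>w. (Z w - 1)\<^sup>2)"
    by (intro integrable_square_diff Z2) auto
  have "(\<integral>w. (Z w - 1)\<^sup>2 \<partial>M) = (\<integral>w. (Z w)\<^sup>2 - 2 * Z w + 1 \<partial>M)"
    by (intro Bochner_Integration.integral_cong) (auto simp: power2_eq_square algebra_simps)
  also have "\<dots> = (\<integral>w. (Z w)\<^sup>2 \<partial>M) - 1"
    using Z2 Z1 Z1e by (simp add: prob_space)
  also have "\<dots> \<le> 2 * real (card I) * (a\<^sup>2)\<^sup>2"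
    unfolding Z2e using cosh_pow_le[of "a\<^sup>2" "card I"] a by (simp flip: power_mult)
  finally have "(\<integral>w. (Z w - 1)\<^sup>2 \<partial>M) \<le> 2 * real (card I) * (a\<^sup>2)\<^sup>2" .
  then have "sqrt (\<integral>w. (Z w - 1)\<^sup>2 \<partial>M) \<le> sqrt (2 * real (card I) * (a\<^sup>2)\<^sup>2)"
    by (rule real_sqrt_le_mono)
  then have "sqrt (\<integral>w. (Z w - 1)\<^sup>2 \<partial>M) \<le> sqrt (2 * real (card I)) * a\<^sup>2"
    unfolding real_sqrt_mult[of _ "(a\<^sup>2)\<^sup>2"] real_sqrt_abs by simp
  then have dev: "(\<integral>w. \<bar>Z w - 1\<bar> \<partial>M) \<le> sqrt (2 * real (card I)) * a\<^sup>2"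
    using integral_abs_le_sqrt[of "\<lambda>w. Z w - 1"] iZ by (simp add: prob_space)
  have iZh: "integrable M (\<lambda>w. Z w * hr w)"
  proof (rule Bochner_Integration.integrable_bound)
    show "integrable M (\<lambda>w. B * Z w)" using Z1 by simp
    show "AE w in M. norm (Z w * hr w) \<le> norm (B * Z w)"
      using hrB by eventually_elim (use hr0 Z0 B0 in \<open>simp add: abs_mult mult.commute[of B] mult_left_mono\<close>)
  qed simp
  have "(\<integral>w. Z w * hr w \<partial>M) \<le> (\<integral>w. hr w + B * \<bar>Z w - 1\<bar> \<partial>M)"
  proof (rule integral_mono_AE[OF iZh])
    show "integrable M (\<lambda>w. hr w + B * \<bar>Z w - 1\<bar>)" using ihr Z1 by simp
    show "AE w in M. Z w * hr w \<le> hr w + B * \<bar>Z w - 1\<bar>"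
      using hrB
    proof eventually_elim
      case (elim w)
      have "Z w * hr w = hr w + (Z w - 1) * hr w" by (simp add: algebra_simps)
      also have "(Z w - 1) * hr w \<le> \<bar>Z w - 1\<bar> * B"
        using elim hr0[of w] by (intro mult_mono) auto
      finally show ?case by (simp add: mult.commute)
    qed
  qed
  also have "\<dots> = (\<integral>w. hr w \<partial>M) + B * (\<integral>w. \<bar>Z w - 1\<bar> \<partial>M)"
    using ihr Z1 by simp
  also have "\<dots> \<le> l + B * (sqrt (2 * real (card I)) * a\<^sup>2)"
    using tot dev B0 by (intro add_mono mult_left_mono) auto
  finally have main: "(\<integral>w. Z w * hr w \<partial>M) \<le> l + B * (sqrt (2 * real (card I)) * a\<^sup>2)" .
  have "(\<Sum>A\<in>Pow I. \<integral>\<^sup>+y. of_nat (length y) \<partial>(density M (\<lambda>w. ennreal (sign_tilt a A w)) \<bind> K))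
      = (\<Sum>A\<in>Pow I. \<integral>\<^sup>+w. ennreal (sign_tilt a A w) * h w \<partial>M)"
  proof (rule sum.cong[OF refl])
    fix A
    have Ksub': "K \<in> density M (\<lambda>w. ennreal (sign_tilt a A w)) \<rightarrow>\<^sub>M subprob_algebra (count_space UNIV)"
      using Ksub by simp
    show "(\<integral>\<^sup>+y. of_nat (length y) \<partial>(density M (\<lambda>w. ennreal (sign_tilt a A w)) \<bind> K))
      = (\<integral>\<^sup>+w. ennreal (sign_tilt a A w) * h w \<partial>M)"
      unfolding nn_integral_bind[OF borel_measurable_count_space Ksub'] h_def[symmetric]
      by (rule nn_integral_density) auto
  qed
  also have "\<dots> = (\<integral>\<^sup>+w. (\<Sum>A\<in>Pow I. ennreal (sign_tilt a A w)) * h w \<partial>M)"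
    by (simp add: sum_distrib_right nn_integral_sum)
  also have "\<dots> = (\<integral>\<^sup>+w. ennreal (2 ^ card I * (Z w * hr w)) \<partial>M)"
  proof (rule nn_integral_cong_AE, use hr in eventually_elim)
    fix w assume w: "h w = ennreal (hr w)"
    have "(\<Sum>A\<in>Pow I. ennreal (sign_tilt a A w)) = ennreal (2 ^ card I * Z w)"
      by (subst sum_ennreal) (auto simp: tilt_nonneg Z_def)
    then show "(\<Sum>A\<in>Pow I. ennreal (sign_tilt a A w)) * h w = ennreal (2 ^ card I * (Z w * hr w))"
      using Z0[of w] hr0[of w] w by (simp add: mult.assoc[symmetric] flip: ennreal_mult)
  qed
  also have "\<dots> = ennreal (\<integral>w. 2 ^ card I * (Z w * hr w) \<partial>M)"
    using iZh Z0 hr0 by (intro nn_integral_eq_integral) auto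
  also have "\<dots> \<le> ennreal (2 ^ card I * (l + B * (sqrt (2 * real (card I)) * a\<^sup>2)))"
    using main by (intro ennreal_leI) simp
  finally show ?thesis .
qed

text \<open>The base point is the signal of \<open>A\<close>, from which a flip is a shift by 2 a in
  one coordinate. With \<beta> = 2 a, the condition \<beta> \<le> 1 reads a \<le> 1/2, and the
  constants become 16 = 4 * 2^2 and 576 = 36 * 2^4.\<close>

lemma sign_flip_lik_ratio:
  assumes K: "K \<in> M \<rightarrow>\<^sub>M prob_algebra (count_space (UNIV :: bool list set))"
    and a: "0 \<le> a" "a \<le> 1/2"
    and len: "(\<integral>\<^sup>+y. of_nat (length y) \<partial>(density M (\<lambda>w. ennreal (sign_tilt a A w)) \<bind> K)) \<le> ennreal l" and l: "0 \<le> l"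
  obtains L :: "'i \<Rightarrow> bool list \<Rightarrow> real" where "\<And>k y. k \<in> I \<Longrightarrow> 0 \<le> L k y"
    "\<And>k. k \<in> I \<Longrightarrow> density M (\<lambda>w. ennreal (sign_tilt a (flip k A) w)) \<bind> K
        = density (density M (\<lambda>w. ennreal (sign_tilt a A w)) \<bind> K) (\<lambda>y. ennreal (L k y))"
    "(\<Sum>k\<in>I. \<integral>\<^sup>+y. ennreal ((L k y - 1)\<^sup>2) \<partial>(density M (\<lambda>w. ennreal (sign_tilt a A w)) \<bind> K))
      \<le> ennreal (16 * a\<^sup>2 * (ln 4 * l + ln 2) + 576 * exp 8 * real (card I) * a^4)"
proof -
  let ?c = "\<lambda>i. a * sign_of A i"
  let ?M = "density M (\<lambda>w. ennreal (sign_tilt a A w))"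
  let ?b = "\<lambda>k. - 2 * a * sign_of A k"
  have G: "gaussian_family ?M I (\<lambda>i w. \<xi> i w - ?c i)"
    unfolding tilt_def by (rule shifted_gaussian_family)
  have K': "K \<in> ?M \<rightarrow>\<^sub>M prob_algebra (count_space UNIV)" using K by simp
  have b: "\<bar>?b k\<bar> = 2 * a" for k using a by (simp add: abs_mult)
  from message_lik_ratio[where b = ?b and \<beta> = "2 * a", OF G K' b _ _ len l] a obtain L :: "'i \<Rightarrow> bool list \<Rightarrow> real"
    where L: "\<And>k y. k \<in> I \<Longrightarrow> 0 \<le> L k y"
    "\<And>k. k \<in> I \<Longrightarrow> density ?M (\<lambda>w. ennreal (exp (?b k * (\<xi> k w - ?c k) - (?b k)\<^sup>2 / 2))) \<bind> K
        = density (?M \<bind> K) (\<lambda>y. ennreal (L k y))"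
    "(\<Sum>k\<in>I. \<integral>\<^sup>+y. ennreal ((L k y - 1)\<^sup>2) \<partial>(?M \<bind> K))
      \<le> ennreal (4 * (2 * a)\<^sup>2 * (ln 4 * l + ln 2) + 36 * exp 8 * real (card I) * (2 * a)^4)"
    by auto
  have dens: "density ?M (\<lambda>w. ennreal (exp (?b k * (\<xi> k w - ?c k) - (?b k)\<^sup>2 / 2)))
      = density M (\<lambda>w. ennreal (sign_tilt a (flip k A) w))" if k: "k \<in> I" for k
  proof -
    have "(\<lambda>w. ennreal (exp (?b k * (\<xi> k w - ?c k) - (?b k)\<^sup>2 / 2))) \<in> borel_measurable M"
      using k by measurable
    then show ?thesis
      by (subst density_density_eq) (auto simp: sign_tilt_flip[OF k] ennreal_mult tilt_nonneg)
  qed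
  show thesis
  proof (rule that[OF L(1)])
    show "density M (\<lambda>w. ennreal (sign_tilt a (flip k A) w)) \<bind> K = density (?M \<bind> K) (\<lambda>y. ennreal (L k y))"
      if "k \<in> I" for k
      using L(2)[OF that] unfolding dens[OF that] .
    show "(\<Sum>k\<in>I. \<integral>\<^sup>+y. ennreal ((L k y - 1)\<^sup>2) \<partial>(?M \<bind> K))
      \<le> ennreal (16 * a\<^sup>2 * (ln 4 * l + ln 2) + 576 * exp 8 * real (card I) * a^4)"
      using L(3) by (simp add: power_mult_distrib mult.assoc)
  qed
qed

end

section \<open>The lower bound for a fixed sample size\<close>

lemma Bessel_le:
  assumes I: "finite I" and psi: "\<And>i. i \<in> I \<Longrightarrow> \<psi> i \<in> L2_unit"
    and orth: "\<And>i j. i \<in> I \<Longrightarrow> j \<in> I \<Longrightarrow> L2_inner (\<psi> i) (\<psi> j) = (if i = j then 1 else 0)"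
    and h: "h \<in> L2_unit"
  shows "(\<Sum>i\<in>I. (L2_inner h (\<psi> i))\<^sup>2) \<le> L2_inner h h"
proof -
  let ?p = "\<lambda>x. \<Sum>i\<in>I. L2_inner h (\<psi> i) * \<psi> i x"
  have p: "?p \<in> L2_unit" by (intro L2_unit_sum psi)
  have "L2_inner ?p h = (\<Sum>i\<in>I. L2_inner h (\<psi> i) * L2_inner (\<psi> i) h)"
    by (rule L2_inner_sum_left[OF psi h])
  also have "\<dots> = (\<Sum>i\<in>I. (L2_inner h (\<psi> i))\<^sup>2)"
    by (simp add: L2_inner_commute[of _ h] power2_eq_square)
  finally have "0 \<le> L2_inner h h - 2 * (\<Sum>i\<in>I. (L2_inner h (\<psi> i))\<^sup>2) + L2_inner ?p ?p"
    using L2_inner_self_diff[OF h p] L2_inner_self_nonneg[of "\<lambda>x. h x - ?p x"] by simp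
  moreover have "L2_inner ?p ?p = (\<Sum>i\<in>I. (L2_inner h (\<psi> i))\<^sup>2)"
    by (rule L2_inner_self_sum[OF I psi orth])
  ultimately show ?thesis by simp
qed

lemma L2_norm_sq_eq: "h \<in> L2_unit \<Longrightarrow> L2_norm_sq h = ennreal (L2_inner h h)"
  unfolding L2_norm_sq_def L2_inner_self by (intro nn_integral_eq_integral L2_unit_integrable_square) auto

text \<open>Rescaling of paths is absorbed into the kernels, so the message laws of all sign vectors
  come from densities over one Wiener measure sent through the same \<open>K'\<close>.\<close>

lemma message_law_sign:
  assumes W: "wiener_measure \<W>" and I: "finite I" and psi: "\<And>i. i \<in> I \<Longrightarrow> \<psi> i \<in> L2_unit"
    and orth: "\<And>i j. i \<in> I \<Longrightarrow> j \<in> I \<Longrightarrow> L2_inner (\<psi> i) (\<psi> j) = (if i = j then 1 else 0)"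
    and K: "\<And>i. i \<in> {1..m} \<Longrightarrow> K i \<in> path_space \<rightarrow>\<^sub>M prob_algebra (count_space UNIV)"
  obtains \<xi> K' where "gaussian_family \<W> I \<xi>"
    "\<And>i. i \<in> {1..m} \<Longrightarrow> K' i \<in> \<W> \<rightarrow>\<^sub>M prob_algebra (count_space UNIV)"
    "\<And>a A i. i \<in> {1..m} \<Longrightarrow> message_law \<W> n m K (\<lambda>x. \<Sum>k\<in>I. (sqrt (real m / real n) * (a * sign_of A k)) * \<psi> k x) i
      = density \<W> (\<lambda>w. ennreal (gaussian_family.tilt I \<xi> (\<lambda>k. a * sign_of A k) w)) \<bind> K' i"
    "\<And>i. i \<in> {1..m} \<Longrightarrow> message_law \<W> n m K (\<lambda>x. 0) i = \<W> \<bind> K' i"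
proof -
  let ?s = "sqrt (real m / real n)"
  interpret prob_space \<W> by (rule wiener_measure_prob_space[OF W])
  obtain \<xi> where xi: "\<And>i. i \<in> I \<Longrightarrow> \<xi> i \<in> borel_measurable \<W>"
    and law: "\<And>\<sigma> c. white_noise_law \<W> \<sigma> (\<lambda>x. \<Sum>i\<in>I. (\<sigma> * c i) * \<psi> i x)
      = distr (density \<W> (\<lambda>w. ennreal (exp ((\<Sum>i\<in>I. c i * \<xi> i w) - (\<Sum>i\<in>I. (c i)\<^sup>2) / 2)))) path_space (scale_path \<sigma>)"
    by (rule white_noise_law_density[OF W I psi orth]; (assumption | (rule that; simp)))
  have sc: "scale_path \<sigma> \<in> density \<W> f \<rightarrow>\<^sub>M path_space" for \<sigma> f
    using measurable_scale_path by (simp add: measurable_cong_sets[OF wiener_measure_sets[OF W] refl])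
  have G: "gaussian_family \<W> I \<xi>"
  proof
    fix c
    let ?D = "\<lambda>w. ennreal (exp ((\<Sum>i\<in>I. c i * \<xi> i w) - (\<Sum>i\<in>I. (c i)\<^sup>2) / 2))"
    have [measurable]: "(\<lambda>w. \<Sum>i\<in>I. c i * \<xi> i w) \<in> borel_measurable \<W>"
      using xi by (intro borel_measurable_sum borel_measurable_times) auto
    \<comment> \<open>At noise level 1, the total mass of the white noise law is exactly the
      exponential moment required of a Gaussian family.\<close>
    have "prob_space (distr (density \<W> ?D) path_space (scale_path 1))"
      unfolding law[symmetric] by (intro prob_space_white_noise_law[OF W] L2_unit_sum psi)
    from prob_space.emeasure_space_1[OF this]
    have "emeasure (distr (density \<W> ?D) path_space (scale_path 1)) (space path_space) = 1"
      unfolding space_distr .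
    also have "emeasure (distr (density \<W> ?D) path_space (scale_path 1)) (space path_space) = emeasure (density \<W> ?D) (space \<W>)"
    proof -
      have "scale_path 1 -` space path_space \<inter> space (density \<W> ?D) = space \<W>"
        using measurable_space[OF sc[of 1 ?D]] by auto
      then show ?thesis by (subst emeasure_distr[OF sc]) simp_all
    qed
    also have "\<dots> = (\<integral>\<^sup>+w. ?D w \<partial>\<W>)"
      by (subst emeasure_density) (auto cong: nn_integral_cong)
    finally show "(\<integral>\<^sup>+w. ?D w \<partial>\<W>) = 1" .
  qed (use I xi in auto)
  interpret gaussian_family \<W> I \<xi> by (rule G)
  define K' where "K' i w = K i (scale_path ?s w)" for i w
  have K': "K' i \<in> \<W> \<rightarrow>\<^sub>M prob_algebra (count_space UNIV)" if "i \<in> {1..m}" for i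
    unfolding K'_def[abs_def] using measurable_compose[OF measurable_scale_path K[OF that]]
    by (simp add: measurable_cong_sets[OF wiener_measure_sets[OF W] refl])
  have bd: "message_law \<W> n m K (\<lambda>x. \<Sum>k\<in>I. (?s * c k) * \<psi> k x) i = density \<W> (\<lambda>w. ennreal (tilt c w)) \<bind> K' i"
    if i: "i \<in> {1..m}" for c i
    unfolding message_law_def law K'_def tilt_def
    by (rule bind_distr[OF sc measurable_prob_algebraD[OF K[OF i]]]) (simp add: not_empty)
  show thesis
  proof (rule that[OF G K'])
    show "message_law \<W> n m K (\<lambda>x. \<Sum>k\<in>I. (?s * (a * sign_of A k)) * \<psi> k x) i
      = density \<W> (\<lambda>w. ennreal (tilt (\<lambda>k. a * sign_of A k) w)) \<bind> K' i" if "i \<in> {1..m}" for a A i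
      by (rule bd[OF that])
    have "density \<W> (\<lambda>w. ennreal (tilt (\<lambda>_. 0) w)) = \<W>"
      by (simp add: tilt_def density_1)
    then show "message_law \<W> n m K (\<lambda>x. 0) i = \<W> \<bind> K' i" if "i \<in> {1..m}" for i
      using bd[OF that, of "\<lambda>_. 0"] by simp
  qed
qed

text \<open>Assouad's argument: two sign vectors that differ at \<open>k\<close> give a two-point
  bound for coordinate \<open>k\<close>, and summed over \<open>A\<close> the flipped risks are a
  rearrangement of the original ones. The chi-square bounds are linear in the mean lengths, so only
  their average over \<open>A\<close> enters. \<open>s * a\<close> is the size of the wavelet
  coefficients and \<open>a\<close> the same in units of the noise level.\<close>

lemma risk_lower_bound:
  fixes \<psi> :: "'i \<Rightarrow> real \<Rightarrow> real" and n m :: nat and I :: "'i set"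
  defines "s \<equiv> sqrt (real m / real n)"
  defines "f \<equiv> \<lambda>a A x. \<Sum>k\<in>I. (s * (a * sign_of A k)) * \<psi> k x"
  assumes W: "wiener_measure \<W>" and I: "finite I" and psi: "\<And>i. i \<in> I \<Longrightarrow> \<psi> i \<in> L2_unit"
    and orth: "\<And>i j. i \<in> I \<Longrightarrow> j \<in> I \<Longrightarrow> L2_inner (\<psi> i) (\<psi> j) = (if i = j then 1 else 0)"
    and est: "distributed_estimator m K F"
    and a: "0 \<le> a" "a \<le> 1/2" "real (card I) * a^4 \<le> 1"
    and B0: "0 \<le> B" and l0: "0 \<le> l" and \<rho>0: "0 \<le> \<rho>"
    and B: "\<And>i. i \<in> {1..m} \<Longrightarrow> AE y in message_law \<W> n m K (\<lambda>x. 0) i. real (length y) \<le> B"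
    and len: "\<And>i. i \<in> {1..m} \<Longrightarrow> expected_bits \<W> n m K (\<lambda>x. 0) i \<le> ennreal l"
    and risk: "\<And>A. A \<subseteq> I \<Longrightarrow> risk \<W> n m K F (f a A) \<le> ennreal \<rho>"
  shows "(s * a)\<^sup>2 * (real (card I) - real m * (16 * a\<^sup>2 * (ln 4 * (l + B * (sqrt (2 * real (card I)) * a\<^sup>2)) + ln 2)
      + 576 * exp 8 * real (card I) * a^4)) \<le> \<rho>"
proof -
  have K: "\<And>i. i \<in> {1..m} \<Longrightarrow> K i \<in> path_space \<rightarrow>\<^sub>M prob_algebra (count_space UNIV)"
    and F: "\<And>y. y \<in> {1..m} \<rightarrow>\<^sub>E UNIV \<Longrightarrow> F y \<in> L2_unit"
    using est by (auto simp: distributed_estimator_def)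
  obtain \<xi> K' where G: "gaussian_family \<W> I \<xi>"
    and K': "\<And>i. i \<in> {1..m} \<Longrightarrow> K' i \<in> \<W> \<rightarrow>\<^sub>M prob_algebra (count_space UNIV)"
    and law: "\<And>a A i. i \<in> {1..m} \<Longrightarrow> message_law \<W> n m K (\<lambda>x. \<Sum>k\<in>I. (s * (a * sign_of A k)) * \<psi> k x) i
      = density \<W> (\<lambda>w. ennreal (gaussian_family.tilt I \<xi> (\<lambda>k. a * sign_of A k) w)) \<bind> K' i"
    and law0: "\<And>i. i \<in> {1..m} \<Longrightarrow> message_law \<W> n m K (\<lambda>x. 0) i = \<W> \<bind> K' i"
    by (rule message_law_sign[where n = n and m = m and K = K, OF W I psi orth K]; (assumption | (rule that; simp add: s_def)))
  interpret gaussian_family \<W> I \<xi> by (rule G)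
  let ?J = "{1..m}" and ?d = "card I" and ?N = "(2::real) ^ card I"
  let ?\<mu> = "\<lambda>A i. message_law \<W> n m K (f a A) i"
  have law': "?\<mu> A i = density \<W> (\<lambda>w. ennreal (sign_tilt a A w)) \<bind> K' i" if "i \<in> ?J" for A i
    unfolding f_def by (rule law[OF that])
  have fL: "f a A \<in> L2_unit" for A unfolding f_def by (intro L2_unit_sum psi)
  have Kt: "K' i \<in> density \<W> h \<rightarrow>\<^sub>M prob_algebra (count_space UNIV)" if "i \<in> ?J" for i h
    using K'[OF that] by simp
  have \<mu>p: "prob_space (?\<mu> A i)" and \<mu>s: "sets (?\<mu> A i) = UNIV" if "i \<in> ?J" for A i
    unfolding law'[OF that] using bind_message[OF prob_space_tilt Kt[OF that]] by auto
  let ?len = "\<lambda>A i. \<integral>\<^sup>+y. of_nat (length y) \<partial>?\<mu> A i"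
  define Lb where "Lb = l + B * (sqrt (2 * real ?d) * a\<^sup>2)"
  have Lb0: "0 \<le> Lb" unfolding Lb_def using l0 B0 by simp
  have a2: "a\<^sup>2 \<le> 1" using a by (simp add: power_le_one)
  have avg: "(\<Sum>A\<in>Pow I. ?len A i) \<le> ennreal (?N * Lb)" if i: "i \<in> ?J" for i
  proof -
    have "(\<Sum>A\<in>Pow I. ?len A i) = (\<Sum>A\<in>Pow I. \<integral>\<^sup>+y. of_nat (length y) \<partial>(density \<W> (\<lambda>w. ennreal (sign_tilt a A w)) \<bind> K' i))"
      by (simp add: law'[OF i])
    also have "\<dots> \<le> ennreal (?N * Lb)"
      unfolding Lb_def
      by (rule average_length_le[OF K'[OF i] B[OF i, unfolded law0[OF i]] B0
            len[OF i, unfolded expected_bits_def law0[OF i]] l0 a2 a(3)])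
    finally show ?thesis .
  qed
  \<comment> \<open>A finite sum over \<open>A\<close> makes each term finite, so the bookkeeping
    moves to the reals, where terms may be subtracted.\<close>
  define lr where "lr A i = enn2real (?len A i)" for A i
  have lr: "?len A i = ennreal (lr A i)" if "A \<in> Pow I" "i \<in> ?J" for A i
  proof -
    have "?len A i \<le> (\<Sum>A\<in>Pow I. ?len A i)"
      using I that by (intro member_le_sum) auto
    also have "\<dots> < \<infinity>" using avg[OF that(2)] by (simp add: le_less_trans)
    finally show ?thesis unfolding lr_def by simp
  qed
  have lr0: "0 \<le> lr A i" for A i by (simp add: lr_def)
  have lr_avg: "(\<Sum>A\<in>Pow I. lr A i) \<le> ?N * Lb" if i: "i \<in> ?J" for i
  proof -
    have "ennreal (\<Sum>A\<in>Pow I. lr A i) = (\<Sum>A\<in>Pow I. ?len A i)"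
      using lr0 by (simp add: lr[OF _ i] flip: sum_ennreal)
    also note avg[OF i]
    finally show ?thesis using Lb0 by (subst (asm) ennreal_le_iff) auto
  qed
  let ?b = "\<lambda>A i. 16 * a\<^sup>2 * (ln 4 * lr A i + ln 2) + 576 * exp 8 * real ?d * a^4"
  \<comment> \<open>The ratios depend on \<open>A\<close> and \<open>i\<close>; naming their
    properties allows a simultaneous choice for all pairs.\<close>
  define ratio where "ratio A i L \<longleftrightarrow> (\<forall>k\<in>I. \<forall>y. 0 \<le> L k y)
      \<and> (\<forall>k\<in>I. ?\<mu> (flip k A) i = density (?\<mu> A i) (\<lambda>y. ennreal (L k y)))
      \<and> (\<Sum>k\<in>I. \<integral>\<^sup>+y. ennreal ((L k y - 1)\<^sup>2) \<partial>?\<mu> A i) \<le> ennreal (?b A i)"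
    for A i and L :: "'i \<Rightarrow> bool list \<Rightarrow> real"
  have ex: "\<exists>L. ratio A i L" if A: "A \<in> Pow I" and i: "i \<in> ?J" for A i
  proof -
    have "(\<integral>\<^sup>+y. of_nat (length y) \<partial>(density \<W> (\<lambda>w. ennreal (sign_tilt a A w)) \<bind> K' i)) \<le> ennreal (lr A i)"
      using lr[OF A i] by (simp add: law'[OF i])
    then show ?thesis
      unfolding law'[OF i] ratio_def
      by (rule sign_flip_lik_ratio[OF K'[OF i] a(1,2) _ lr0]) (intro exI conjI ballI allI; assumption | blast)
  qed
  define L where "L A i = (SOME L. ratio A i L)" for A i
  have ratio: "ratio A i (L A i)" if "A \<in> Pow I" "i \<in> ?J" for A i
    unfolding L_def by (rule someI_ex[OF ex[OF that]])
  have L0: "0 \<le> L A i k y" if "A \<in> Pow I" "i \<in> ?J" "k \<in> I" for A i k y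
    using ratio[OF that(1,2)] that(3) unfolding ratio_def by blast
  have Ld: "?\<mu> (flip k A) i = density (?\<mu> A i) (\<lambda>y. ennreal (L A i k y))" if "A \<in> Pow I" "i \<in> ?J" "k \<in> I" for A i k
    using ratio[OF that(1,2)] that(3) unfolding ratio_def by blast
  have Ls: "(\<Sum>k\<in>I. \<integral>\<^sup>+y. ennreal ((L A i k y - 1)\<^sup>2) \<partial>?\<mu> A i) \<le> ennreal (?b A i)" if "A \<in> Pow I" "i \<in> ?J" for A i
    using ratio[OF that] unfolding ratio_def by blast
  let ?x = "\<lambda>A i k. \<integral>\<^sup>+y. ennreal ((L A i k y - 1)\<^sup>2) \<partial>?\<mu> A i"
  define x where "x A i k = enn2real (?x A i k)" for A i k
  have x0: "0 \<le> x A i k" for A i k by (simp add: x_def)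
  have x: "?x A i k = ennreal (x A i k)" if "A \<in> Pow I" "i \<in> ?J" "k \<in> I" for A i k
  proof -
    have "?x A i k \<le> (\<Sum>k\<in>I. ?x A i k)" using I that by (intro member_le_sum) auto
    also have "\<dots> < \<infinity>" using Ls[OF that(1,2)] by (simp add: le_less_trans)
    finally show ?thesis unfolding x_def by simp
  qed
  have xs: "(\<Sum>k\<in>I. x A i k) \<le> ?b A i" if "A \<in> Pow I" "i \<in> ?J" for A i
  proof -
    have b0: "0 \<le> ?b A i" using lr0 by simp
    have "ennreal (\<Sum>k\<in>I. x A i k) = (\<Sum>k\<in>I. ?x A i k)"
      using x0 by (simp add: x[OF that] flip: sum_ennreal)
    also note Ls[OF that]
    finally show ?thesis using b0 by (subst (asm) ennreal_le_iff) auto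
  qed
  let ?P = "\<lambda>A. Pi\<^sub>M ?J (?\<mu> A)"
  \<comment> \<open>Coordinatewise risk of the wavelet coefficients of the estimator; Bessel's
    inequality bounds the sum over \<open>k\<close> by the full risk.\<close>
  let ?R = "\<lambda>A k. \<integral>\<^sup>+y. ennreal ((L2_inner (F y) (\<psi> k) - s * a * sign_of A k)\<^sup>2) \<partial>?P A"
  have Rsum: "(\<Sum>k\<in>I. ?R A k) \<le> ennreal \<rho>" if A: "A \<in> Pow I" for A
  proof -
    have "(\<Sum>k\<in>I. ?R A k) = (\<integral>\<^sup>+y. (\<Sum>k\<in>I. ennreal ((L2_inner (F y) (\<psi> k) - s * a * sign_of A k)\<^sup>2)) \<partial>?P A)"
      by (rule nn_integral_sum[symmetric]) (rule measurable_PiM_countable, auto simp: \<mu>s)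
    also have "\<dots> \<le> (\<integral>\<^sup>+y. L2_norm_sq (\<lambda>t. F y t - f a A t) \<partial>?P A)"
    proof (rule nn_integral_mono)
      fix y assume "y \<in> space (?P A)"
      then have "y \<in> ?J \<rightarrow>\<^sub>E UNIV" by (auto simp: space_PiM PiE_iff)
      then have Fy: "F y \<in> L2_unit" by (rule F)
      have h: "(\<lambda>t. F y t - f a A t) \<in> L2_unit" by (intro L2_unit_diff Fy fL)
      have "L2_inner (\<lambda>t. F y t - f a A t) (\<psi> k) = L2_inner (F y) (\<psi> k) - s * a * sign_of A k" if k: "k \<in> I" for k
      proof -
        have "L2_inner (f a A) (\<psi> k) = (\<Sum>j\<in>I. (s * (a * sign_of A j)) * L2_inner (\<psi> j) (\<psi> k))"
          unfolding f_def by (rule L2_inner_sum_left[OF psi psi[OF k]])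
        also have "\<dots> = (\<Sum>j\<in>I. if j = k then s * (a * sign_of A j) else 0)"
          using orth k by (intro sum.cong) auto
        also have "\<dots> = s * a * sign_of A k" using k I by simp
        finally show ?thesis using Fy fL psi[OF k] by (simp add: L2_inner_diff_left)
      qed
      then have "(\<Sum>k\<in>I. ennreal ((L2_inner (F y) (\<psi> k) - s * a * sign_of A k)\<^sup>2))
          = ennreal (\<Sum>k\<in>I. (L2_inner (\<lambda>t. F y t - f a A t) (\<psi> k))\<^sup>2)"
        by (simp flip: sum_ennreal)
      also have "\<dots> \<le> L2_norm_sq (\<lambda>t. F y t - f a A t)"
        unfolding L2_norm_sq_eq[OF h] by (intro ennreal_leI Bessel_le[OF I psi orth h])
      finally show "(\<Sum>k\<in>I. ennreal ((L2_inner (F y) (\<psi> k) - s * a * sign_of A k)\<^sup>2)) \<le> L2_norm_sq (\<lambda>t. F y t - f a A t)" .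
    qed
    also have "\<dots> \<le> ennreal \<rho>"
      using risk[of A] A unfolding risk_def by simp
    finally show ?thesis .
  qed
  define r where "r A k = enn2real (?R A k)" for A k
  have r0: "0 \<le> r A k" for A k by (simp add: r_def)
  have r: "?R A k = ennreal (r A k)" if "A \<in> Pow I" "k \<in> I" for A k
  proof -
    have "?R A k \<le> (\<Sum>k\<in>I. ?R A k)" using I that by (intro member_le_sum) auto
    also have "\<dots> < \<infinity>" using Rsum[OF that(1)] by (simp add: le_less_trans)
    finally show ?thesis unfolding r_def by simp
  qed
  have rs: "(\<Sum>k\<in>I. r A k) \<le> \<rho>" if "A \<in> Pow I" for A
  proof -
    have "ennreal (\<Sum>k\<in>I. r A k) = (\<Sum>k\<in>I. ennreal (r A k))"
      using r0 by (intro sum_ennreal[symmetric])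
    also have "\<dots> = (\<Sum>k\<in>I. ?R A k)"
      by (intro sum.cong refl r[symmetric] that)
    also note Rsum[OF that]
    finally show ?thesis using \<rho>0 by (subst (asm) ennreal_le_iff) auto
  qed
  have flipI: "flip k A \<in> Pow I" if "A \<in> Pow I" "k \<in> I" for A k
    using that by (auto simp: flip_def)
  have two: "2 * (s * a)\<^sup>2 * (1 - (\<Sum>i\<in>?J. x A i k)) \<le> r A k + r (flip k A) k" if A: "A \<in> Pow I" and k: "k \<in> I" for A k
  proof -
    have "ennreal ((s * a * sign_of A k - s * a * sign_of (flip k A) k)\<^sup>2 * (1 - (\<Sum>i\<in>?J. x A i k)) / 2) \<le> ?R A k + ?R (flip k A) k"
      using A k x
      by (intro two_point_risk[where L = "\<lambda>i. L A i k"] \<mu>s \<mu>p Ld L0 x0) auto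
    also have "\<dots> = ennreal (r A k + r (flip k A) k)"
      unfolding r[OF A k] r[OF flipI[OF A k] k] using r0 by (intro ennreal_plus[symmetric])
    also have "(s * a * sign_of A k - s * a * sign_of (flip k A) k)\<^sup>2 = 4 * (s * a)\<^sup>2"
      by (simp add: sign_of_flip power_mult_distrib)
    finally have "4 * (s * a)\<^sup>2 * (1 - (\<Sum>i\<in>?J. x A i k)) / 2 \<le> r A k + r (flip k A) k"
      using r0 by (subst (asm) ennreal_le_iff) auto
    then show ?thesis by simp
  qed
  have cardP: "real (card (Pow I)) = ?N" using I by (simp add: card_Pow)
  have "(\<Sum>A\<in>Pow I. \<Sum>k\<in>I. 2 * (s * a)\<^sup>2 * (1 - (\<Sum>i\<in>?J. x A i k))) \<le> (\<Sum>A\<in>Pow I. \<Sum>k\<in>I. r A k + r (flip k A) k)"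
    by (intro sum_mono two)
  also have "\<dots> = (\<Sum>A\<in>Pow I. \<Sum>k\<in>I. r A k) + (\<Sum>A\<in>Pow I. \<Sum>k\<in>I. r (flip k A) k)"
    by (simp only: sum.distrib)
  also have "(\<Sum>A\<in>Pow I. \<Sum>k\<in>I. r (flip k A) k) = (\<Sum>k\<in>I. \<Sum>A\<in>Pow I. r (flip k A) k)"
    by (rule sum.swap)
  also have "(\<Sum>k\<in>I. \<Sum>A\<in>Pow I. r (flip k A) k) = (\<Sum>k\<in>I. \<Sum>A\<in>Pow I. r A k)"
    by (intro sum.cong refl sum_Pow_flip)
  also have "\<dots> = (\<Sum>A\<in>Pow I. \<Sum>k\<in>I. r A k)" by (rule sum.swap)
  also have "(\<Sum>A\<in>Pow I. \<Sum>k\<in>I. r A k) \<le> (\<Sum>A\<in>Pow I. \<rho>)" by (intro sum_mono rs)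
  also have "\<dots> = ?N * \<rho>" by (simp add: cardP)
  finally have up: "(\<Sum>A\<in>Pow I. \<Sum>k\<in>I. 2 * (s * a)\<^sup>2 * (1 - (\<Sum>i\<in>?J. x A i k))) \<le> 2 * (?N * \<rho>)"
    by (simp only: mult_2)
  have lo: "(\<Sum>A\<in>Pow I. \<Sum>k\<in>I. 2 * (s * a)\<^sup>2 * (1 - (\<Sum>i\<in>?J. x A i k)))
      = 2 * (s * a)\<^sup>2 * (?N * real ?d - (\<Sum>i\<in>?J. \<Sum>A\<in>Pow I. \<Sum>k\<in>I. x A i k))"
  proof -
    have "(\<Sum>A\<in>Pow I. \<Sum>k\<in>I. \<Sum>i\<in>?J. x A i k) = (\<Sum>A\<in>Pow I. \<Sum>i\<in>?J. \<Sum>k\<in>I. x A i k)"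
      by (intro sum.cong refl sum.swap)
    also have "\<dots> = (\<Sum>i\<in>?J. \<Sum>A\<in>Pow I. \<Sum>k\<in>I. x A i k)" by (rule sum.swap)
    finally have eq: "(\<Sum>A\<in>Pow I. \<Sum>k\<in>I. \<Sum>i\<in>?J. x A i k) = (\<Sum>i\<in>?J. \<Sum>A\<in>Pow I. \<Sum>k\<in>I. x A i k)" .
    have "(\<Sum>A\<in>Pow I. \<Sum>k\<in>I. (1::real)) = ?N * real ?d" by (simp add: cardP)
    then show ?thesis
      unfolding sum_distrib_left[symmetric] sum_subtractf eq by (simp only:)
  qed
  have "(\<Sum>i\<in>?J. \<Sum>A\<in>Pow I. \<Sum>k\<in>I. x A i k) \<le> (\<Sum>i\<in>?J. ?N * (16 * a\<^sup>2 * (ln 4 * Lb + ln 2) + 576 * exp 8 * real ?d * a^4))"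
  proof (rule sum_mono)
    fix i assume i: "i \<in> ?J"
    have "(\<Sum>A\<in>Pow I. \<Sum>k\<in>I. x A i k) \<le> (\<Sum>A\<in>Pow I. ?b A i)" by (intro sum_mono xs i)
    also have "\<dots> = 16 * a\<^sup>2 * (ln 4 * (\<Sum>A\<in>Pow I. lr A i) + ?N * ln 2) + ?N * (576 * exp 8 * real ?d * a^4)"
      by (simp add: sum.distrib cardP flip: sum_distrib_left)
    also have "\<dots> \<le> 16 * a\<^sup>2 * (ln 4 * (?N * Lb) + ?N * ln 2) + ?N * (576 * exp 8 * real ?d * a^4)"
      using lr_avg[OF i] by (intro add_mono mult_left_mono order_refl) auto
    also have "\<dots> = ?N * (16 * a\<^sup>2 * (ln 4 * Lb + ln 2) + 576 * exp 8 * real ?d * a^4)"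
      by (simp add: algebra_simps)
    finally show "(\<Sum>A\<in>Pow I. \<Sum>k\<in>I. x A i k) \<le> ?N * (16 * a\<^sup>2 * (ln 4 * Lb + ln 2) + 576 * exp 8 * real ?d * a^4)" .
  qed
  then have "(\<Sum>i\<in>?J. \<Sum>A\<in>Pow I. \<Sum>k\<in>I. x A i k) \<le> ?N * (real m * (16 * a\<^sup>2 * (ln 4 * Lb + ln 2) + 576 * exp 8 * real ?d * a^4))"
    by (simp add: mult.left_commute)
  then have "2 * (s * a)\<^sup>2 * (?N * real ?d - ?N * (real m * (16 * a\<^sup>2 * (ln 4 * Lb + ln 2) + 576 * exp 8 * real ?d * a^4)))
      \<le> 2 * (s * a)\<^sup>2 * (?N * real ?d - (\<Sum>i\<in>?J. \<Sum>A\<in>Pow I. \<Sum>k\<in>I. x A i k))"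
    by (intro mult_left_mono) auto
  also have "\<dots> \<le> 2 * (?N * \<rho>)" using up unfolding lo .
  finally have "(2 * ?N) * ((s * a)\<^sup>2 * (real ?d - real m * (16 * a\<^sup>2 * (ln 4 * Lb + ln 2) + 576 * exp 8 * real ?d * a^4))) \<le> (2 * ?N) * \<rho>"
    by (simp add: algebra_simps)
  then have "(s * a)\<^sup>2 * (real ?d - real m * (16 * a\<^sup>2 * (ln 4 * Lb + ln 2) + 576 * exp 8 * real ?d * a^4)) \<le> \<rho>"
    by (rule mult_left_le_imp_le) simp
  then show ?thesis unfolding Lb_def .
qed

section \<open>Choice of the resolution level\<close>

lemma eventually_const_mult_powr_le:
  fixes c e b :: real
  assumes "e < 0" "0 < b"
  shows "\<forall>\<^sub>F n in sequentially. c * real n powr e < b"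
proof -
  have "(\<lambda>n. c * real n powr e) \<longlonglongrightarrow> c * 0"
    by (intro tendsto_mult tendsto_const tendsto_neg_powr assms filterlim_real_sequentially)
  then show ?thesis using assms(2) by (auto dest: order_tendstoD(2))
qed

text \<open>For y \<ge> 1 the floor of y is at least y/2, so either rounding loses at most a factor
  2.\<close>

lemma machine_count_bounds:
  assumes n: "1 \<le> n" and p: "0 < p"
    and m: "m = nat \<lfloor>real n powr p\<rfloor> \<or> m = nat \<lceil>real n powr p\<rceil>"
  shows "1 \<le> m" "real n powr p / 2 \<le> real m"
proof -
  have y: "1 \<le> real n powr p" using n p by (simp add: ge_one_powr_ge_zero)
  then have f1: "1 \<le> \<lfloor>real n powr p\<rfloor>" by simp
  have "real_of_int \<lfloor>real n powr p\<rfloor> \<ge> 1" using f1 by linarith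
  then have "real n powr p / 2 \<le> real_of_int \<lfloor>real n powr p\<rfloor>" by linarith
  moreover have "\<lfloor>real n powr p\<rfloor> \<le> int m" using m f1 by (auto intro: floor_le_ceiling)
  ultimately show "real n powr p / 2 \<le> real m" by linarith
  show "1 \<le> m" using \<open>\<lfloor>real n powr p\<rfloor> \<le> int m\<close> f1 by linarith
qed

text \<open>The dimension d is about n^(r1 - \<kappa>) with \<kappa> = r1 \<tau>, the choice that
  makes m a^2 of order n^\<tau>. Four error terms have to stay below d/8: the mean length needs r2 <
  r1, the cap needs r1 < 2 p, the constant ln 2 needs \<tau> small against r1, and the second order
  term needs \<tau> small against p. The risk is then of order n^(- 2 s1 (r1 - \<kappa>)), a factor
  n^(2 s1 \<kappa>) above n^(- 2 s1 r1); half of this exponent is given away as the slack in the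
  claim.\<close>

lemma level_choice:
  fixes p s1 s2 L C C2 :: real
  assumes p: "0 < p" "p < 1/2" and s1: "1 / (4 * p) - 1/2 < s1" and s2: "s1 < s2"
    and L: "0 < L" and C: "0 < C" and C2: "0 < C2"
  defines "r1 \<equiv> 1 / (1 + 2 * s1)" and "r2 \<equiv> 1 / (1 + 2 * s2)"
  defines "\<tau> \<equiv> min (min (2 * p - r1) (r1 - r2)) p / 10"
  shows "0 < \<tau>" and "0 < s1" and "0 < s1 * (r1 * \<tau>)"
    and "\<forall>\<^sub>F n in sequentially. \<forall>m. m = nat \<lfloor>real n powr p\<rfloor> \<or> m = nat \<lceil>real n powr p\<rceil> \<longrightarrow>
      (\<exists>j a. 1 \<le> j \<and> 0 \<le> a \<and> a \<le> 1/2 \<and> 2^j * a^4 \<le> 1 \<and>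
        2 powr (2 * real j * s1) * (2^j * (sqrt (real m / real n) * a)\<^sup>2) = L\<^sup>2 / 2 \<and>
        C * real n powr (- (2 * s1 / (1 + 2 * s1)) + s1 * (r1 * \<tau>))
          < (sqrt (real m / real n) * a)\<^sup>2 * (2^j - real m * (16 * a\<^sup>2 * (ln 4 * (C2 * real n powr (r2 + \<tau>)
              + (real n powr (r1 + \<tau>) * log 2 (real n)) * (sqrt (2 * 2^j) * a\<^sup>2)) + ln 2) + 576 * exp 8 * 2^j * a^4)))"
proof -
  have "1/2 < 1 / (4 * p)" using p by (simp add: field_simps)
  then show s1p: "0 < s1" using s1 by simp
  \<comment> \<open>The lower bound on \<open>s1\<close> is the same as r1 < 2 p.\<close>
  have "1 < 2 * p * (1 + 2 * s1)"
  proof -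
    have "1 / (4 * p) * (4 * p) < (s1 + 1/2) * (4 * p)"
      using s1 p by (intro mult_strict_right_mono) auto
    then show ?thesis using p by (simp add: algebra_simps)
  qed
  then have g1: "0 < 2 * p - r1" unfolding r1_def using s1p by (simp add: field_simps)
  have g2: "0 < r1 - r2" unfolding r1_def r2_def using s1p s2 by (simp add: frac_less2)
  show \<tau>0: "0 < \<tau>" unfolding \<tau>_def using g1 g2 p by simp
  have t1: "10 * \<tau> \<le> 2 * p - r1" and t2: "10 * \<tau> \<le> r1 - r2" and t3: "10 * \<tau> \<le> p"
    by (simp_all add: \<tau>_def)
  have r1: "0 < r1" "r1 < 1" and r2: "0 < r2" unfolding r1_def r2_def using s1p s2 by auto
  define \<kappa> where "\<kappa> = r1 * \<tau>"
  have \<kappa>: "0 < \<kappa>" "\<kappa> < \<tau>" unfolding \<kappa>_def using r1 \<tau>0 by auto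
  show "0 < s1 * (r1 * \<tau>)" using s1p r1 \<tau>0 by simp
  have inv: "1 + 2 * s1 = 1 / r1" unfolding r1_def by simp
  \<comment> \<open>L^2/2 is the squared norm given to the signal, 2^(1 + 2 s1) pays for rounding
    the dimension to a power of two, and a further factor 2 for rounding \<open>m\<close>.\<close>
  define A where "A = L\<^sup>2 * 2 powr (1 + 2 * s1)"
  have A: "0 < A" unfolding A_def using L by simp
  have E1: "\<forall>\<^sub>F n in sequentially. A * real n powr (\<tau> - p) < 1/4"
    using t3 \<tau>0 by (intro eventually_const_mult_powr_le) auto
  have E2: "\<forall>\<^sub>F n in sequentially. A\<^sup>2 * real n powr (r1 - \<kappa> + 2 * (\<tau> - p)) < 1"
    using t1 \<tau>0 \<kappa> by (intro eventually_const_mult_powr_le) auto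
  have E3: "\<forall>\<^sub>F n in sequentially. (16 * ln 4 * A * C2) * real n powr (2 * \<tau> + r2 - (r1 - \<kappa>)) < 1/16"
    using t2 \<tau>0 \<kappa> by (intro eventually_const_mult_powr_le) auto
  \<comment> \<open>The tightest exponent: it equals (r1/2 - p) + 4 \<tau> + \<kappa>/2, where r1/2
    - p \<le> -5 \<tau> and \<kappa> < \<tau>. The divisor 10 in \<tau> pays for it.\<close>
  have E4: "\<forall>\<^sub>F n in sequentially. (16 * ln 4 * A * (sqrt 2 * A)) * real n powr (\<tau> + (r1 + 2 * \<tau>) + ((r1 - \<kappa>) / 2 + (\<tau> - p)) - (r1 - \<kappa>)) < 1/16"
  proof (rule eventually_const_mult_powr_le)
    show "\<tau> + (r1 + 2 * \<tau>) + ((r1 - \<kappa>) / 2 + (\<tau> - p)) - (r1 - \<kappa>) < 0"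
      unfolding diff_divide_distrib using t1 \<tau>0 \<kappa> by linarith
  qed simp
  have E5: "\<forall>\<^sub>F n in sequentially. (16 * ln 2 * A) * real n powr (\<tau> - (r1 - \<kappa>)) < 1/16"
    using t2 r2 \<tau>0 \<kappa> by (intro eventually_const_mult_powr_le) auto
  have E6: "\<forall>\<^sub>F n in sequentially. (576 * exp 8 * A * A) * real n powr (\<tau> + (\<tau> - p)) < 1/8"
    using t3 \<tau>0 by (intro eventually_const_mult_powr_le) auto
  have E7: "\<forall>\<^sub>F n in sequentially. C * real n powr (- (s1 * \<kappa>)) < L\<^sup>2 / 4"
    using s1p \<kappa> L by (intro eventually_const_mult_powr_le) auto
  have E8: "\<forall>\<^sub>F n in sequentially. log 2 (real n) \<le> real n powr \<tau>"
    using \<tau>0 by real_asymp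
  have E9: "\<forall>\<^sub>F n in sequentially. 2 * real n powr (- (r1 - \<kappa>)) < 1"
    using t2 r2 \<tau>0 \<kappa> by (intro eventually_const_mult_powr_le) auto
  show "\<forall>\<^sub>F n in sequentially. \<forall>m. m = nat \<lfloor>real n powr p\<rfloor> \<or> m = nat \<lceil>real n powr p\<rceil> \<longrightarrow>
      (\<exists>j a. 1 \<le> j \<and> 0 \<le> a \<and> a \<le> 1/2 \<and> 2^j * a^4 \<le> 1 \<and>
        2 powr (2 * real j * s1) * (2^j * (sqrt (real m / real n) * a)\<^sup>2) = L\<^sup>2 / 2 \<and>
        C * real n powr (- (2 * s1 / (1 + 2 * s1)) + s1 * (r1 * \<tau>))
          < (sqrt (real m / real n) * a)\<^sup>2 * (2^j - real m * (16 * a\<^sup>2 * (ln 4 * (C2 * real n powr (r2 + \<tau>)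
              + (real n powr (r1 + \<tau>) * log 2 (real n)) * (sqrt (2 * 2^j) * a\<^sup>2)) + ln 2) + 576 * exp 8 * 2^j * a^4)))"
    using E1 E2 E3 E4 E5 E6 E7 E8 E9 eventually_ge_at_top[of 1]
  proof eventually_elim
    case (elim n)
    define y where "y = real n"
    have y1: "1 \<le> y" using elim(10) by (simp add: y_def)
    then have y0: "0 < y" by simp
    note E = elim(1-9)[folded y_def]
    show ?case
      unfolding y_def[symmetric]
    proof (intro allI impI)
      fix m assume m: "m = nat \<lfloor>y powr p\<rfloor> \<or> m = nat \<lceil>y powr p\<rceil>"
      have m1: "1 \<le> m" and mp: "y powr p / 2 \<le> real m"
        using machine_count_bounds[OF elim(10) p(1), of m] m unfolding y_def by auto
      then have m0: "0 < real m" by simp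
      define X where "X = y powr (r1 - \<kappa>)"
      have X2: "2 < X"
        using E(9) y0 unfolding X_def powr_minus[of y "r1 - \<kappa>"] by (simp add: field_simps)
      \<comment> \<open>The largest power of two below \<open>X\<close>, so that X/2 \<le> d \<le>
        X; X > 2 makes the level positive.\<close>
      define j where "j = nat \<lfloor>log 2 X\<rfloor>"
      have lg: "1 < log 2 X" using X2 by simp
      then have jr: "real j = of_int \<lfloor>log 2 X\<rfloor>" unfolding j_def by simp
      have j1: "1 \<le> j" unfolding j_def using lg by linarith
      define d where "d = (2::real)^j"
      have d0: "0 < d" by (simp add: d_def)
      have dpow: "d = 2 powr real j" unfolding d_def by (simp add: powr_realpow)
      have dX: "d \<le> X"
      proof -
        have "2 powr real j \<le> 2 powr (log 2 X)" unfolding jr by (intro powr_mono) auto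
        then show ?thesis unfolding dpow using X2 by simp
      qed
      have Xd: "X / 2 \<le> d"
      proof -
        have "2 powr (log 2 X) \<le> 2 powr (real j + 1)" unfolding jr by (intro powr_mono) linarith+
        then show ?thesis unfolding dpow using X2 by (simp add: powr_add)
      qed
      \<comment> \<open>The squared coefficient for which the squared Besov norm is L^2/2, strictly
        inside the ball.\<close>
      define q where "q = L\<^sup>2 / 2 * d powr (- (1 + 2 * s1))"
      have q0: "0 < q" unfolding q_def using L d0 by simp
      \<comment> \<open>The same coefficient in units of the noise level sqrt (m/n).\<close>
      define a where "a = sqrt (q * y / real m)"
      have a0: "0 \<le> a" unfolding a_def using q0 y0 by simp
      have a2: "a\<^sup>2 = q * y / real m" unfolding a_def using q0 y0 by simp
      have sa: "(sqrt (real m / y) * a)\<^sup>2 = q"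
        using m0 y0 by (simp add: power_mult_distrib a2)
      have norm: "2 powr (2 * real j * s1) * (d * q) = L\<^sup>2 / 2"
      proof -
        have "2 powr (2 * real j * s1) * d = d powr (1 + 2 * s1)"
          unfolding dpow by (simp add: powr_powr powr_add[symmetric] algebra_simps)
        then have "2 powr (2 * real j * s1) * (d * q) = L\<^sup>2 / 2 * (d powr (1 + 2 * s1) * d powr (- (1 + 2 * s1)))"
          unfolding q_def by (simp add: algebra_simps)
        also have "d powr (1 + 2 * s1) * d powr (- (1 + 2 * s1)) = 1"
          using d0 by (simp flip: powr_add)
        finally show ?thesis by simp
      qed
      have qy: "q * y \<le> A / 2 * y powr \<tau>"
      proof -
        have "d powr (- (1 + 2 * s1)) \<le> (X / 2) powr (- (1 + 2 * s1))"
          using Xd X2 s1p by (intro powr_mono2') auto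
        also have "\<dots> = 2 powr (1 + 2 * s1) * X powr (- (1 + 2 * s1))"
        proof -
          have "(X / 2) powr (- (1 + 2 * s1)) = X powr (- (1 + 2 * s1)) / 2 powr (- (1 + 2 * s1))"
            by (rule powr_divide)
          also have "(2::real) powr (- (1 + 2 * s1)) = inverse (2 powr (1 + 2 * s1))"
            by (rule powr_minus)
          finally show ?thesis by (simp only: divide_inverse inverse_inverse_eq mult.commute)
        qed
        also have "X powr (- (1 + 2 * s1)) = y powr (\<tau> - 1)"
        proof -
          have "(r1 - \<kappa>) * (- (1 + 2 * s1)) = \<tau> - 1"
            unfolding inv \<kappa>_def using r1 by (simp add: field_simps)
          then show ?thesis unfolding X_def by (simp add: powr_powr)
        qed
        finally have "q \<le> L\<^sup>2 / 2 * (2 powr (1 + 2 * s1) * y powr (\<tau> - 1))"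
          unfolding q_def using L by (intro mult_left_mono) auto
        then have "q * y \<le> L\<^sup>2 / 2 * (2 powr (1 + 2 * s1) * y powr (\<tau> - 1)) * y"
          using y0 by (intro mult_right_mono) auto
        also have "\<dots> = A / 2 * (y powr (\<tau> - 1) * y powr 1)"
          unfolding A_def using y0 by simp
        also have "y powr (\<tau> - 1) * y powr 1 = y powr \<tau>"
          by (subst powr_add[symmetric]) simp
        finally show ?thesis .
      qed
      have ma2: "real m * a\<^sup>2 \<le> A * y powr \<tau>"
      proof -
        have "real m * a\<^sup>2 = q * y" unfolding a2 using m0 by simp
        also have "\<dots> \<le> A / 2 * y powr \<tau>" by (rule qy)
        also have "\<dots> \<le> A * y powr \<tau>" using A by (intro mult_right_mono) auto
        finally show ?thesis .
      qed
      have a2le: "a\<^sup>2 \<le> A * y powr (\<tau> - p)"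
      proof -
        have yp: "0 < y powr p" using y0 by simp
        have "a\<^sup>2 \<le> (A / 2 * y powr \<tau>) / (y powr p / 2)"
          unfolding a2 using qy mp yp m0 A by (intro frac_le) auto
        also have "\<dots> = A * y powr (\<tau> - p)" using yp by (simp add: powr_diff)
        finally show ?thesis .
      qed
      have ah: "a \<le> 1/2"
      proof -
        have "a\<^sup>2 \<le> (1/2)\<^sup>2" using a2le E(1) by (simp add: power2_eq_square)
        then show ?thesis by (rule power2_le_imp_le) simp
      qed
      have a4: "a^4 = a\<^sup>2 * a\<^sup>2" by (simp flip: power_add)
      have da4: "d * a^4 \<le> 1"
      proof -
        have "d * (a\<^sup>2 * a\<^sup>2) \<le> X * ((A * y powr (\<tau> - p)) * (A * y powr (\<tau> - p)))"
          using dX d0 a2le A by (intro mult_mono) auto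
        also have "\<dots> = A\<^sup>2 * y powr (r1 - \<kappa> + 2 * (\<tau> - p))"
        proof -
          have "y powr (r1 - \<kappa> + 2 * (\<tau> - p)) = X * (y powr (\<tau> - p) * y powr (\<tau> - p))"
            unfolding X_def by (simp only: powr_add mult_2)
          then show ?thesis by (simp only: power2_eq_square mult_ac)
        qed
        finally show ?thesis unfolding a4 using E(2) by simp
      qed
      have sq: "sqrt (2 * d) * a\<^sup>2 \<le> sqrt 2 * A * y powr ((r1 - \<kappa>) / 2 + (\<tau> - p))"
      proof -
        have "sqrt (2 * d) \<le> sqrt 2 * y powr ((r1 - \<kappa>) / 2)"
        proof -
          have "sqrt d \<le> sqrt X" using dX by simp
          also have "sqrt X = y powr ((r1 - \<kappa>) / 2)"
            unfolding X_def using y0 by (simp add: powr_half_sqrt[symmetric] powr_powr)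
          finally show ?thesis by (simp add: real_sqrt_mult)
        qed
        then have "sqrt (2 * d) * a\<^sup>2 \<le> (sqrt 2 * y powr ((r1 - \<kappa>) / 2)) * (A * y powr (\<tau> - p))"
          using a2le by (intro mult_mono) auto
        then show ?thesis by (simp add: powr_add mult_ac)
      qed
      \<comment> \<open>The threshold 1/16 becomes d/8 because X \<le> 2 d; four terms of this size
        use up half of \<open>d\<close>.\<close>
      have scale: "c * y powr (e + (r1 - \<kappa>)) \<le> d / 8" if "c * y powr e < 1/16" for c e
      proof -
        have "c * y powr (e + (r1 - \<kappa>)) = (c * y powr e) * X" unfolding X_def by (simp add: powr_add)
        also have "\<dots> \<le> 1/16 * X" using that X2 by (intro mult_right_mono) auto
        finally show ?thesis using Xd by simp
      qed
      let ?B = "y powr (r1 + \<tau>) * log 2 y"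
      have lg0: "0 \<le> log 2 y" using y1 by simp
      have Bl: "?B \<le> y powr (r1 + 2 * \<tau>)"
      proof -
        have "?B \<le> y powr (r1 + \<tau>) * y powr \<tau>" using E(8) by (intro mult_left_mono) auto
        also have "\<dots> = y powr (r1 + 2 * \<tau>)" by (simp add: add.commute flip: powr_add)
        finally show ?thesis .
      qed
      have T1: "16 * ln 4 * (real m * a\<^sup>2) * (C2 * y powr (r2 + \<tau>)) \<le> d / 8"
      proof -
        have "16 * ln 4 * (real m * a\<^sup>2) * (C2 * y powr (r2 + \<tau>)) \<le> 16 * ln 4 * (A * y powr \<tau>) * (C2 * y powr (r2 + \<tau>))"
          using ma2 C2 by (intro mult_right_mono mult_left_mono) auto
        also have "\<dots> = (16 * ln 4 * A * C2) * (y powr \<tau> * y powr (r2 + \<tau>))"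
          by (simp only: mult_ac)
        also have "y powr \<tau> * y powr (r2 + \<tau>) = y powr ((2 * \<tau> + r2 - (r1 - \<kappa>)) + (r1 - \<kappa>))"
        proof -
          have "(2 * \<tau> + r2 - (r1 - \<kappa>)) + (r1 - \<kappa>) = \<tau> + (r2 + \<tau>)" by simp
          then show ?thesis by (simp only: powr_add)
        qed
        also have "(16 * ln 4 * A * C2) * \<dots> \<le> d / 8"
          by (rule scale[OF E(3)])
        finally show ?thesis .
      qed
      have T2: "16 * ln 4 * (real m * a\<^sup>2) * (?B * (sqrt (2 * d) * a\<^sup>2)) \<le> d / 8"
      proof -
        have "?B * (sqrt (2 * d) * a\<^sup>2) \<le> y powr (r1 + 2 * \<tau>) * (sqrt 2 * A * y powr ((r1 - \<kappa>) / 2 + (\<tau> - p)))"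
          by (rule mult_mono[OF Bl sq]) (use d0 in auto)
        then have "16 * ln 4 * (real m * a\<^sup>2) * (?B * (sqrt (2 * d) * a\<^sup>2))
            \<le> 16 * ln 4 * (A * y powr \<tau>) * (y powr (r1 + 2 * \<tau>) * (sqrt 2 * A * y powr ((r1 - \<kappa>) / 2 + (\<tau> - p))))"
        proof (rule mult_mono[rotated])
          show "16 * ln 4 * (real m * a\<^sup>2) \<le> 16 * ln 4 * (A * y powr \<tau>)"
            using ma2 by (intro mult_left_mono) auto
        qed (use lg0 d0 A in auto)
        also have "\<dots> = (16 * ln 4 * A * (sqrt 2 * A)) * (y powr \<tau> * y powr (r1 + 2 * \<tau>) * y powr ((r1 - \<kappa>) / 2 + (\<tau> - p)))"
          by (simp only: mult_ac)
        also have "y powr \<tau> * y powr (r1 + 2 * \<tau>) * y powr ((r1 - \<kappa>) / 2 + (\<tau> - p))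
            = y powr ((\<tau> + (r1 + 2 * \<tau>) + ((r1 - \<kappa>) / 2 + (\<tau> - p)) - (r1 - \<kappa>)) + (r1 - \<kappa>))"
          by (simp only: diff_add_cancel powr_add)
        also have "(16 * ln 4 * A * (sqrt 2 * A)) * \<dots> \<le> d / 8"
          by (rule scale[OF E(4)])
        finally show ?thesis .
      qed
      have T3: "16 * ln 2 * (real m * a\<^sup>2) \<le> d / 8"
      proof -
        have "16 * ln 2 * (real m * a\<^sup>2) \<le> 16 * ln 2 * (A * y powr \<tau>)"
          using ma2 by (intro mult_left_mono) auto
        also have "\<dots> = (16 * ln 2 * A) * y powr ((\<tau> - (r1 - \<kappa>)) + (r1 - \<kappa>))"
          by simp
        also have "\<dots> \<le> d / 8" by (rule scale[OF E(5)])
        finally show ?thesis .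
      qed
      have T4: "576 * exp 8 * d * ((real m * a\<^sup>2) * a\<^sup>2) \<le> d / 8"
      proof -
        have "(real m * a\<^sup>2) * a\<^sup>2 \<le> (A * y powr \<tau>) * (A * y powr (\<tau> - p))"
          by (rule mult_mono[OF ma2 a2le]) (use A in auto)
        then have "576 * exp 8 * d * ((real m * a\<^sup>2) * a\<^sup>2) \<le> 576 * exp 8 * d * ((A * y powr \<tau>) * (A * y powr (\<tau> - p)))"
          using d0 by (intro mult_left_mono) auto
        also have "\<dots> = d * ((576 * exp 8 * A * A) * y powr (\<tau> + (\<tau> - p)))"
          by (simp only: powr_add mult_ac)
        also have "\<dots> \<le> d * (1/8)" using E(6) d0 by (intro mult_left_mono) auto
        finally show ?thesis by simp
      qed
      have T: "real m * (16 * a\<^sup>2 * (ln 4 * (C2 * y powr (r2 + \<tau>) + ?B * (sqrt (2 * d) * a\<^sup>2)) + ln 2) + 576 * exp 8 * d * a^4) \<le> d / 2"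
      proof -
        have "real m * (16 * a\<^sup>2 * (ln 4 * (C2 * y powr (r2 + \<tau>) + ?B * (sqrt (2 * d) * a\<^sup>2)) + ln 2) + 576 * exp 8 * d * a^4)
          = 16 * ln 4 * (real m * a\<^sup>2) * (C2 * y powr (r2 + \<tau>)) + 16 * ln 4 * (real m * a\<^sup>2) * (?B * (sqrt (2 * d) * a\<^sup>2))
            + 16 * ln 2 * (real m * a\<^sup>2) + 576 * exp 8 * d * ((real m * a\<^sup>2) * a\<^sup>2)"
          unfolding a4 by (simp only: distrib_left distrib_right mult_ac add_ac)
        with T1 T2 T3 T4 show ?thesis by linarith
      qed
      \<comment> \<open>Half of \<open>d\<close> survives the error terms; the factor y^(- s1
        \<kappa>) left over from the slack beats the constant \<open>C\<close>.\<close>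
      have low: "C * y powr (- (2 * s1 / (1 + 2 * s1)) + s1 * \<kappa>) < q * (d / 2)"
      proof -
        have "q * (d / 2) = L\<^sup>2 / 4 * (d powr (- (1 + 2 * s1)) * d powr 1)"
          unfolding q_def using d0 by simp
        also have "d powr (- (1 + 2 * s1)) * d powr 1 = d powr (- (2 * s1))"
          by (subst powr_add[symmetric]) simp
        finally have qd: "q * (d / 2) = L\<^sup>2 / 4 * d powr (- (2 * s1))" .
        have "y powr (- (2 * s1 * (r1 - \<kappa>))) = X powr (- (2 * s1))"
          unfolding X_def powr_powr by (simp add: mult_ac)
        also have "\<dots> \<le> d powr (- (2 * s1))"
          using dX d0 s1p by (intro powr_mono2') auto
        finally have "L\<^sup>2 / 4 * y powr (- (2 * s1 * (r1 - \<kappa>))) \<le> q * (d / 2)"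
          unfolding qd by (intro mult_left_mono) auto
        moreover have "C * y powr (- (2 * s1 / (1 + 2 * s1)) + s1 * \<kappa>) < L\<^sup>2 / 4 * y powr (- (2 * s1 * (r1 - \<kappa>)))"
        proof -
          have e: "- (2 * s1 / (1 + 2 * s1)) + s1 * \<kappa> = - (s1 * \<kappa>) + (- (2 * s1 * (r1 - \<kappa>)))"
            unfolding r1_def by (simp add: algebra_simps)
          have "C * y powr (- (2 * s1 / (1 + 2 * s1)) + s1 * \<kappa>) = (C * y powr (- (s1 * \<kappa>))) * y powr (- (2 * s1 * (r1 - \<kappa>)))"
            unfolding e powr_add by (simp only: mult.assoc)
          also have "\<dots> < L\<^sup>2 / 4 * y powr (- (2 * s1 * (r1 - \<kappa>)))"
            using E(7) y0 by (intro mult_strict_right_mono) auto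
          finally show ?thesis .
        qed
        ultimately show ?thesis by linarith
      qed
      have "C * y powr (- (2 * s1 / (1 + 2 * s1)) + s1 * (r1 * \<tau>))
          < (sqrt (real m / y) * a)\<^sup>2 * (d - real m * (16 * a\<^sup>2 * (ln 4 * (C2 * y powr (r2 + \<tau>) + ?B * (sqrt (2 * d) * a\<^sup>2)) + ln 2) + 576 * exp 8 * d * a^4))"
        unfolding \<kappa>_def[symmetric] sa
        by (rule less_le_trans[OF low]) (use T q0 in \<open>intro mult_left_mono, auto\<close>)
      then show "\<exists>j a. 1 \<le> j \<and> 0 \<le> a \<and> a \<le> 1/2 \<and> 2^j * a^4 \<le> 1 \<and>
        2 powr (2 * real j * s1) * (2^j * (sqrt (real m / y) * a)\<^sup>2) = L\<^sup>2 / 2 \<and>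
        C * y powr (- (2 * s1 / (1 + 2 * s1)) + s1 * (r1 * \<tau>))
          < (sqrt (real m / y) * a)\<^sup>2 * (2^j - real m * (16 * a\<^sup>2 * (ln 4 * (C2 * y powr (r2 + \<tau>)
              + (y powr (r1 + \<tau>) * log 2 y) * (sqrt (2 * 2^j) * a\<^sup>2)) + ln 2) + 576 * exp 8 * 2^j * a^4))"
        using j1 a0 ah da4 norm unfolding d_def[symmetric] sa[symmetric] by (intro exI[of _ j] exI[of _ a]) (simp add: d_def)
    qed
  qed
qed

theorem theorem2p4:
  fixes p s1 s2 :: real
  assumes "0 < p" "p < 1/2"
    and "1 / (4 * p) - 1/2 < s1" "s1 < s2"
  shows "\<exists>\<epsilon>1>0. \<exists>\<epsilon>2>0. \<forall>L>0. \<forall>N \<psi> \<W>. \<forall>m :: nat \<Rightarrow> nat.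
    cdv_wavelet_basis N \<psi> \<and> s2 < real N \<and> wiener_measure \<W> \<and>
    (\<forall>n. m n = nat \<lfloor>real n powr p\<rfloor> \<or> m n = nat \<lceil>real n powr p\<rceil>) \<longrightarrow>
    \<not> (\<exists>K F.
        (\<forall>n. distributed_estimator (m n) (K n) (F n)) \<and>
        (\<forall>\<^sub>F n in sequentially. \<forall>i\<in>{1..m n}. \<forall>f\<in>L2_unit.
           AE y in message_law \<W> n (m n) (K n) f i.
             real (length y) \<le> real n powr (1 / (1 + 2 * s1) + \<epsilon>1) * log 2 (real n)) \<and>
        (\<forall>s\<in>{s1, s2}.
           (\<exists>C>0. \<forall>\<^sub>F n in sequentially.
              (SUP i\<in>{1..m n}. SUP f\<in>besov_ball \<psi> s L. expected_bits \<W> n (m n) (K n) f i)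
                \<le> ennreal (C * real n powr (1 / (1 + 2 * s) + \<epsilon>1))) \<and>
           (\<exists>C>0. \<forall>\<^sub>F n in sequentially.
              (SUP f\<in>besov_ball \<psi> s L. risk \<W> n (m n) (K n) (F n) f)
                \<le> ennreal (C * real n powr (- (2 * s / (1 + 2 * s)) + \<epsilon>2)))))"
proof -
  define r1 where "r1 = 1 / (1 + 2 * s1)"
  define r2 where "r2 = 1 / (1 + 2 * s2)"
  define \<tau> where "\<tau> = min (min (2 * p - r1) (r1 - r2)) p / 10"
  define \<epsilon> where "\<epsilon> = s1 * (r1 * \<tau>)"
  note choice = level_choice[OF assms, folded r1_def r2_def, folded \<tau>_def]
  have \<tau>: "0 < \<tau>" and \<epsilon>: "0 < \<epsilon>"
    \<comment> \<open>Signs of \<tau> and \<epsilon> do not involve \<open>L\<close> and the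
      constants, so arbitrary positive values are inserted.\<close>
    using choice(1,3)[of 1 1 1] by (auto simp: \<epsilon>_def)
  show ?thesis
  \<comment> \<open>Both witnesses are fixed before \<open>L\<close>, the basis and the estimators,
    and depend on \<open>s1\<close>, \<open>s2\<close> and \<open>p\<close> only.\<close>
  proof (rule exI[of _ \<tau>], rule conjI[OF \<tau>], rule exI[of _ \<epsilon>], rule conjI[OF \<epsilon>], intro allI impI notI)
    fix L :: real and N \<psi> \<W> and m :: "nat \<Rightarrow> nat"
    assume L: "0 < L"
    assume "cdv_wavelet_basis N \<psi> \<and> s2 < real N \<and> wiener_measure \<W> \<and>
      (\<forall>n. m n = nat \<lfloor>real n powr p\<rfloor> \<or> m n = nat \<lceil>real n powr p\<rceil>)"
    then have basis: "cdv_wavelet_basis N \<psi>" and W: "wiener_measure \<W>"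
      and m: "m n = nat \<lfloor>real n powr p\<rfloor> \<or> m n = nat \<lceil>real n powr p\<rceil>" for n
      by auto
    have psi: "\<psi> j k \<in> L2_unit" if "k \<in> wavelet_idx j" for j k
      using basis that unfolding cdv_wavelet_basis_def by blast
    have orth: "L2_inner (\<psi> j k) (\<psi> j' k') = (if j = j' \<and> k = k' then 1 else 0)"
      if "k \<in> wavelet_idx j" "k' \<in> wavelet_idx j'" for j k j' k'
      using basis that unfolding cdv_wavelet_basis_def by blast
    assume "\<exists>K F.
        (\<forall>n. distributed_estimator (m n) (K n) (F n)) \<and>
        (\<forall>\<^sub>F n in sequentially. \<forall>i\<in>{1..m n}. \<forall>f\<in>L2_unit.
           AE y in message_law \<W> n (m n) (K n) f i.
             real (length y) \<le> real n powr (1 / (1 + 2 * s1) + \<tau>) * log 2 (real n)) \<and>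
        (\<forall>s\<in>{s1, s2}.
           (\<exists>C>0. \<forall>\<^sub>F n in sequentially.
              (SUP i\<in>{1..m n}. SUP f\<in>besov_ball \<psi> s L. expected_bits \<W> n (m n) (K n) f i)
                \<le> ennreal (C * real n powr (1 / (1 + 2 * s) + \<tau>))) \<and>
           (\<exists>C>0. \<forall>\<^sub>F n in sequentially.
              (SUP f\<in>besov_ball \<psi> s L. risk \<W> n (m n) (K n) (F n) f)
                \<le> ennreal (C * real n powr (- (2 * s / (1 + 2 * s)) + \<epsilon>))))"
    \<comment> \<open>The mean length is taken from the smoother class and the risk from the rougher
      one; the contradiction lies between these two demands.\<close>
    then obtain K F C C2 where est: "\<And>n. distributed_estimator (m n) (K n) (F n)"
      and bits: "\<forall>\<^sub>F n in sequentially. \<forall>i\<in>{1..m n}. \<forall>f\<in>L2_unit.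
           AE y in message_law \<W> n (m n) (K n) f i. real (length y) \<le> real n powr (r1 + \<tau>) * log 2 (real n)"
      and C2: "0 < C2" and mean_bits: "\<forall>\<^sub>F n in sequentially.
              (SUP i\<in>{1..m n}. SUP f\<in>besov_ball \<psi> s2 L. expected_bits \<W> n (m n) (K n) f i)
                \<le> ennreal (C2 * real n powr (r2 + \<tau>))"
      and C: "0 < C" and risks: "\<forall>\<^sub>F n in sequentially.
              (SUP f\<in>besov_ball \<psi> s1 L. risk \<W> n (m n) (K n) (F n) f)
                \<le> ennreal (C * real n powr (- (2 * s1 / (1 + 2 * s1)) + \<epsilon>))"
      unfolding r1_def r2_def by blast
    have "\<forall>\<^sub>F n in sequentially. False"
      using choice(4)[OF L C C2] bits mean_bits risks eventually_ge_at_top[of 1]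
    proof eventually_elim
      case (elim n)
      let ?s = "sqrt (real (m n) / real n)"
      obtain j a where j: "1 \<le> j" and a: "0 \<le> a" "a \<le> 1/2" "2^j * a^4 \<le> 1"
        and norm: "2 powr (2 * real j * s1) * (2^j * (?s * a)\<^sup>2) = L\<^sup>2 / 2"
        and low: "C * real n powr (- (2 * s1 / (1 + 2 * s1)) + \<epsilon>)
          < (?s * a)\<^sup>2 * (2^j - real (m n) * (16 * a\<^sup>2 * (ln 4 * (C2 * real n powr (r2 + \<tau>)
              + (real n powr (r1 + \<tau>) * log 2 (real n)) * (sqrt (2 * 2^j) * a\<^sup>2)) + ln 2) + 576 * exp 8 * 2^j * a^4))"
        using elim(1) m[of n] unfolding \<epsilon>_def by blast
      let ?I = "{1..2^j :: nat}"
      \<comment> \<open>j \<ge> 1 keeps clear of level 0, which also holds the father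
        function.\<close>
      have idx: "wavelet_idx j = ?I" using j by (simp add: wavelet_idx_def)
      have psiI: "\<psi> j k \<in> L2_unit" if "k \<in> ?I" for k using psi that idx by auto
      have orthI: "L2_inner (\<psi> j k) (\<psi> j k') = (if k = k' then 1 else 0)" if "k \<in> ?I" "k' \<in> ?I" for k k'
        using orth that idx by auto
      have card: "real (card ?I) = 2^j" by simp
      \<comment> \<open>The zero function is as smooth as desired, so the lengths of the messages it
        produces obey the bound for \<open>s2\<close>.\<close>
      have zero: "(\<lambda>x. 0) \<in> besov_ball \<psi> s2 L"
        using L by (simp add: besov_ball_def besov_norm_sq_def L2_unit_zero L2_inner_def)
      have log0: "0 \<le> log 2 (real n)" using elim(5) by simp
      define f where "f A x = (\<Sum>k\<in>?I. (?s * (a * sign_of A k)) * \<psi> j k x)" for A x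
      have fL: "f A \<in> L2_unit" for A
        unfolding f_def[abs_def] by (intro L2_unit_sum psiI)
      have coef: "L2_inner (f A) (\<psi> j' k') = (if j' = j then ?s * (a * sign_of A k') else 0)"
        if k': "k' \<in> wavelet_idx j'" for A j' k'
      proof -
        have "L2_inner (f A) (\<psi> j' k') = (\<Sum>k\<in>?I. (?s * (a * sign_of A k)) * L2_inner (\<psi> j k) (\<psi> j' k'))"
          unfolding f_def[abs_def] by (intro L2_inner_sum_left psiI psi k')
        also have "\<dots> = (\<Sum>k\<in>?I. if k = k' then (if j' = j then ?s * (a * sign_of A k') else 0) else 0)"
          using k' idx by (intro sum.cong refl) (auto simp: orth)
        also have "\<dots> = (if j' = j then ?s * (a * sign_of A k') else 0)"
          using k' idx by (auto simp: sum.delta)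
        finally show ?thesis .
      qed
      \<comment> \<open>By orthonormality only level \<open>j\<close> contributes, with squared norm
        L^2/2; this meets the strict inequality that defines the ball.\<close>
      have fball: "f A \<in> besov_ball \<psi> s1 L" for A
      proof -
        have "ennreal (2 powr (2 * real j' * s1) * (\<Sum>k\<in>wavelet_idx j'. (L2_inner (f A) (\<psi> j' k))\<^sup>2)) \<le> ennreal (L\<^sup>2 / 2)" for j'
        proof (cases "j' = j")
          case True
          have "(\<Sum>k\<in>wavelet_idx j. (L2_inner (f A) (\<psi> j k))\<^sup>2) = (\<Sum>k\<in>?I. (?s * a)\<^sup>2)"
            using coef[of _ j A] by (intro sum.cong idx) (simp add: power_mult_distrib idx)
          then show ?thesis using norm True by simp
        next
          case False
          then have "(\<Sum>k\<in>wavelet_idx j'. (L2_inner (f A) (\<psi> j' k))\<^sup>2) = 0"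
            using coef[of _ j' A] by (intro sum.neutral) auto
          then show ?thesis by simp
        qed
        then have "besov_norm_sq \<psi> s1 (f A) \<le> ennreal (L\<^sup>2 / 2)"
          unfolding besov_norm_sq_def by (rule SUP_least)
        also have "\<dots> < ennreal (L\<^sup>2)" using L by (intro ennreal_lessI) auto
        finally show ?thesis using fL by (simp add: besov_ball_def)
      qed
      have "(?s * a)\<^sup>2 * (real (card ?I) - real (m n) * (16 * a\<^sup>2 * (ln 4 * (C2 * real n powr (r2 + \<tau>)
              + (real n powr (r1 + \<tau>) * log 2 (real n)) * (sqrt (2 * real (card ?I)) * a\<^sup>2)) + ln 2) + 576 * exp 8 * real (card ?I) * a^4))
          \<le> C * real n powr (- (2 * s1 / (1 + 2 * s1)) + \<epsilon>)"
      proof (rule risk_lower_bound[OF W _ psiI orthI est a(1,2)])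
        show "real (card ?I) * a^4 \<le> 1" unfolding card by (rule a(3))
        show "0 \<le> real n powr (r1 + \<tau>) * log 2 (real n)" using log0 by simp
        show "AE y in message_law \<W> n (m n) (K n) (\<lambda>x. 0) i. real (length y) \<le> real n powr (r1 + \<tau>) * log 2 (real n)"
          if "i \<in> {1..m n}" for i
          using elim(2) that L2_unit_zero by blast
        show "expected_bits \<W> n (m n) (K n) (\<lambda>x. 0) i \<le> ennreal (C2 * real n powr (r2 + \<tau>))" if i: "i \<in> {1..m n}" for i
        proof -
          have "expected_bits \<W> n (m n) (K n) (\<lambda>x. 0) i \<le> (SUP f\<in>besov_ball \<psi> s2 L. expected_bits \<W> n (m n) (K n) f i)"
            by (rule SUP_upper[OF zero])
          also have "\<dots> \<le> (SUP i\<in>{1..m n}. SUP f\<in>besov_ball \<psi> s2 L. expected_bits \<W> n (m n) (K n) f i)"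
            by (rule SUP_upper[OF i])
          also note elim(3)
          finally show ?thesis .
        qed
        show "risk \<W> n (m n) (K n) (F n) (\<lambda>x. \<Sum>k\<in>?I. (?s * (a * sign_of A k)) * \<psi> j k x)
            \<le> ennreal (C * real n powr (- (2 * s1 / (1 + 2 * s1)) + \<epsilon>))" for A
          using order_trans[OF SUP_upper[OF fball] elim(4)] unfolding f_def[abs_def] .
      qed (use C C2 in auto)
      with low show False unfolding card by linarith
    qed
    then show False by simp
  qed
qed

end
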